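(* Let $\gamma>1$ and $K\in\mathbb{R}$, and consider the two-sided sonic configuration $(\Omega^\pm,\varphi^\pm,\Gamma_{\rm sonic})$ described in the context. Let $Q=(\xi_*,f(\xi_* ))\in\Gamma_{\rm sonic}$ be a fixed sonic point and let $\psi^Q$ be as defined in the context. If $Q$ is non-exceptional and $\partial^\perp c(Q)=0$, then $\psi^Q$ is twice differentiable at $Q$ across the sonic curve, and there exist sufficiently small positive constants $\varepsilon$ and $\varepsilon_0$ such that $$\psi^Q(Q+t\mathbf n_Q)\ge\Big(\frac1{\gamma+1}-\varepsilon_0\Big)\Big(\frac{\mathbf n_Q\cdot(U,V)(Q)}{c(Q)}\Big)^2t^2\quad\text{for } t\in(-\varepsilon,\varepsilon),$$ $$\psi^Q(Q+s\boldsymbol\tau_Q)\ge\Big(\frac1{\gamma+1}-\varepsilon_0\Big)\Big(\frac{\boldsymbol\tau_Q\cdot(U,V)(Q)}{c(Q)}\Big)^2s^2\quad\text{for } s\in(-\varepsilon,\varepsilon),$$ where $\mathbf n_Q=\frac{(f'(\xi_* ),-1)}{\sqrt{1+(f'(\xi_* ))^2}}$ and $\boldsymbol\tau_Q=\frac{(1,f'(\xi_* ))}{\sqrt{1+(f'(\xi_* ))^2}}$.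
   Context: Equation. Fix $\gamma>1$ and $K\in\mathbb{R}$. In coordinates $(\xi,\eta)\in\mathbb{R}^2$, with $D=(\partial_\xi,\partial_\eta)$, self-similar potential flow is $\mathrm{div}(\rho D\varphi)+2\rho=0$ with $\rho=(K-\varphi-\frac12|D\varphi|^2)^{1/(\gamma-1)}$. The sonic speed $c\ge 0$ is given by $c^2=(\gamma-1)(K-\varphi-\frac12|D\varphi|^2)$. The pseudo-velocity is $(U,V)=D\varphi$ and the velocity is $(u,v)=(U,V)+(\xi,\eta)$. Equivalently, $(c^2-U^2)u_\xi-UV(u_\eta+v_\xi)+(c^2-V^2)v_\eta=0$, $u_\eta=v_\xi$, and $\frac{c^2}{\gamma-1}+\frac{U^2+V^2}{2}+\varphi=K$. The solution is (pseudo-)supersonic where $|D\varphi|>c$, (pseudo-)subsonic where $|D\varphi|<c$, and a point is (pseudo-)sonic if $|D\varphi|=c$. Configuration. $\Omega^-$ and $\Omega^+$ are the supersonic and subsonic regions, lying on the two sides of the curve formed by all sonic points; $\Gamma_{\rm sonic}$ denotes the relative interior of that curve. $\varphi^-\in C^2(\overline{\Omega^-})$ is a supersonic solution in $\Omega^-$, $\varphi^+\in C^2(\Omega^+\cup\Gamma_{\rm sonic})$ is a subsonic solution in $\Omega^+$, and $\varphi^+=\varphi^-$, $D\varphi^+=D\varphi^-$ on $\Gamma_{\rm sonic}$. Write $\varphi=\varphi^\pm$ on the respective sides. For each $Q\in\Gamma_{\rm sonic}$, in suitable (rotated) coordinates $(\xi,\eta)$ (the equations are invariant under rotation) there is $r>0$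 such that $\Gamma_{\rm sonic}\cap B_r(Q)=\{\eta=f(\xi)\}\cap B_r(Q)$ with $f\in C^{1,1}((l_1,l_2))$, $l_1<l_2$. Notation. $\partial^\perp=V\partial_\xi-U\partial_\eta$; derivatives of $c$ at points of $\Gamma_{\rm sonic}$ are one-sided. A point $(\xi,f(\xi))\in\Gamma_{\rm sonic}$ is exceptional if $(U,V)(\xi,f(\xi))$ is normal to $\Gamma_{\rm sonic}$ there, i.e. $U+f'(\xi)V=0$; otherwise it is non-exceptional. Definition of $\psi^Q$. For $Q=(\xi_*,\eta_* )\in\Gamma_{\rm sonic}$, $\eta_*=f(\xi_* )$, put $(u_2^Q,v_2^Q)=D\varphi(Q)+(\xi_*,\eta_* )$, $$\varphi_2^Q(\xi,\eta)=-\tfrac12\big((\xi^2+\eta^2)-(\xi_*^2+\eta_*^2)\big)+u_2^Q(\xi-\xi_* )+v_2^Q(\eta-\eta_* )+\varphi(Q),$$ and $\psi^Q=\varphi-\varphi_2^Q$ (with $\varphi=\varphi^\pm$ on the respective sides of $\Gamma_{\rm sonic}$). *)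

theory Defs
  imports "HOL-Analysis.Analysis"
begin

type_synonym plane = "real \<times> real"

definition pd1 :: "(plane \<Rightarrow> real) \<Rightarrow> plane \<Rightarrow> real" where
  "pd1 \<phi> p = deriv (\<lambda>x. \<phi> (x, snd p)) (fst p)"

definition pd2 :: "(plane \<Rightarrow> real) \<Rightarrow> plane \<Rightarrow> real" where
  "pd2 \<phi> p = deriv (\<lambda>y. \<phi> (fst p, y)) (snd p)"

definition grad :: "(plane \<Rightarrow> real) \<Rightarrow> plane \<Rightarrow> plane" where
  "grad \<phi> p = (pd1 \<phi> p, pd2 \<phi> p)"

definition divergence :: "(plane \<Rightarrow> plane) \<Rightarrow> plane \<Rightarrow> real" where
  "divergence F p = pd1 (\<lambda>q. fst (F q)) p + pd2 (\<lambda>q. snd (F q)) p"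

(* Value of g at p, taken from within the open set \<Omega>: on \<Omega> it is g p, at a boundary point it is the
   limit from \<Omega>.  Used for the boundary values of derivatives, so that derivatives at points of
   the sonic curve are one-sided. *)
definition value_from :: "plane set \<Rightarrow> (plane \<Rightarrow> real) \<Rightarrow> plane \<Rightarrow> real" where
  "value_from \<Omega> g p = (if p \<in> \<Omega> then g p else Lim (at p within \<Omega>) g)"

definition grad_from :: "plane set \<Rightarrow> (plane \<Rightarrow> real) \<Rightarrow> plane \<Rightarrow> plane" where
  "grad_from \<Omega> \<phi> p = (value_from \<Omega> (pd1 \<phi>) p, value_from \<Omega> (pd2 \<phi>) p)"

(* \<phi> is of class C^2 in the open set \<Omega>, and \<phi> and all its partial derivatives of order at most 2
   extend continuously from \<Omega> to S.  With S = closure \<Omega> this is the usual class of C^2 functions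
   on the closure of \<Omega>. *)
definition C2_upto :: "plane set \<Rightarrow> plane set \<Rightarrow> (plane \<Rightarrow> real) \<Rightarrow> bool" where
  "C2_upto \<Omega> S \<phi> \<longleftrightarrow>
     open \<Omega> \<and> \<Omega> \<subseteq> S \<and> S \<subseteq> closure \<Omega> \<and>
     \<phi> differentiable_on \<Omega> \<and> pd1 \<phi> differentiable_on \<Omega> \<and> pd2 \<phi> differentiable_on \<Omega> \<and>
     continuous_on S \<phi> \<and>
     (\<forall>g \<in> {pd1 \<phi>, pd2 \<phi>, pd1 (pd1 \<phi>), pd2 (pd1 \<phi>), pd1 (pd2 \<phi>), pd2 (pd2 \<phi>)}.
        continuous_on S (value_from \<Omega> g))"

(* K - \<phi> - |D\<phi>|^2/2, with D\<phi> taken from within \<Omega>. *)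
definition bernoulli :: "real \<Rightarrow> plane set \<Rightarrow> (plane \<Rightarrow> real) \<Rightarrow> plane \<Rightarrow> real" where
  "bernoulli K \<Omega> \<phi> p = K - \<phi> p - (norm (grad_from \<Omega> \<phi> p))\<^sup>2 / 2"

definition density :: "real \<Rightarrow> real \<Rightarrow> plane set \<Rightarrow> (plane \<Rightarrow> real) \<Rightarrow> plane \<Rightarrow> real" where
  "density \<gamma> K \<Omega> \<phi> p = bernoulli K \<Omega> \<phi> p powr (1 / (\<gamma> - 1))"

definition sonic_speed :: "real \<Rightarrow> real \<Rightarrow> plane set \<Rightarrow> (plane \<Rightarrow> real) \<Rightarrow> plane \<Rightarrow> real" where
  "sonic_speed \<gamma> K \<Omega> \<phi> p = sqrt ((\<gamma> - 1) * bernoulli K \<Omega> \<phi> p)"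

definition potential_flow :: "real \<Rightarrow> real \<Rightarrow> plane set \<Rightarrow> (plane \<Rightarrow> real) \<Rightarrow> bool" where
  "potential_flow \<gamma> K \<Omega> \<phi> \<longleftrightarrow>
     (\<forall>p\<in>\<Omega>. bernoulli K \<Omega> \<phi> p \<ge> 0 \<and>
        (\<lambda>q. density \<gamma> K \<Omega> \<phi> q *\<^sub>R grad \<phi> q) differentiable (at p) \<and>
        divergence (\<lambda>q. density \<gamma> K \<Omega> \<phi> q *\<^sub>R grad \<phi> q) p + 2 * density \<gamma> K \<Omega> \<phi> p = 0)"

definition rot :: "real \<Rightarrow> plane \<Rightarrow> plane" where
  "rot \<theta> p = (cos \<theta> * fst p - sin \<theta> * snd p, sin \<theta> * fst p + cos \<theta> * snd p)"

definition C11_on :: "real \<Rightarrow> real \<Rightarrow> (real \<Rightarrow> real) \<Rightarrow> bool" where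
  "C11_on l1 l2 f \<longleftrightarrow>
     f differentiable_on {l1<..<l2} \<and>
     (\<forall>a b. l1 < a \<and> b < l2 \<longrightarrow> (\<exists>L. L-lipschitz_on {a..b} (deriv f)))"

(* In the coordinates (\<xi>,\<eta>) rotated by the angle \<theta>, \<Gamma> is near Q the graph of f, with \<Omega>m on one
   side of it and \<Omega>p on the other. *)
definition sonic_chart ::
  "plane set \<Rightarrow> plane set \<Rightarrow> plane set \<Rightarrow> plane \<Rightarrow> real \<Rightarrow> (real \<Rightarrow> real) \<Rightarrow> real \<Rightarrow> real \<Rightarrow> real \<Rightarrow> bool"
where
  "sonic_chart \<Omega>m \<Omega>p \<Gamma> Q \<theta> f l1 l2 r \<longleftrightarrow>
     l1 < l2 \<and> 0 < r \<and> C11_on l1 l2 f \<and>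
     \<Gamma> \<inter> ball Q r = {rot \<theta> (\<xi>, f \<xi>) | \<xi>. l1 < \<xi> \<and> \<xi> < l2} \<inter> ball Q r \<and>
     (let below = {rot \<theta> (\<xi>, \<eta>) | \<xi> \<eta>. l1 < \<xi> \<and> \<xi> < l2 \<and> \<eta> < f \<xi>} \<inter> ball Q r;
          above = {rot \<theta> (\<xi>, \<eta>) | \<xi> \<eta>. l1 < \<xi> \<and> \<xi> < l2 \<and> f \<xi> < \<eta>} \<inter> ball Q r
      in below \<subseteq> \<Omega>m \<and> above \<subseteq> \<Omega>p \<or> below \<subseteq> \<Omega>p \<and> above \<subseteq> \<Omega>m)"

definition sonic_configuration ::
  "real \<Rightarrow> real \<Rightarrow> plane set \<Rightarrow> plane set \<Rightarrow> plane set \<Rightarrow> (plane \<Rightarrow> real) \<Rightarrow> (plane \<Rightarrow> real) \<Rightarrow> bool"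
where
  "sonic_configuration \<gamma> K \<Omega>m \<Omega>p \<Gamma> \<phi>m \<phi>p \<longleftrightarrow>
     \<Omega>m \<inter> \<Omega>p = {} \<and>
     C2_upto \<Omega>m (closure \<Omega>m) \<phi>m \<and> potential_flow \<gamma> K \<Omega>m \<phi>m \<and>
     (\<forall>p\<in>\<Omega>m. norm (grad \<phi>m p) > sonic_speed \<gamma> K \<Omega>m \<phi>m p) \<and>
     C2_upto \<Omega>p (\<Omega>p \<union> \<Gamma>) \<phi>p \<and> potential_flow \<gamma> K \<Omega>p \<phi>p \<and>
     (\<forall>p\<in>\<Omega>p. norm (grad \<phi>p p) < sonic_speed \<gamma> K \<Omega>p \<phi>p p) \<and>
     (\<forall>p\<in>\<Gamma>. \<phi>p p = \<phi>m p \<and> grad_from \<Omega>p \<phi>p p = grad_from \<Omega>m \<phi>m p \<and>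
            norm (grad_from \<Omega>m \<phi>m p) = sonic_speed \<gamma> K \<Omega>m \<phi>m p) \<and>
     (\<forall>Q\<in>\<Gamma>. \<exists>\<theta> f l1 l2 r. sonic_chart \<Omega>m \<Omega>p \<Gamma> Q \<theta> f l1 l2 r)"

(* The common potential; only its values on \<Omega>m, \<Omega>p and the sonic curve are meaningful. *)
definition glue :: "plane set \<Rightarrow> (plane \<Rightarrow> real) \<Rightarrow> (plane \<Rightarrow> real) \<Rightarrow> plane \<Rightarrow> real" where
  "glue \<Omega>m \<phi>m \<phi>p p = (if p \<in> \<Omega>m then \<phi>m p else \<phi>p p)"

(* \<phi>_2^Q as a function of the point Q, the value z = \<phi>(Q) and the gradient w = D\<phi>(Q). *)
definition phi2 :: "plane \<Rightarrow> real \<Rightarrow> plane \<Rightarrow> plane \<Rightarrow> real" where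
  "phi2 Q z w p =
     (let u2 = fst w + fst Q; v2 = snd w + snd Q in
      - (1/2) * (((fst p)\<^sup>2 + (snd p)\<^sup>2) - ((fst Q)\<^sup>2 + (snd Q)\<^sup>2))
      + u2 * (fst p - fst Q) + v2 * (snd p - snd Q) + z)"

definition psi :: "plane set \<Rightarrow> (plane \<Rightarrow> real) \<Rightarrow> (plane \<Rightarrow> real) \<Rightarrow> plane \<Rightarrow> plane \<Rightarrow> real" where
  "psi \<Omega>m \<phi>m \<phi>p Q p =
     glue \<Omega>m \<phi>m \<phi>p p - phi2 Q (glue \<Omega>m \<phi>m \<phi>p Q) (grad_from \<Omega>m \<phi>m Q) p"

(* (V \<partial>_\<xi> - U \<partial>_\<eta>) c at Q, with all derivatives taken from within \<Omega>. *)
definition perp_deriv_c :: "real \<Rightarrow> real \<Rightarrow> plane set \<Rightarrow> (plane \<Rightarrow> real) \<Rightarrow> plane \<Rightarrow> real" where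
  "perp_deriv_c \<gamma> K \<Omega> \<phi> Q =
     (let U = fst (grad_from \<Omega> \<phi> Q); V = snd (grad_from \<Omega> \<phi> Q);
          Dc = grad_from \<Omega> (sonic_speed \<gamma> K \<Omega> \<phi>) Q
      in V * fst Dc - U * snd Dc)"

definition tau_vec :: "real \<Rightarrow> (real \<Rightarrow> real) \<Rightarrow> real \<Rightarrow> plane" where
  "tau_vec \<theta> f \<xi> = rot \<theta> ((1 / sqrt (1 + (deriv f \<xi>)\<^sup>2)) *\<^sub>R (1, deriv f \<xi>))"

definition n_vec :: "real \<Rightarrow> (real \<Rightarrow> real) \<Rightarrow> real \<Rightarrow> plane" where
  "n_vec \<theta> f \<xi> = rot \<theta> ((1 / sqrt (1 + (deriv f \<xi>)\<^sup>2)) *\<^sub>R (deriv f \<xi>, - 1))"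

(* The gradient W at the point of the graph over \<xi> is normal to the graph.  For \<theta> = 0 and
   W = (U, V) the equation reads U + f'(\<xi>) V = 0. *)
definition exceptional :: "real \<Rightarrow> (real \<Rightarrow> real) \<Rightarrow> real \<Rightarrow> plane \<Rightarrow> bool" where
  "exceptional \<theta> f \<xi> W \<longleftrightarrow> W \<bullet> rot \<theta> (1, deriv f \<xi>) = 0"

definition twice_differentiable_at :: "(plane \<Rightarrow> real) \<Rightarrow> plane \<Rightarrow> bool" where
  "twice_differentiable_at g Q \<longleftrightarrow>
     (\<forall>\<^sub>F p in nhds Q. g differentiable (at p)) \<and> grad g differentiable (at Q)"

end

theory Submission
  imports Defs
begin

text \<open>
Put \<open>M = I + D\<^sup>2\<phi>\<close>, which is the Hessian of \<open>\<psi>\<close>, and \<open>N = c\<^sup>2 I - W W\<^sup>T\<close> with \<open>W = D\<phi>\<close>; the equation reads \<open>N : M = 0\<close>.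
Since \<open>D\<phi>\<close> is continuous across the sonic curve, the jump of \<open>M\<close> at \<open>Q\<close> has the form \<open>\<lambda> n n\<^sup>T\<close>, and the equation gives
\<open>\<lambda> (c\<^sup>2 - (W \<bullet> n)\<^sup>2) = 0\<close>, so there is no jump at a non-exceptional point. A vanishing \<open>\<partial>\<^sup>\<bottom>c\<close> makes \<open>W\<close> an eigenvector
of \<open>M\<close>; the equation then makes the other eigenvalue zero, and differentiating \<open>|W|\<^sup>2 = c\<^sup>2\<close> along the curve
yields \<open>M = 2 / (\<gamma> + 1) * W W\<^sup>T / c\<^sup>2\<close>. Second-order Taylor expansion gives the bound in every direction \<open>v\<close> with \<open>v \<bullet> W \<noteq> 0\<close>.

In a direction with \<open>v \<bullet> W = 0\<close> Taylor expansion says nothing, so it has to be shown that \<open>W\<close> is never tangent to the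
curve at such a point. This is a Hopf boundary argument on the subsonic side. In coordinates with \<open>x\<close> along \<open>W\<close>, let \<open>P\<close>
be the first-order Taylor polynomial of \<open>\<phi>\<^sub>x\<close> at \<open>Q\<close> minus \<open>\<phi>\<^sub>x\<close>. Subsonicity forces \<open>P \<ge> c\<^sub>0 y\<^sup>2\<close> up to small errors, and \<open>P\<close>
solves the \<open>x\<close>-derivative of the equation in a weak sense, obtained from difference quotients. Comparison with a quadratic
barrier of positive slope gives \<open>P\<^sub>y(Q) > 0\<close>, whereas \<open>P\<^sub>y(Q) = - M\<^sub>x\<^sub>y(Q) = 0\<close>.
\<close>

section \<open>A viscosity form of the differentiated equation\<close>

text \<open>The obstacle is the lack of regularity: \<phi> is only C^2, so \<open>P\<close> is only
  C^1 and the equation cannot be differentiated pointwise. Moreover the equation for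
  \<open>P\<close> degenerates at the sonic point: the coefficient of its second x-derivative is
  \<open>C - U^2\<close>, which vanishes there. Two facts make a comparison possible. The
  coefficient is of order \<open>y0^2\<close> at those points of the region where \<open>P\<close>
  lies below the barrier, and only such points have to be excluded. And at a contact point the first
  derivatives of \<open>P\<close> are those of the barrier, so the lower-order terms are small
  multiples of its slope. The sign of \<open>P\<close> comes from subsonicity:
  \<open>C - U^2\<close> exceeds \<open>V^2\<close>, and \<open>V\<close> is close to
  \<open>- y\<close> because the second eigenvalue of the Hessian of \<psi> is zero, whence
  \<open>P\<close> is at least about \<open>y^2 / (\<gamma> + 1)\<close>. The vanishing mixed
  derivative is used only through \<open>P (0, y) = o(y)\<close>, against a barrier that is linear
  in \<open>y\<close>.\<close>

abbreviation lin :: "real \<Rightarrow> real \<Rightarrow> plane \<Rightarrow> real" where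
  "lin A B \<equiv> \<lambda>h. A * fst h + B * snd h"

text \<open>Only the derivative of \<open>k'\<close> at the maximum itself is available. If
  \<open>\<kappa>\<close> were positive, \<open>k'\<close> would be positive just to the right of 0,
  and the mean value theorem would lift \<open>k\<close> above \<open>k 0\<close>.\<close>

lemma second_derivative_local_max:
  fixes k k' :: "real \<Rightarrow> real"
  assumes "e > 0" and k: "\<And>t. \<bar>t\<bar> < e \<Longrightarrow> (k has_real_derivative k' t) (at t)"
    and k': "(k' has_real_derivative \<kappa>) (at 0)" and mx: "\<And>t. \<bar>t\<bar> < e \<Longrightarrow> k t \<le> k 0"
  shows "\<kappa> \<le> 0"
proof (rule ccontr)
  assume "\<not> \<kappa> \<le> 0"
  then obtain d where d: "d > 0" "\<And>h. 0 < h \<Longrightarrow> h < d \<Longrightarrow> k' 0 < k' (0 + h)"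
    using DERIV_pos_inc_right[OF k'] by (meson not_le)
  have k0: "k' 0 = 0"
    using DERIV_local_max[OF k[of 0] \<open>e > 0\<close>] mx \<open>e > 0\<close> by simp
  define h where "h = min d e / 2"
  have h: "0 < h" "h < d" "h < e" using d \<open>e > 0\<close> by (auto simp: h_def)
  have "\<exists>z>0. z < h \<and> k h - k 0 = (h - 0) * k' z"
    by (rule MVT2) (use h k in auto)
  then obtain z where "0 < z" "z < h" "k h - k 0 = h * k' z" by auto
  moreover have "k' z > 0" using d(2)[of z] k0 \<open>0 < z\<close> \<open>z < h\<close> h by simp
  ultimately show False using mx[of h] h by (smt (verit) mult_pos_pos)
qed

lemma has_real_derivative_along_line:
  fixes F :: "plane \<Rightarrow> real"
  assumes "(F has_derivative (lin A B)) (at (p + t *\<^sub>R v))"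
  shows "((\<lambda>t. F (p + t *\<^sub>R v)) has_real_derivative (A * fst v + B * snd v)) (at t)"
proof -
  have "((\<lambda>t. p + t *\<^sub>R v) has_derivative (\<lambda>h. h *\<^sub>R v)) (at t)"
    by (auto intro!: derivative_eq_intros)
  from has_derivative_compose[OF this assms]
  show ?thesis unfolding has_field_derivative_def
    by (rule back_subst[of "\<lambda>G. (_ has_derivative G) _"]) (auto simp: algebra_simps fun_eq_iff)
qed

text \<open>The base points move because they will be maximum points of varying functions. The mean
  value theorem writes the quotient as \<open>A\<close> at a point between \<open>p n\<close> and
  its shift, and continuity of \<open>A\<close> at \<open>ps\<close> does the rest.\<close>

lemma difference_quotient_tendsto:
  fixes F A B :: "plane \<Rightarrow> real" and p :: "nat \<Rightarrow> plane" and h :: "nat \<Rightarrow> real"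
  assumes D: "open D" and F: "\<And>p. p \<in> D \<Longrightarrow> (F has_derivative (lin (A p) (B p))) (at p)"
    and A: "continuous_on D A" and p: "p \<longlonglongrightarrow> ps" "ps \<in> D" and h: "h \<longlonglongrightarrow> 0" "\<And>n. h n > 0"
  shows "(\<lambda>n. (F (p n + (h n, 0)) - F (p n)) / h n) \<longlonglongrightarrow> A ps"
proof -
  obtain r where r: "r > 0" "ball ps r \<subseteq> D" using D p(2) openE by blast
  have ev: "\<forall>\<^sub>F n in sequentially. \<exists>z>0. z < h n \<and> F (p n + (h n, 0)) - F (p n) = h n * A (p n + (z, 0))"
  proof -
    have "\<forall>\<^sub>F n in sequentially. dist (p n) ps < r / 2" "\<forall>\<^sub>F n in sequentially. dist (h n) 0 < r / 2"
      using tendstoD[OF p(1), of "r/2"] tendstoD[OF h(1), of "r/2"] r by auto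
    then show ?thesis
    proof eventually_elim
      case (elim n)
      have inD: "p n + t *\<^sub>R (1, 0) \<in> D" if "0 \<le> t" "t \<le> h n" for t
      proof -
        have "dist ps (p n + t *\<^sub>R (1, 0)) \<le> dist ps (p n) + norm (t *\<^sub>R (1::real, 0::real))"
          by (metis add_diff_cancel_left' dist_norm dist_triangle norm_minus_commute)
        also have "\<dots> < r" using elim that h(2)[of n] by (auto simp: dist_commute norm_Pair)
        finally show ?thesis using r by auto
      qed
      have "\<exists>z>0. z < h n \<and> F (p n + h n *\<^sub>R (1, 0)) - F (p n + 0 *\<^sub>R (1, 0))
           = (h n - 0) * (A (p n + z *\<^sub>R (1, 0)) * fst (1::real, 0::real) + B (p n + z *\<^sub>R (1, 0)) * snd (1::real, 0::real))"
        by (rule MVT2[OF h(2) has_real_derivative_along_line[OF F[OF inD]]]) auto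
      then show ?case by (simp add: zero_prod_def[symmetric])
    qed
  qed
  define z where "z n = (SOME z. z > 0 \<and> z < h n \<and> F (p n + (h n, 0)) - F (p n) = h n * A (p n + (z, 0)))" for n
  have z: "\<forall>\<^sub>F n in sequentially. z n > 0 \<and> z n < h n \<and> F (p n + (h n, 0)) - F (p n) = h n * A (p n + (z n, 0))"
    using ev
  proof eventually_elim
    case (elim n)
    then show ?case unfolding z_def by (rule someI_ex)
  qed
  have "z \<longlonglongrightarrow> 0"
    by (rule tendsto_sandwich[OF _ _ tendsto_const h(1)]) (use z in \<open>auto elim: eventually_mono\<close>)
  then have "(\<lambda>n. p n + (z n, 0)) \<longlonglongrightarrow> ps + (0, 0)"
    by (intro tendsto_intros p)
  moreover have "isCont A ps" using A D p(2) continuous_on_eq_continuous_at by blast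
  ultimately have "(\<lambda>n. A (p n + (z n, 0))) \<longlonglongrightarrow> A ps"
    using isCont_tendsto_compose[of ps A] by (simp add: zero_prod_def[symmetric])
  then show ?thesis
    by (rule Lim_transform_eventually) (use z h(2) in \<open>auto elim!: eventually_mono simp: less_imp_neq\<close>)
qed

locale C2_potential =
  fixes D :: "plane set" and \<phi> U V a b d :: "plane \<Rightarrow> real" and s K :: real
  assumes open_D: "open D"
    and der_\<phi>: "\<And>p. p \<in> D \<Longrightarrow> (\<phi> has_derivative (lin (U p) (V p))) (at p)"
    and der_U: "\<And>p. p \<in> D \<Longrightarrow> (U has_derivative (lin (a p) (b p))) (at p)"
    and der_V: "\<And>p. p \<in> D \<Longrightarrow> (V has_derivative (lin (b p) (d p))) (at p)"
    and cont: "continuous_on D a" "continuous_on D b" "continuous_on D d"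
begin

text \<open>The square of the sonic speed, with \<open>s\<close> in the role of
  \<open>\<gamma> - 1\<close>; \<open>Cx\<close> is its x-derivative.\<close>

definition C :: "plane \<Rightarrow> real" where
  "C p = s * (K - \<phi> p - ((U p)^2 + (V p)^2) / 2)"

definition Cx :: "plane \<Rightarrow> real" where
  "Cx p = - s * (U p + U p * a p + V p * b p)"

lemma cont_U: "continuous_on D U" and cont_V: "continuous_on D V" and cont_\<phi>: "continuous_on D \<phi>"
  using der_U der_V der_\<phi> by (meson continuous_at_imp_continuous_on has_derivative_continuous)+

lemma der_C: "p \<in> D \<Longrightarrow> (C has_derivative (lin (Cx p) (- s * (V p + U p * b p + V p * d p)))) (at p)"
  unfolding C_def[abs_def] Cx_def
  by (rule derivative_eq_intros der_U der_V der_\<phi> | assumption | rule refl | (simp; fail))+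
    (auto simp: fun_eq_iff algebra_simps power2_eq_square)

lemma cont_C: "continuous_on D C"
  using der_C by (meson continuous_at_imp_continuous_on has_derivative_continuous)

text \<open>\<open>U\<close> is only C^1, so a maximum of \<open>U + z\<close> yields no
  second-order condition by itself. The x-difference quotients of \<phi> are twice differentiable
  and approximate \<open>U\<close>: after adding \<open>z\<close>, each has an interior maximum,
  where the gradient vanishes and the Hessian is nonpositive. Combining this with the equation at
  both ends of the quotient and passing to the limit gives the inequality that the differentiated
  equation would give at a touching point.\<close>

lemma contact_point:
  assumes Kc: "compact Kc" "Kc \<subseteq> D" "open G" "G \<subseteq> Kc" "p0 \<in> Kc"
    and sub: "\<And>p. p \<in> D \<Longrightarrow> (U p)^2 + (V p)^2 < C p"
    and pde: "\<And>p. p \<in> D \<Longrightarrow>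
      (C p - (U p)^2) * (1 + a p) - 2 * U p * V p * b p + (C p - (V p)^2) * (1 + d p) = 0"
    and z: "\<And>p. z p = z0 + z1 * fst p + z2 * snd p + z11 * (fst p)^2 / 2 + z22 * (snd p)^2 / 2"
    and bd: "\<And>p. p \<in> Kc - G \<Longrightarrow> U p + z p < U p0 + z p0"
  obtains p where "p \<in> Kc" "U p0 + z p0 \<le> U p + z p"
    "a p + z1 + z11 * fst p = 0" "b p + z2 + z22 * snd p = 0"
    "(C p - (U p)^2) * z11 + (C p - (V p)^2) * z22 \<le>
       (Cx p - 2 * U p * a p) * (1 + a p) - 2 * (a p * V p + U p * b p) * b p
       + (Cx p - 2 * V p * b p) * (1 + d p)"
proof -
  obtain \<eta> where \<eta>: "\<eta> > 0" "(\<Union>x\<in>Kc. cball x \<eta>) \<subseteq> D"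
    using compact_subset_open_imp_cball_epsilon_subset[OF Kc(1) open_D Kc(2)] by blast
  \<comment> \<open>The denominator \<open>n + 2\<close> gives \<open>h n < \<eta>\<close> for every
    \<open>n\<close>, so the shift keeps all of \<open>Kc\<close> inside \<open>D\<close>.\<close>
  define h where "h n = \<eta> / real (n + 2)" for n
  have h0: "h n > 0" "h n < \<eta>" for n using \<eta> by (auto simp: h_def field_simps intro!: add_pos_nonneg)
  have hlim: "h \<longlonglongrightarrow> 0"
    unfolding h_def using LIMSEQ_ignore_initial_segment[OF lim_const_over_n[of \<eta>], of 2] by simp
  have inD: "p + (h n, 0) \<in> D" if "p \<in> Kc" for p n
  proof -
    have "p + (h n, 0) \<in> cball p \<eta>" using h0[of n] by (simp add: dist_norm norm_Pair)
    then show ?thesis using \<eta>(2) that by blast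
  qed
  have KD: "p \<in> D" if "p \<in> Kc" for p using Kc(2) that by blast
  \<comment> \<open>The smoother replacement for \<open>U + z\<close>, to which the maximum
    conditions of second order apply.\<close>
  define Z where "Z n p = (\<phi> (p + (h n, 0)) - \<phi> p) / h n + z p" for n p
  have shift: "(\<lambda>p. p + (h n, 0)) ` Kc \<subseteq> D" for n using inD by auto
  have zc: "continuous_on A z" for A
    unfolding z by (intro continuous_intros) auto
  have Zc: "continuous_on Kc (Z n)" for n
    unfolding Z_def
    by (intro continuous_intros zc continuous_on_compose2[OF cont_\<phi> _ shift] continuous_on_subset[OF cont_\<phi> Kc(2)])
       (use h0[of n] in auto)
  have "\<exists>p\<in>Kc. \<forall>y\<in>Kc. Z n y \<le> Z n p" for n
    by (rule continuous_attains_sup[OF Kc(1) _ Zc]) (use Kc in auto)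
  then obtain x where x: "\<And>n. x n \<in> Kc" "\<And>n y. y \<in> Kc \<Longrightarrow> Z n y \<le> Z n (x n)" by metis
  obtain p r where p: "p \<in> Kc" "strict_mono r" "(x \<circ> r) \<longlonglongrightarrow> p"
    using Kc(1) x(1) unfolding compact_def by metis
  define y where "y = x \<circ> r"
  define k where "k = h \<circ> r"
  have y: "y \<longlonglongrightarrow> p" "\<And>n. y n \<in> Kc" using p x by (auto simp: y_def)
  have k: "k \<longlonglongrightarrow> 0" "\<And>n. k n > 0" using hlim p h0 by (auto simp: k_def LIMSEQ_subseq_LIMSEQ)
  have pD: "p \<in> D" using KD p by blast
  note dq = difference_quotient_tendsto[OF open_D _ _ y(1) pD k]
  note dq0 = difference_quotient_tendsto[OF open_D _ _ tendsto_const _ k]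
  have Zlim: "(\<lambda>n. Z (r n) (y n)) \<longlonglongrightarrow> U p + z p"
    unfolding Z_def
  proof (rule tendsto_add)
    show "(\<lambda>n. (\<phi> (y n + (h (r n), 0)) - \<phi> (y n)) / h (r n)) \<longlonglongrightarrow> U p"
      using dq[OF der_\<phi> cont_U] by (simp add: k_def)
    have "isCont z p" using zc[of UNIV] continuous_on_eq_continuous_at by blast
    then show "(\<lambda>n. z (y n)) \<longlonglongrightarrow> z p" by (rule isCont_tendsto_compose) (rule y)
  qed
  have Zlim0: "(\<lambda>n. Z (r n) p0) \<longlonglongrightarrow> U p0 + z p0"
    unfolding Z_def
  proof (rule tendsto_add[OF _ tendsto_const])
    show "(\<lambda>n. (\<phi> (p0 + (h (r n), 0)) - \<phi> p0) / h (r n)) \<longlonglongrightarrow> U p0"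
      using dq0[OF der_\<phi> cont_U KD[OF Kc(5)]] by (simp add: k_def)
  qed
  have ge: "U p0 + z p0 \<le> U p + z p"
    by (rule LIMSEQ_le[OF Zlim0 Zlim]) (use x(2)[OF Kc(5)] in \<open>auto simp: y_def\<close>)
  \<comment> \<open>Points of \<open>Kc - G\<close> have a value strictly below the one at
    \<open>p0\<close>, so the limit is interior, and so are the maximum points from some index
    on.\<close>
  then have "p \<in> G" using bd[of p] p by fastforce
  then have evG: "\<forall>\<^sub>F n in sequentially. y n \<in> G"
    using y(1) Kc(3) topological_tendstoD by blast
  \<comment> \<open>The three conditions at a maximum point for fixed \<open>n\<close>, still with
    difference quotients in place of derivatives; the limit is taken term by term
    afterwards.\<close>
  have crit: "(U (q + (k n, 0)) - U q) / k n + z1 + z11 * fst q = 0 \<and>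
      (V (q + (k n, 0)) - V q) / k n + z2 + z22 * snd q = 0 \<and>
      (C (q + (k n, 0)) - (U (q + (k n, 0)))^2) * z11 + (C (q + (k n, 0)) - (V (q + (k n, 0)))^2) * z22 \<le>
       (((C (q + (k n, 0)) - (U (q + (k n, 0)))^2) - (C q - (U q)^2)) / k n) * (1 + a q)
       - 2 * ((U (q + (k n, 0)) * V (q + (k n, 0)) - U q * V q) / k n) * b q
       + (((C (q + (k n, 0)) - (V (q + (k n, 0)))^2) - (C q - (V q)^2)) / k n) * (1 + d q)"
    if "y n \<in> G" "q = y n" for n q
  proof -
    define q' where "q' = q + (k n, 0)"
    have q: "q \<in> G" using that by simp
    have q'D: "q' \<in> D" using inD[of q "r n"] that Kc by (auto simp: q'_def k_def)
    have qD: "q \<in> D" using q Kc KD by blast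
    obtain e where e: "e > 0" "ball q e \<subseteq> G" using Kc(3) q openE by blast
    have kn: "k n > 0" by (rule k)
    define dx where "dx w = (U (w + (k n, 0)) - U w) / k n + z1 + z11 * fst w" for w
    define dy where "dy w = (V (w + (k n, 0)) - V w) / k n + z2 + z22 * snd w" for w
    have shiftder: "((\<lambda>w. F (w + (k n, 0))) has_derivative F') (at w)"
      if "(F has_derivative F') (at (w + (k n, 0)))" for F :: "plane \<Rightarrow> real" and F' w
    proof -
      have "((\<lambda>w. w + (k n, 0)) has_derivative (\<lambda>h. h)) (at w)"
        by (auto intro!: derivative_eq_intros)
      from has_derivative_compose[OF this that] show ?thesis .
    qed
    have dZ: "(Z (r n) has_derivative (lin (dx w) (dy w))) (at w)" if "w \<in> G" for w
    proof -
      have wD: "w \<in> D" "w + (k n, 0) \<in> D" using that Kc inD[of w "r n"] by (auto simp: k_def)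
      have Zk: "Z (r n) = (\<lambda>p. (\<phi> (p + (k n, 0)) - \<phi> p) / k n + z p)"
        by (auto simp: Z_def k_def)
      show ?thesis unfolding Zk z dx_def dy_def
        by (rule derivative_eq_intros shiftder[OF der_\<phi>] der_\<phi> | rule wD refl | (use kn in simp; fail))+
          (use kn in \<open>auto simp: fun_eq_iff field_simps power2_eq_square\<close>)
    qed
    have ddx: "(dx has_derivative (lin ((a q' - a q) / k n + z11) ((b q' - b q) / k n))) (at q)"
      unfolding dx_def[abs_def] q'_def
      by (rule derivative_eq_intros shiftder[OF der_U] der_U | rule qD q'D[unfolded q'_def] refl | (use kn in simp; fail))+
         (use kn in \<open>auto simp: fun_eq_iff field_simps power2_eq_square\<close>)
    have ddy: "(dy has_derivative (lin ((b q' - b q) / k n) ((d q' - d q) / k n + z22))) (at q)"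
      unfolding dy_def[abs_def] q'_def
      by (rule derivative_eq_intros shiftder[OF der_V] der_V | rule qD q'D[unfolded q'_def] refl | (use kn in simp; fail))+
         (use kn in \<open>auto simp: fun_eq_iff field_simps power2_eq_square\<close>)
    have mx: "Z (r n) w \<le> Z (r n) q" if "w \<in> G" for w
      using x(2)[of w "r n"] Kc(4) that \<open>q = y n\<close> by (auto simp: y_def)
    have line: "q + t *\<^sub>R v \<in> G" if "\<bar>t\<bar> < e / (norm v + 1)" for t and v :: plane
    proof -
      have "norm (t *\<^sub>R v) \<le> \<bar>t\<bar> * (norm v + 1)" by (simp add: algebra_simps)
      also have "\<dots> < e" using that by (simp add: pos_less_divide_eq add_nonneg_pos)
      finally show ?thesis using e by (auto simp: dist_norm)
    qed
    have second: "((a q' - a q) / k n + z11) * (fst v)^2 + 2 * ((b q' - b q) / k n) * fst v * snd v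
        + ((d q' - d q) / k n + z22) * (snd v)^2 \<le> 0"
      and first: "dx q * fst v + dy q * snd v = 0" for v :: plane
    proof -
      define kk where "kk t = Z (r n) (q + t *\<^sub>R v)" for t
      define kk' where "kk' t = dx (q + t *\<^sub>R v) * fst v + dy (q + t *\<^sub>R v) * snd v" for t
      have e': "e / (norm v + 1) > 0" using e by (simp add: add_nonneg_pos)
      have kd: "(kk has_real_derivative kk' t) (at t)" if "\<bar>t\<bar> < e / (norm v + 1)" for t
        unfolding kk_def[abs_def] kk'_def by (rule has_real_derivative_along_line[OF dZ[OF line[OF that]]])
      have km: "kk t \<le> kk 0" if "\<bar>t\<bar> < e / (norm v + 1)" for t
        unfolding kk_def using mx[OF line[OF that]] by simp
      have dx0: "((\<lambda>t. dx (q + t *\<^sub>R v)) has_real_derivative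
          (((a q' - a q) / k n + z11) * fst v + ((b q' - b q) / k n) * snd v)) (at 0)"
        by (rule has_real_derivative_along_line) (use ddx in simp)
      have dy0: "((\<lambda>t. dy (q + t *\<^sub>R v)) has_real_derivative
          (((b q' - b q) / k n) * fst v + ((d q' - d q) / k n + z22) * snd v)) (at 0)"
        by (rule has_real_derivative_along_line) (use ddy in simp)
      have k2: "(kk' has_real_derivative ((((a q' - a q) / k n + z11) * fst v + ((b q' - b q) / k n) * snd v) * fst v
          + (((b q' - b q) / k n) * fst v + ((d q' - d q) / k n + z22) * snd v) * snd v)) (at 0)"
        unfolding kk'_def[abs_def]
        by (rule DERIV_add[OF DERIV_cmult_right[OF dx0] DERIV_cmult_right[OF dy0]])
      have "((((a q' - a q) / k n + z11) * fst v + ((b q' - b q) / k n) * snd v) * fst v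
          + (((b q' - b q) / k n) * fst v + ((d q' - d q) / k n + z22) * snd v) * snd v) \<le> 0"
        by (rule second_derivative_local_max[OF e' kd k2 km])
      then show "((a q' - a q) / k n + z11) * (fst v)^2 + 2 * ((b q' - b q) / k n) * fst v * snd v
        + ((d q' - d q) / k n + z22) * (snd v)^2 \<le> 0"
        by (simp add: power2_eq_square algebra_simps)
      have "kk' 0 = 0" by (rule DERIV_local_max[OF kd e']) (use km e' in auto)
      then show "dx q * fst v + dy q * snd v = 0" by (simp add: kk'_def)
    qed
    have f1: "dx q = 0" "dy q = 0" using first[of "(1, 0)"] first[of "(0, 1)"] by auto
    define h11 where "h11 = (a q' - a q) / k n + z11"
    define h12 where "h12 = (b q' - b q) / k n"
    define h22 where "h22 = (d q' - d q) / k n + z22"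
    \<comment> \<open>\<open>N = (C - U\<^sup>2 - V\<^sup>2) I + (- V, U) (- V, U)\<^sup>T\<close>, so three directions suffice to test \<open>N : H \<le> 0\<close>.\<close>
    have s1: "h11 \<le> 0" "h22 \<le> 0" "h11 * (V q')^2 - 2 * h12 * V q' * U q' + h22 * (U q')^2 \<le> 0"
      using second[of "(1, 0)"] second[of "(0, 1)"] second[of "(- V q', U q')"]
      by (auto simp: h11_def h12_def h22_def)
    have "(C q' - (U q')^2 - (V q')^2) * (h11 + h22) \<le> 0"
      using sub[OF q'D] s1 by (intro mult_nonneg_nonpos) auto
    then have sd: "(C q' - (U q')^2) * h11 - 2 * U q' * V q' * h12 + (C q' - (V q')^2) * h22 \<le> 0"
      using s1(3) by (simp add: algebra_simps)
    have aa: "a q' = a q + k n * (h11 - z11)" "b q' = b q + k n * h12" "d q' = d q + k n * (h22 - z22)"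
      using kn by (auto simp: h11_def h12_def h22_def)
    \<comment> \<open>The discrete counterpart of differentiating the coefficients: their difference
      quotients, paired with the second derivatives at \<open>q\<close>.\<close>
    define R where "R = (((C q' - (U q')^2) - (C q - (U q)^2)) * (1 + a q)
         - 2 * (U q' * V q' - U q * V q) * b q + ((C q' - (V q')^2) - (C q - (V q)^2)) * (1 + d q)) / k n"
    have kR: "k n * R = ((C q' - (U q')^2) - (C q - (U q)^2)) * (1 + a q)
         - 2 * (U q' * V q' - U q * V q) * b q + ((C q' - (V q')^2) - (C q - (V q)^2)) * (1 + d q)"
      using kn by (simp add: R_def)
    \<comment> \<open>The second derivatives at \<open>q'\<close> are those at \<open>q\<close> plus
      \<open>k n\<close> times those of the quotient. Subtracting the equation at \<open>q\<close>
      from the one at \<open>q'\<close> therefore splits into a second-order part with coefficients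
      at \<open>q'\<close> and the term \<open>R\<close>.\<close>
    have "k n * ((C q' - (U q')^2) * (h11 - z11) - 2 * U q' * V q' * h12 + (C q' - (V q')^2) * (h22 - z22))
        = - (k n * R)"
      using pde[OF qD] pde[OF q'D] unfolding aa kR by (simp add: algebra_simps)
    then have "(C q' - (U q')^2) * (h11 - z11) - 2 * U q' * V q' * h12 + (C q' - (V q')^2) * (h22 - z22)
        = - R"
      using kn by (metis less_irrefl mult_minus_right nonzero_mult_div_cancel_left)
    then have "(C q' - (U q')^2) * z11 + (C q' - (V q')^2) * z22 \<le> R"
      using sd by (simp add: algebra_simps)
    moreover have "R = (((C q' - (U q')^2) - (C q - (U q)^2)) / k n) * (1 + a q)
       - 2 * ((U q' * V q' - U q * V q) / k n) * b q
       + (((C q' - (V q')^2) - (C q - (V q)^2)) / k n) * (1 + d q)"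
    proof -
      have "(x1 * y1 - 2 * x2 * y2 + x3 * y3) / k n = x1 / k n * y1 - 2 * (x2 / k n) * y2 + x3 / k n * y3"
        for x1 x2 x3 y1 y2 y3 by (simp add: add_divide_distrib diff_divide_distrib)
      then show ?thesis unfolding R_def .
    qed
    ultimately show ?thesis using f1 unfolding dx_def dy_def q'_def[symmetric] by simp
  qed
  have yk: "(\<lambda>n. y n + (k n, 0)) \<longlonglongrightarrow> p"
    using tendsto_add[OF y(1) tendsto_Pair[OF k(1) tendsto_const[of 0]]] by (simp add: zero_prod_def[symmetric])
  have lim: "(\<lambda>n. F (y n)) \<longlonglongrightarrow> F p" "(\<lambda>n. F (y n + (k n, 0))) \<longlonglongrightarrow> F p"
    if "continuous_on D F" for F :: "plane \<Rightarrow> real"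
  proof -
    have "isCont F p" using that open_D pD continuous_on_eq_continuous_at by blast
    then show "(\<lambda>n. F (y n)) \<longlonglongrightarrow> F p" "(\<lambda>n. F (y n + (k n, 0))) \<longlonglongrightarrow> F p"
      using isCont_tendsto_compose y(1) yk by blast+
  qed
  note cUV = cont_U cont_V cont_C cont
  have cCx: "continuous_on D Cx" unfolding Cx_def[abs_def] by (intro continuous_intros cUV)
  have q11: "(\<lambda>n. ((C (y n + (k n, 0)) - (U (y n + (k n, 0)))^2) - (C (y n) - (U (y n))^2)) / k n)
      \<longlonglongrightarrow> Cx p - 2 * U p * a p"
    by (rule dq[where F="\<lambda>p. C p - (U p)^2" and A="\<lambda>p. Cx p - 2 * U p * a p"
          and B="\<lambda>p. - s * (V p + U p * b p + V p * d p) - 2 * U p * b p"])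
       ((rule derivative_eq_intros der_C der_U der_V | assumption | rule refl | (simp; fail))+,
        (auto simp: fun_eq_iff algebra_simps power2_eq_square)[1],
        intro continuous_intros cCx cUV)
  have q12: "(\<lambda>n. (U (y n + (k n, 0)) * V (y n + (k n, 0)) - U (y n) * V (y n)) / k n)
      \<longlonglongrightarrow> a p * V p + U p * b p"
  proof (rule dq[where F="\<lambda>p. U p * V p" and A="\<lambda>p. a p * V p + U p * b p"])
    show "((\<lambda>p. U p * V p) has_derivative (lin (a p * V p + U p * b p) (b p * V p + U p * d p))) (at p)"
      if "p \<in> D" for p
      by (rule has_derivative_eq_rhs[OF has_derivative_mult[OF der_U[OF that] der_V[OF that]]])
        (simp add: fun_eq_iff algebra_simps)
    show "continuous_on D (\<lambda>p. a p * V p + U p * b p)"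
      by (intro continuous_intros cUV)
  qed
  have q22: "(\<lambda>n. ((C (y n + (k n, 0)) - (V (y n + (k n, 0)))^2) - (C (y n) - (V (y n))^2)) / k n)
      \<longlonglongrightarrow> Cx p - 2 * V p * b p"
    by (rule dq[where F="\<lambda>p. C p - (V p)^2" and A="\<lambda>p. Cx p - 2 * V p * b p"
          and B="\<lambda>p. - s * (V p + U p * b p + V p * d p) - 2 * V p * d p"])
       ((rule derivative_eq_intros der_C der_U der_V | assumption | rule refl | (simp; fail))+,
        (auto simp: fun_eq_iff algebra_simps power2_eq_square)[1],
        intro continuous_intros cCx cUV)
  have qU: "(\<lambda>n. (U (y n + (k n, 0)) - U (y n)) / k n) \<longlonglongrightarrow> a p" by (rule dq[OF der_U cont(1)])
  have qV: "(\<lambda>n. (V (y n + (k n, 0)) - V (y n)) / k n) \<longlonglongrightarrow> b p" by (rule dq[OF der_V cont(2)])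
  have e1: "a p + z1 + z11 * fst p = 0"
  proof (rule LIMSEQ_unique)
    show "(\<lambda>n. (U (y n + (k n, 0)) - U (y n)) / k n + z1 + z11 * fst (y n)) \<longlonglongrightarrow> a p + z1 + z11 * fst p"
      by (intro tendsto_intros qU y)
    show "(\<lambda>n. (U (y n + (k n, 0)) - U (y n)) / k n + z1 + z11 * fst (y n)) \<longlonglongrightarrow> 0"
      by (rule tendsto_eventually) (rule eventually_mono[OF evG]; use crit in blast)
  qed
  have e2: "b p + z2 + z22 * snd p = 0"
  proof (rule LIMSEQ_unique)
    show "(\<lambda>n. (V (y n + (k n, 0)) - V (y n)) / k n + z2 + z22 * snd (y n)) \<longlonglongrightarrow> b p + z2 + z22 * snd p"
      by (intro tendsto_intros qV y)
    show "(\<lambda>n. (V (y n + (k n, 0)) - V (y n)) / k n + z2 + z22 * snd (y n)) \<longlonglongrightarrow> 0"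
      by (rule tendsto_eventually) (rule eventually_mono[OF evG]; use crit in blast)
  qed
  have "(C p - (U p)^2) * z11 + (C p - (V p)^2) * z22 \<le>
       (Cx p - 2 * U p * a p) * (1 + a p) - 2 * (a p * V p + U p * b p) * b p
       + (Cx p - 2 * V p * b p) * (1 + d p)"
  proof (rule tendsto_le[OF sequentially_bot])
    show "(\<lambda>n. (((C (y n + (k n, 0)) - (U (y n + (k n, 0)))^2) - (C (y n) - (U (y n))^2)) / k n) * (1 + a (y n))
       - 2 * ((U (y n + (k n, 0)) * V (y n + (k n, 0)) - U (y n) * V (y n)) / k n) * b (y n)
       + (((C (y n + (k n, 0)) - (V (y n + (k n, 0)))^2) - (C (y n) - (V (y n))^2)) / k n) * (1 + d (y n)))
       \<longlonglongrightarrow> (Cx p - 2 * U p * a p) * (1 + a p) - 2 * (a p * V p + U p * b p) * b p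
       + (Cx p - 2 * V p * b p) * (1 + d p)"
      by (intro tendsto_intros q11 q12 q22 lim cUV)
    show "(\<lambda>n. (C (y n + (k n, 0)) - (U (y n + (k n, 0)))^2) * z11 + (C (y n + (k n, 0)) - (V (y n + (k n, 0)))^2) * z22)
      \<longlonglongrightarrow> (C p - (U p)^2) * z11 + (C p - (V p)^2) * z22"
      by (intro tendsto_intros lim cUV)
  qed (rule eventually_mono[OF evG]; use crit in blast)
  with that p(1) ge e1 e2 show thesis by blast
qed

end

section \<open>The barrier at a tangential sonic point\<close>

text \<open>Here \<open>al\<close>, \<open>be\<close>, \<open>de\<close> stand for
  \<open>1 + a\<close>, \<open>b\<close>, \<open>1 + d\<close> at a contact point, and
  \<open>E\<close>, \<open>F\<close> for \<open>C - U^2\<close>, \<open>C - V^2\<close>. The left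
  side is the lower-order part of the differentiated equation, the right side its second-order part
  applied to the barrier, so the strict inequality contradicts the conclusion of
  \<open>contact_point\<close>. The left side is at most \<open>16.4 * l\<close>, while
  \<open>F \<ge> 1/2\<close> makes the right side at least \<open>29 * l\<close>.\<close>

lemma barrier_estimate:
  fixes s x y y0 u v E F al be de l :: real
  assumes "s > 0" "0 < y0" "y0 * (400 * (s + 2)^2) \<le> 1" "0 < y" "y \<le> y0" "\<bar>x\<bar> \<le> 6/5 * y0"
    and l: "l * (8 * (s + 2)) = y0"
    and al: "(s + 2) * al = 2 + x / 4"
    and be: "be = - l * (1/2 + 60 * y)"
    and E: "0 \<le> E" "E \<le> (s + 2) * y0^2" and F: "1/2 \<le> F" and u: "0 \<le> u" "u \<le> 2" and v: "\<bar>v\<bar> \<le> 4 * y0"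
    and pde: "E * al - 2 * u * v * be + F * de = 0"
  shows "u * al * (2 - (s + 2) * al) - (s + 2) * al * v * be + 2 * v * be - 2 * u * be^2
      - de * (s * u * al + (s + 2) * v * be) < F * (60 * l) - E * (2 * l / y0)"
proof -
  define w where "w = s + 2"
  have w: "w > 2" using assms by (simp add: w_def)
  have "w^2 \<ge> 2 * w" using w by (simp add: power2_eq_square)
  then have "y0 * (800 * w) \<le> y0 * (400 * w^2)" using assms(2) by (intro mult_left_mono) auto
  then have wy0: "w * y0 \<le> 1/800" using assms(3) unfolding w_def[symmetric] by (simp add: algebra_simps)
  have "2 * y0 \<le> w * y0" using w assms by (intro mult_right_mono) auto
  then have y01: "y0 \<le> 1/1600" using wy0 by simp
  have lw: "y0 = 8 * w * l" using l unfolding w_def by (simp add: algebra_simps)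
  have lpos: "l > 0" using lw assms(2) w by (simp add: zero_less_mult_iff)
  have wal: "1 \<le> w * al" "w * al \<le> 3" using al assms y01 by (auto simp: w_def[symmetric] abs_le_iff)
  have al0: "al > 0" using wal w zero_less_mult_iff[of w al] by linarith
  have beb: "\<bar>be\<bar> \<le> l"
  proof -
    have "\<bar>be\<bar> = l * (1/2 + 60 * y)" using be lpos assms(4) by (simp add: abs_mult)
    also have "\<dots> \<le> l * 1" using lpos assms(5) y01 by (intro mult_left_mono) auto
    finally show ?thesis by simp
  qed
  have vb: "\<bar>v * be\<bar> \<le> 4 * y0 * l"
    unfolding abs_mult using mult_mono[OF v beb] assms(2) by simp
  have vb2: "4 * y0 * l \<le> l / 400" using y01 lpos by (simp add: mult_right_mono)
  \<comment> \<open>The x-slope of the barrier enters as \<open>2 - w * al = - x / 4\<close>. This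
    is the one contribution of order \<open>l\<close> that shrinking \<open>y0\<close> does not make
    small relative to \<open>l\<close>.\<close>
  have t1: "u * al * (2 - w * al) \<le> 14.4 * l"
  proof -
    have "u * al * (2 - w * al) = (u * al) * (- x / 4)" using al by (simp add: w_def)
    also have "\<dots> \<le> (u * al) * (3/10 * y0)"
      using u al0 assms(6) by (intro mult_left_mono) auto
    also have "\<dots> = (12/5 * l) * (u * (w * al))" using lw by (simp add: algebra_simps)
    also have "\<dots> \<le> (12/5 * l) * (2 * 3)"
      using lpos u wal by (intro mult_left_mono mult_mono) auto
    finally show ?thesis by simp
  qed
  have t2: "- w * al * v * be + 2 * v * be \<le> l"
  proof -
    have "- w * al * v * be + 2 * v * be = (2 - w * al) * (v * be)" by (simp add: algebra_simps)
    also have "\<dots> \<le> \<bar>2 - w * al\<bar> * \<bar>v * be\<bar>" by (metis abs_ge_self abs_mult)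
    also have "\<dots> \<le> 1 * (4 * y0 * l)" using wal vb by (intro mult_mono) auto
    also have "\<dots> \<le> l" using vb2 lpos by simp
    finally show ?thesis .
  qed
  \<comment> \<open>The equation itself controls the remaining second derivative: as
    \<open>F\<close> is bounded below, \<open>de\<close> inherits the smallness of \<open>E\<close>
    and of \<open>v * be\<close>.\<close>
  have deb: "\<bar>de\<bar> \<le> 80 * w * y0 * l"
  proof -
    have "F * de = 2 * u * (v * be) - E * al" using pde by (simp add: algebra_simps)
    moreover have "F * \<bar>de\<bar> = \<bar>F * de\<bar>" using F by (simp add: abs_mult)
    ultimately have "F * \<bar>de\<bar> = \<bar>2 * u * (v * be) - E * al\<bar>" by simp
    also have "\<dots> \<le> 2 * u * \<bar>v * be\<bar> + E * al"
      using u E al0 abs_triangle_ineq4[of "2 * u * (v * be)" "E * al"] by (simp add: abs_mult)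
    also have "\<dots> \<le> 2 * 2 * (4 * y0 * l) + (w * y0^2) * al"
      using u E al0 vb lpos assms(2) by (intro add_mono mult_mono) (auto simp: w_def)
    also have "(w * y0^2) * al = y0 * (8 * w * l) * (w * al)" using lw by (simp add: power2_eq_square)
    also have "\<dots> \<le> y0 * (8 * w * l) * 3"
      using wal lpos w assms(2) by (intro mult_left_mono) auto
    also have "2 * 2 * (4 * y0 * l) \<le> 8 * (y0 * (w * l))"
      using w lpos assms(2) by (simp add: mult.left_commute[of _ w])
    finally have "F * \<bar>de\<bar> \<le> 32 * w * y0 * l" by (simp add: algebra_simps)
    moreover have "1/2 * \<bar>de\<bar> \<le> F * \<bar>de\<bar>" using F by (intro mult_right_mono) auto
    ultimately have "\<bar>de\<bar> \<le> 64 * w * y0 * l" by simp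
    also have "\<dots> \<le> 80 * w * y0 * l" using w lpos assms(2) by simp
    finally show ?thesis .
  qed
  have t3: "- de * (s * u * al + w * v * be) \<le> l"
  proof -
    have "\<bar>w * v * be\<bar> \<le> w * (4 * y0 * l)" using vb w by (simp add: abs_mult mult.assoc)
    also have "\<dots> = y0 * y0 / 2" using lw by simp
    also have "\<dots> \<le> 1" using y01 assms(2) mult_mono[of y0 1 y0 1] by simp
    finally have b1: "\<bar>w * v * be\<bar> \<le> 1" .
    have "s * al \<le> 3" using wal al0 by (simp add: w_def algebra_simps)
    then have b2: "u * (s * al) \<le> 2 * 3" using u assms(1) al0 by (intro mult_mono) auto
    have b3: "\<bar>s * u * al + w * v * be\<bar> \<le> 7"
    proof -
      have "0 \<le> u * (s * al)" using u assms(1) al0 by simp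
      moreover have "s * u * al = u * (s * al)" by simp
      ultimately show ?thesis using b1 b2 by linarith
    qed
    have "- de * (s * u * al + w * v * be) \<le> \<bar>de\<bar> * \<bar>s * u * al + w * v * be\<bar>"
      by (metis abs_ge_self abs_minus_cancel abs_mult)
    also have "\<dots> \<le> (80 * w * y0 * l) * 7" using deb b3 w lpos assms(2) by (intro mult_mono) auto
    also have "\<dots> = 560 * (w * y0) * l" by simp
    also have "\<dots> \<le> 560 * (1/800) * l" using wy0 lpos by (intro mult_right_mono) auto
    finally show ?thesis using lpos by simp
  qed
  have t4: "E * (2 * l / y0) \<le> l"
  proof -
    have "E * (2 * l / y0) \<le> (w * y0^2) * (2 * l / y0)"
      using E lpos assms(2) by (intro mult_right_mono) (auto simp: w_def)
    also have "\<dots> = 2 * (w * y0) * l" using assms(2) by (simp add: power2_eq_square)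
    also have "\<dots> \<le> 2 * (1/800) * l" using wy0 lpos by (intro mult_right_mono) auto
    finally show ?thesis using lpos by simp
  qed
  have t5: "30 * l \<le> F * (60 * l)" using F lpos by simp
  have t6: "- 2 * u * be^2 \<le> 0" using u by simp
  show ?thesis using t1 t2 t3 t4 t5 t6 lpos unfolding w_def[symmetric] by linarith
qed

text \<open>The condition on \<open>x^2\<close> describes a narrow, almost parabolic region of
  half-width about \<open>sqrt (y0 * y)\<close>. All its points have size at most of order
  \<open>y0\<close>, and \<open>x^2 + y^2\<close> is at most of order \<open>y0 * y\<close>, so
  quadratic Taylor errors become linear in \<open>y\<close> with a small factor.\<close>

lemma tangential_region:
  fixes x y y0 :: real
  assumes "0 < y0" "y0 \<le> 1/1600" "0 < y" "y \<le> y0" "x^2 \<le> y0 * (y + 30 * y^2)"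
  shows "x^2 \<le> 5/4 * y0 * y" "\<bar>x\<bar> \<le> 6/5 * y0" "norm (x, y) \<le> 3/2 * y0" "x^2 + y^2 \<le> 9/4 * y0 * y"
proof -
  have "y^2 \<le> (1/1600) * y" unfolding power2_eq_square using assms by (intro mult_right_mono) auto
  then have "y0 * (y + 30 * y^2) \<le> y0 * (5/4 * y)" using assms by (intro mult_left_mono) auto
  then show 1: "x^2 \<le> 5/4 * y0 * y" using assms(5) by simp
  also have "\<dots> \<le> 5/4 * y0 * y0" using assms by (intro mult_left_mono) auto
  finally have 2: "x^2 \<le> 5/4 * y0^2" by (simp add: power2_eq_square)
  then have "x^2 \<le> 36/25 * y0^2" using zero_le_power2[of y0] by linarith
  then have "x^2 \<le> (6/5 * y0)^2" by (simp add: power_mult_distrib power_divide)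
  then show "\<bar>x\<bar> \<le> 6/5 * y0" using assms(1) abs_le_square_iff[of x "6/5 * y0"] by simp
  have 3: "y^2 \<le> y0 * y" unfolding power2_eq_square using assms by (intro mult_right_mono) auto
  show 4: "x^2 + y^2 \<le> 9/4 * y0 * y" using 1 3 by simp
  also have "\<dots> \<le> 9/4 * y0 * y0" using assms by (intro mult_left_mono) auto
  finally have "x^2 + y^2 \<le> (3/2 * y0)^2" by (simp add: power2_eq_square)
  then show "norm (x, y) \<le> 3/2 * y0"
    unfolding norm_Pair real_norm_def power2_abs using assms(1) by (intro real_le_lsqrt) auto
qed

text \<open>Subsonicity is the hypothesis \<open>v^2 \<le> E\<close>. With \<open>v\<close> close to
  \<open>- y\<close> the quadratic terms combine to \<open>(w / 2 - s / 2) * y^2 = y^2\<close>; the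
  term in \<open>P^2\<close> has the favourable sign, and \<open>chi\<close>, the Taylor remainder
  of the potential, and the deviation of \<open>v\<close> only produce an error of size
  \<open>w * e * y0 * y\<close>.\<close>

lemma subsonic_lower_bound:
  fixes s x y y0 P v chi n E e w kx :: real
  assumes "s > 0" "w = s + 2" "0 < y0" "0 < y" and n: "0 \<le> n" "n \<le> 3/2 * y0" "n^2 \<le> 9/4 * y0 * y"
    and e: "0 \<le> e" and v: "\<bar>v + y\<bar> \<le> e * n" and chi: "\<bar>chi\<bar> \<le> e * n^2"
    and E: "E = w * (1 - kx) * P - w / 2 * P^2 + s * y^2 / 2 - s * chi - s * v^2 / 2" "v^2 \<le> E"
  shows "y^2 - 4 * w * e * y0 * y \<le> w * (1 - kx) * P"
proof -
  have v2: "y^2 - 2 * (e * n) * y \<le> v^2"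
  proof -
    have "y * (2 * \<bar>v + y\<bar>) \<le> y * (2 * (e * n))" using v assms(4) by (intro mult_left_mono) auto
    moreover have "y * (v + y) \<le> y * \<bar>v + y\<bar>" using assms(4) by (intro mult_left_mono) auto
    moreover have "v^2 = (v + y)^2 - 2 * (y * (v + y)) + y^2" by (simp add: power2_eq_square algebra_simps)
    moreover have "2 * (e * n) * y = y * (2 * (e * n))" by simp
    ultimately show ?thesis using zero_le_power2[of "v + y"] by linarith
  qed
  have w: "w > 0" using assms by simp
  have a1: "n * y \<le> 3/2 * y0 * y" using n assms(4) by (intro mult_right_mono) auto
  have "w / 2 * (y^2 - 2 * (e * n) * y) \<le> w / 2 * v^2" using v2 w by (intro mult_left_mono) auto
  moreover have "s * (- (e * n^2)) \<le> s * chi" using chi assms(1) by (intro mult_left_mono) auto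
  moreover have "w / 2 * P^2 \<ge> 0" using w by simp
  moreover have "w / 2 * v^2 = v^2 + s * v^2 / 2" using assms(2) by (simp add: algebra_simps)
  moreover have "s * (- (e * n^2)) = - (s * (e * n^2))" by simp
  ultimately have "w / 2 * (y^2 - 2 * (e * n) * y) - s * (e * n^2) - s * y^2 / 2 \<le> w * (1 - kx) * P"
    using E by linarith
  moreover have "w / 2 * (y^2 - 2 * (e * n) * y) - s * (e * n^2) - s * y^2 / 2
     = y^2 - w * e * (n * y) - s * (e * n^2)"
    using assms(2) by (simp add: algebra_simps add_divide_distrib)
  moreover have "w * e * (n * y) \<le> w * e * (3/2 * y0 * y)" using a1 w e by (intro mult_left_mono) auto
  moreover have "s * (e * n^2) \<le> w * (e * (9/4 * y0 * y))"
    using n e assms by (intro mult_mono) auto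
  moreover have "w * e * (3/2 * y0 * y) = 3/2 * (w * e * y0 * y)" "w * (e * (9/4 * y0 * y)) = 9/4 * (w * e * y0 * y)"
    "4 * w * e * y0 * y = 4 * (w * e * y0 * y)" by simp_all
  moreover have "w * e * y0 * y \<ge> 0" using w e assms by simp
  ultimately show ?thesis by linarith
qed

context C2_potential
begin

text \<open>A normalised situation: the sonic point is the origin, where the gradient is
  \<open>(1, 0)\<close> and \<phi> vanishes, and the value of \<open>s * K\<close> makes the sonic
  speed there equal to 1. \<open>D\<close> contains a region above a parabola tangent to the
  velocity, and \<open>asy\<close> is the expansion with Hessian diag(-\<kappa>, -1), hence without
  a mixed term. The contradiction is an interior positive maximum of
  \<open>\<zeta> - P\<close>.\<close>

lemma no_tangential_sonic_point:
  fixes L r0 :: real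
  defines "\<kappa> \<equiv> s / (s + 2)"
  assumes s: "s > 0" and K: "s * K = (s + 2) / 2"
    and sub: "\<And>p. p \<in> D \<Longrightarrow> (U p)^2 + (V p)^2 < C p"
    and pde: "\<And>p. p \<in> D \<Longrightarrow>
      (C p - (U p)^2) * (1 + a p) - 2 * U p * V p * b p + (C p - (V p)^2) * (1 + d p) = 0"
    and dom: "r0 > 0" "\<And>x y. \<bar>x\<bar> < r0 \<Longrightarrow> y < r0 \<Longrightarrow> L * x^2 < y \<Longrightarrow> (x, y) \<in> D"
    and asy: "\<And>\<epsilon>. \<epsilon> > 0 \<Longrightarrow> \<exists>\<rho>>0. \<forall>x y. (x, y) \<in> D \<longrightarrow> norm (x, y) < \<rho> \<longrightarrow>
        \<bar>U (x, y) - 1 + \<kappa> * x\<bar> \<le> \<epsilon> * norm (x, y) \<and> \<bar>V (x, y) + y\<bar> \<le> \<epsilon> * norm (x, y) \<and>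
        \<bar>\<phi> (x, y) - x + (\<kappa> * x^2 + y^2) / 2\<bar> \<le> \<epsilon> * (norm (x, y))^2"
  shows False
proof -
  define w where "w = s + 2"
  have w: "w > 2" using s by (simp add: w_def)
  \<comment> \<open>With this value the error \<open>4 * w * e * y0 * y\<close> in
    \<open>subsonic_lower_bound\<close> is \<open>y0 * y / 50\<close>.\<close>
  define e where "e = 1 / (200 * w)"
  have e: "e > 0" "e \<le> 1/400" "w * e = 1/200" using w by (auto simp: e_def field_simps)
  obtain \<rho> where \<rho>: "\<rho> > 0" and asy1: "\<And>x y. (x, y) \<in> D \<Longrightarrow> norm (x, y) < \<rho> \<Longrightarrow>
        \<bar>U (x, y) - 1 + \<kappa> * x\<bar> \<le> e * norm (x, y) \<and> \<bar>V (x, y) + y\<bar> \<le> e * norm (x, y) \<and>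
        \<bar>\<phi> (x, y) - x + (\<kappa> * x^2 + y^2) / 2\<bar> \<le> e * (norm (x, y))^2"
    using asy[OF e(1)] by blast
  \<comment> \<open>In this order: the smallness required by \<open>barrier_estimate\<close>,
    validity of the expansion on \<open>R\<close>, the size of the domain, and a width of
    \<open>R\<close> small enough for it to lie above the parabola that bounds
    \<open>D\<close>.\<close>
  define y0 where "y0 = Min {1 / (400 * w^2), \<rho> / 2, r0 / 2, 1 / (2 * (\<bar>L\<bar> + 1))}"
  have y0: "y0 > 0" "y0 \<le> 1 / (400 * w^2)" "y0 \<le> \<rho> / 2" "y0 \<le> r0 / 2" "y0 \<le> 1 / (2 * (\<bar>L\<bar> + 1))"
    unfolding y0_def using w \<rho> dom(1) by auto
  have y0w: "y0 * (400 * w^2) \<le> 1" using y0(2) w by (simp add: field_simps)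
  have "w^2 \<ge> 2^2" using w by (intro power_mono) auto
  then have "y0 * (400 * 4) \<le> y0 * (400 * w^2)" using y0 by (intro mult_left_mono) auto
  then have y01: "y0 \<le> 1/1600" using y0w by simp
  have y0L: "y0 * \<bar>L\<bar> \<le> 1/2"
  proof -
    have "y0 * (2 * (\<bar>L\<bar> + 1)) \<le> 1" using y0(5) by (simp add: pos_le_divide_eq add_nonneg_pos)
    then show ?thesis using y0(1) by (simp add: algebra_simps)
  qed
  \<comment> \<open>This makes \<open>2 * l / y0 = 1 / (4 * w)\<close>, so that the barrier changes
    \<open>w * (1 + a)\<close> at a contact point by exactly \<open>x / 4\<close>; it also turns the
    bounds in \<open>y0 / w\<close> into multiples of \<open>l\<close>.\<close>
  define l where "l = y0 / (8 * w)"
  have l: "l > 0" "l * (8 * w) = y0" using y0 w by (auto simp: l_def)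
  have \<kappa>: "0 < \<kappa>" "\<kappa> < 1" "w * (1 - \<kappa>) = 2" "w * \<kappa> = s" using s by (auto simp: \<kappa>_def w_def field_simps)
  define P where "P p = 1 - \<kappa> * fst p - U p" for p
  define \<zeta> where "\<zeta> p = l * (snd p / 2 + 30 * (snd p)^2 - (fst p)^2 / y0)" for p
  \<comment> \<open>The curvature \<open>1 / y0\<close> confines \<open>R\<close> to \<open>\<bar>x\<bar> \<le> 6/5 y0\<close>, where errors \<open>o(\<bar>p\<bar>)\<close> are \<open>o(y0)\<close>; the coefficient 30 outweighs the
    term of order \<open>l\<close> coming from \<open>\<zeta>\<^sub>x\<close>; the slope is \<open>l / 2\<close> rather than \<open>l\<close> so that \<open>\<zeta> = - l y / 2\<close> on the lateral boundary, where \<open>P\<close> is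
    only known to be at least \<open>- y0 y / (25 w)\<close>.\<close>
  define z where "z p = \<zeta> p - 1 + \<kappa> * fst p" for p
  define R where "R = {p. 0 < snd p \<and> snd p \<le> y0 \<and> (fst p)^2 \<le> y0 * (snd p + 30 * (snd p)^2)}"
  have RD: "p \<in> D" if "p \<in> R" for p
  proof -
    obtain x y where p: "p = (x, y)" by (cases p)
    have xy: "0 < y" "y \<le> y0" "x^2 \<le> y0 * (y + 30 * y^2)" using that by (auto simp: R_def p)
    note tr = tangential_region[OF y0(1) y01 xy]
    have "L * x^2 \<le> \<bar>L\<bar> * x^2" by (intro mult_right_mono) auto
    also have "\<dots> \<le> \<bar>L\<bar> * (5/4 * y0 * y)" using tr by (intro mult_left_mono) auto
    also have "\<dots> = 5/4 * y * (y0 * \<bar>L\<bar>)" by simp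
    also have "\<dots> \<le> 5/4 * y * (1/2)" using y0L xy by (intro mult_left_mono) auto
    also have "\<dots> < y" using xy by simp
    finally show ?thesis using dom(2)[of x y] tr(2) xy y0 unfolding p by auto
  qed
  have near: "norm p < \<rho>" if "p \<in> R" for p
    using tangential_region(3)[OF y0(1) y01, of "snd p" "fst p"] that y0(1,3) by (auto simp: R_def)
  define chi where "chi p = \<phi> p - fst p + (\<kappa> * (fst p)^2 + (snd p)^2) / 2" for p
  have Ceq: "C p - (U p)^2 = w * (1 - \<kappa> * fst p) * P p - w / 2 * (P p)^2 + s * (snd p)^2 / 2 - s * chi p - s * (V p)^2 / 2" for p
  proof -
    have U: "U p = 1 - \<kappa> * fst p - P p" by (simp add: P_def)
    have ph: "\<phi> p = fst p - (\<kappa> * (fst p)^2 + (snd p)^2) / 2 + chi p" by (simp add: chi_def)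
    have "C p - (U p)^2 = s * K - s * \<phi> p - (s / 2 + 1) * (U p)^2 - s * (V p)^2 / 2"
      by (simp add: C_def algebra_simps)
    also have "\<dots> = w / 2 - s * \<phi> p - w / 2 * (U p)^2 - s * (V p)^2 / 2"
      using K by (simp add: w_def add_divide_distrib)
    also have "\<dots> = w * (1 - \<kappa> * fst p) * P p - w / 2 * (P p)^2 + s * (snd p)^2 / 2 - s * chi p - s * (V p)^2 / 2"
      unfolding ph U \<kappa>(4)[symmetric] by (simp add: algebra_simps power2_eq_square add_divide_distrib)
    finally show ?thesis .
  qed
  \<comment> \<open>The decisive bound is \<open>C_up\<close>: where \<open>P\<close> is below the
    barrier, the degenerate coefficient \<open>C - U^2\<close> is of order \<open>y0^2\<close>, so
    the strongly concave x-part of the barrier costs little.\<close>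
  have U_near: "\<bar>P p\<bar> \<le> norm p" and V_near: "\<bar>V p\<bar> \<le> 4 * y0"
    and P_low: "(snd p)^2 - y0 * snd p / 50 \<le> w * (1 - \<kappa> * fst p) * P p"
    and \<kappa>x: "\<bar>\<kappa> * fst p\<bar> \<le> 1/2" and C_up: "P p < \<zeta> p \<Longrightarrow> C p - (U p)^2 \<le> w * y0^2"
    and \<zeta>_up: "\<zeta> p \<le> 3/4 * l * snd p" if p: "p \<in> R" for p
  proof -
    obtain x y where pxy: "p = (x, y)" by (cases p)
    have xy: "0 < y" "y \<le> y0" "x^2 \<le> y0 * (y + 30 * y^2)" using p by (auto simp: R_def pxy)
    note tr = tangential_region[OF y0(1) y01 xy]
    note as = asy1[OF RD[OF p, unfolded pxy] near[OF p, unfolded pxy]]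
    have en: "e * norm (x, y) \<le> 1 * norm (x, y)" using e by (intro mult_right_mono) auto
    show "\<bar>P p\<bar> \<le> norm p" using as en unfolding P_def pxy fst_conv by linarith
    have n2: "(norm (x, y))^2 \<le> 9/4 * y0 * y" using tr(4) by (simp add: norm_Pair)
    have "\<bar>V p\<bar> \<le> \<bar>V p + y\<bar> + y" using xy(1) by linarith
    then show "\<bar>V p\<bar> \<le> 4 * y0" using as en tr(3) xy(2) y0(1) unfolding pxy by linarith
    have "\<bar>\<kappa> * x\<bar> \<le> 1 * (6/5 * y0)" unfolding abs_mult using \<kappa> tr(2) by (intro mult_mono) auto
    then show \<kappa>x: "\<bar>\<kappa> * fst p\<bar> \<le> 1/2" using y01 by (simp add: pxy)
    have chi: "\<bar>chi p\<bar> \<le> e * (norm (x, y))^2" using as by (simp add: chi_def pxy)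
    have vE: "(V p)^2 \<le> C p - (U p)^2" using sub[OF RD[OF p]] by simp
    have "y^2 - 4 * w * e * y0 * y \<le> w * (1 - \<kappa> * x) * P p"
      by (rule subsonic_lower_bound[OF s w_def y0(1) xy(1) norm_ge_zero tr(3) n2 _ _ chi _ vE])
         (use e as Ceq[of p] in \<open>auto simp: pxy\<close>)
    then show "(snd p)^2 - y0 * snd p / 50 \<le> w * (1 - \<kappa> * fst p) * P p"
      using e(3) by (simp add: pxy mult.assoc)
    have "y^2 \<le> (1/1600) * y" unfolding power2_eq_square using xy y01 by (intro mult_right_mono) auto
    then have "l * (y / 2 + 30 * y^2 - x^2 / y0) \<le> l * (3/4 * y)" using l y0 xy(1)
      by (intro mult_left_mono) (auto simp: diff_le_eq add_increasing2)
    then show \<zeta>_up: "\<zeta> p \<le> 3/4 * l * snd p" by (simp add: \<zeta>_def pxy)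
    assume P\<zeta>: "P p < \<zeta> p"
    have yy: "y^2 \<le> y0^2" "y0 * y \<le> y0^2" using xy y0 by (auto simp: power2_eq_square intro!: mult_mono)
    have "w * (1 - \<kappa> * x) * P p \<le> w * 2 * (3/4 * l * y0)"
    proof (cases "P p \<ge> 0")
      case True
      have "3/4 * l * y \<le> 3/4 * l * y0" using xy l by simp
      then show ?thesis using P\<zeta> \<zeta>_up True \<kappa>x w by (intro mult_mono) (auto simp: pxy)
    next
      case False
      then have "w * (1 - \<kappa> * x) * P p \<le> 0" using \<kappa>x w by (intro mult_nonneg_nonpos mult_nonneg_nonneg) (auto simp: pxy)
      then show ?thesis using l w y0 by (smt (verit) mult_pos_pos zero_less_divide_iff)
    qed
    also have "\<dots> = 3/16 * y0^2" using l(2) by (simp add: power2_eq_square algebra_simps)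
    finally have 1: "w * (1 - \<kappa> * x) * P p \<le> 3/16 * y0^2" .
    have "s * (- chi p) \<le> s * (1 * (9/4 * y0^2) / 400)"
    proof (intro mult_left_mono)
      have "e * (norm (x, y))^2 \<le> 1/400 * (9/4 * y0^2)" using e n2 yy by (intro mult_mono) auto
      then show "- chi p \<le> 1 * (9/4 * y0^2) / 400" using chi by simp
    qed (use s in auto)
    moreover have "s * y^2 \<le> s * y0^2" using yy s by simp
    moreover have "s * (V p)^2 / 2 \<ge> 0" "w / 2 * (P p)^2 \<ge> 0" using s w by auto
    moreover have "w * y0^2 = s * y0^2 + 2 * y0^2" by (simp add: w_def algebra_simps)
    moreover have "s * y0^2 \<ge> 0" "y0^2 \<ge> 0" using s by auto
    moreover have "s * (1 * (9/4 * y0^2) / 400) = (9/1600) * (s * y0^2)" by simp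
    ultimately show "C p - (U p)^2 \<le> w * y0^2" using 1 Ceq[of p] unfolding pxy fst_conv snd_conv by linarith
  qed
  \<comment> \<open>Where \<open>P\<close> is negative, the factor
    \<open>1 - \<kappa> * x \<ge> 1/2\<close> at most doubles the error
    \<open>y0 * y / 50\<close>.\<close>
  have P_ge: "- (y0 * snd p / (25 * w)) \<le> P p" if p: "p \<in> R" for p
  proof (cases "P p \<ge> 0")
    case True
    moreover have "y0 * snd p / (25 * w) \<ge> 0" using w y0 p by (auto simp: R_def)
    ultimately show ?thesis by linarith
  next
    case False
    have up: "(w * P p) * (1 - \<kappa> * fst p) \<le> (w * P p) * (1/2)"
      using False \<kappa>x[OF p] w by (intro mult_left_mono_neg) (auto simp: mult_le_0_iff)
    have "- (y0 * snd p / 50) \<le> w * P p * (1/2)"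
    proof -
      have "w * (1 - \<kappa> * fst p) * P p = (w * P p) * (1 - \<kappa> * fst p)" by simp
      then show ?thesis using P_low[OF p] zero_le_power2[of "snd p"] up by linarith
    qed
    then show ?thesis using w by (simp add: field_simps)
  qed
  have P_top: "2/5 * y0^2 / w \<le> P p" if p: "p \<in> R" "snd p = y0" for p
  proof -
    have "(snd p)^2 - y0 * snd p / 50 = 49/50 * y0^2" using p by (simp add: power2_eq_square)
    then have *: "49/50 * y0^2 \<le> w * (1 - \<kappa> * fst p) * P p" using P_low[OF p(1)] by simp
    moreover have "49/50 * y0^2 > 0" using y0 by simp
    ultimately have "0 < w * (1 - \<kappa> * fst p) * P p" by linarith
    moreover have "w * (1 - \<kappa> * fst p) > 0" using w \<kappa>x[OF p(1)] by auto
    ultimately have "P p > 0" by (simp add: zero_less_mult_iff)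
    then have "w * (1 - \<kappa> * fst p) * P p \<le> w * 2 * P p"
      using w \<kappa>x[OF p(1)] by (intro mult_right_mono mult_left_mono) auto
    then have "2/5 * y0^2 \<le> w * P p" using * \<open>49/50 * y0^2 > 0\<close> by linarith
    then show ?thesis using w by (simp add: pos_divide_le_eq mult_ac)
  qed
  \<comment> \<open>Subtracting the Taylor polynomial in \<open>z\<close> turns a maximum of
    \<open>U + z\<close> into a maximum of \<open>\<zeta> - P\<close>.\<close>
  have Z: "U p + z p = \<zeta> p - P p" for p by (simp add: z_def P_def)
  \<comment> \<open>The radius may depend on \<open>l\<close>, which is already fixed. Since the
    expansion of \<open>U\<close> has no term in \<open>y\<close>, \<open>P\<close> at
    \<open>(0, y1)\<close> is at most \<open>l * y1 / 4\<close>, half of what the barrier is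
    there.\<close>
  obtain \<rho>2 where \<rho>2: "\<rho>2 > 0" and asy2: "\<And>x y. (x, y) \<in> D \<Longrightarrow> norm (x, y) < \<rho>2 \<Longrightarrow>
        \<bar>U (x, y) - 1 + \<kappa> * x\<bar> \<le> l / 4 * norm (x, y)"
    using asy[of "l / 4"] l(1) by auto
  define y1 where "y1 = min y0 \<rho>2 / 2"
  have y1: "0 < y1" "y1 < y0" "y1 < \<rho>2" using y0(1) \<rho>2 by (auto simp: y1_def)
  define p0 where "p0 = (0::real, y1)"
  have p0R: "p0 \<in> R" using y0 y1 by (auto simp: R_def p0_def)
  have Zp0: "l * y1 / 4 \<le> U p0 + z p0"
  proof -
    have "\<bar>P p0\<bar> \<le> l / 4 * y1" using asy2[of 0 y1] RD[OF p0R] y1 by (simp add: P_def p0_def norm_Pair abs_minus_commute)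
    moreover have "\<zeta> p0 \<ge> l * (y1 / 2)" using l by (simp add: \<zeta>_def p0_def)
    ultimately show ?thesis unfolding Z by (simp add: abs_le_iff)
  qed
  have Zp0pos: "0 < l * y1 / 4" using l y1 by simp
  \<comment> \<open>Cutting off below height \<open>y1 / 16\<close> keeps the compact set away from
    the origin, which is only a boundary point of the region; this height is so small that
    \<open>\<zeta> - P\<close> cannot reach \<open>l * y1 / 4\<close> on the cut.\<close>
  define Kc where "Kc = {p :: plane. y1 / 16 \<le> snd p \<and> snd p \<le> y0 \<and> (fst p)^2 \<le> y0 * (snd p + 30 * (snd p)^2)}"
  define G where "G = {p :: plane. y1 / 16 < snd p \<and> snd p < y0 \<and> (fst p)^2 < y0 * (snd p + 30 * (snd p)^2)}"
  have KcR: "Kc \<subseteq> R" using y1 by (auto simp: Kc_def R_def)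
  have "compact Kc"
    unfolding compact_eq_bounded_closed
  proof
    show "bounded Kc"
    proof (rule bounded_subset[OF bounded_cball])
      show "Kc \<subseteq> cball 0 (3/2 * y0)"
        using tangential_region(3)[OF y0(1) y01] KcR by (force simp: R_def)
    qed
    show "closed Kc" unfolding Kc_def
      by (intro closed_Collect_conj closed_Collect_le continuous_intros)
  qed
  moreover have "open G" unfolding G_def
    by (intro open_Collect_conj open_Collect_less continuous_intros)
  moreover have "Kc \<subseteq> D" using KcR RD by blast
  moreover have "G \<subseteq> Kc" by (auto simp: G_def Kc_def)
  moreover have "p0 \<in> Kc" using y0 y1 by (auto simp: Kc_def p0_def)
  moreover have "z p = - 1 + \<kappa> * fst p + l / 2 * snd p + (- 2 * l / y0) * (fst p)^2 / 2 + (60 * l) * (snd p)^2 / 2" for p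
    by (simp add: z_def \<zeta>_def algebra_simps)
  moreover have "U p + z p < U p0 + z p0" if pKG: "p \<in> Kc - G" for p
  proof -
    have p: "p \<in> R" using pKG KcR by blast
    have y0l: "y0 / w = 8 * l" using w by (simp add: l_def)
    \<comment> \<open>On the bottom \<open>\<zeta>\<close> is at most \<open>3/64 * l * y1\<close>;
      on the top \<open>P\<close> is at least \<open>16/5 * l * y0\<close>, well above
      \<open>\<zeta>\<close>; on the lateral part \<open>\<zeta>\<close> equals
      \<open>- l * y / 2\<close>, which beats the lower bound \<open>- 8/25 * l * y\<close> for
      \<open>P\<close>.\<close>
    consider "snd p = y1 / 16" | "snd p = y0" | "(fst p)^2 = y0 * (snd p + 30 * (snd p)^2)"
      using pKG by (fastforce simp: Kc_def G_def)
    then have "\<zeta> p - P p < l * y1 / 4"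
    proof cases
      case 1
      have "y0 * snd p / (25 * w) = (y0 / w) * (y1 / 400)" unfolding 1 by simp
      then have "y0 * snd p / (25 * w) = l * y1 / 50" unfolding y0l by simp
      moreover have "\<zeta> p \<le> 3/64 * (l * y1)" using \<zeta>_up[OF p] 1 by simp
      ultimately show ?thesis using P_ge[OF p] Zp0pos by linarith
    next
      case 2
      have "2/5 * y0^2 / w = 2/5 * y0 * (y0 / w)" by (simp add: power2_eq_square)
      then have "2/5 * y0^2 / w = 16/5 * (l * y0)" unfolding y0l by simp
      moreover have "l * y0 > 0" using l y0 by simp
      moreover have "\<zeta> p \<le> 3/4 * (l * y0)" using \<zeta>_up[OF p] 2 by simp
      ultimately show ?thesis using P_top[OF p 2] Zp0pos by linarith
    next
      case 3
      have "(fst p)^2 / y0 = snd p + 30 * (snd p)^2" using y0(1) 3 by simp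
      then have "\<zeta> p = - (1/2 * (l * snd p))" unfolding \<zeta>_def by (simp add: algebra_simps)
      moreover have "y0 * snd p / (25 * w) = (y0 / w) * (snd p / 25)" by simp
      then have "y0 * snd p / (25 * w) = 8/25 * (l * snd p)" unfolding y0l by simp
      moreover have "l * snd p > 0" using l p by (auto simp: R_def)
      ultimately show ?thesis using P_ge[OF p] Zp0pos by linarith
    qed
    then show ?thesis using Zp0 unfolding Z by linarith
  qed
  ultimately obtain p where p: "p \<in> Kc" "U p0 + z p0 \<le> U p + z p"
    "a p + \<kappa> + (- 2 * l / y0) * fst p = 0" "b p + l / 2 + (60 * l) * snd p = 0"
    and ineq: "(C p - (U p)^2) * (- 2 * l / y0) + (C p - (V p)^2) * (60 * l) \<le>
       (Cx p - 2 * U p * a p) * (1 + a p) - 2 * (a p * V p + U p * b p) * b p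
       + (Cx p - 2 * V p * b p) * (1 + d p)"
    using contact_point[of Kc G p0 z "-1" \<kappa> "l / 2" "- 2 * l / y0" "60 * l"] sub pde by metis
  have pR: "p \<in> R" using p KcR by blast
  then have pr: "0 < snd p" "snd p \<le> y0" "(fst p)^2 \<le> y0 * (snd p + 30 * (snd p)^2)" by (auto simp: R_def)
  note tr = tangential_region[OF y0(1) y01 pr, unfolded prod.collapse]
  have "P p < \<zeta> p" using p(2) Zp0 Zp0pos unfolding Z by linarith
  then have E2: "C p - (U p)^2 \<le> (s + 2) * y0^2" using C_up[OF pR] by (simp add: w_def)
  have "\<bar>\<kappa> * fst p\<bar> \<le> 1 * (6/5 * y0)" unfolding abs_mult using \<kappa> tr(2) by (intro mult_mono) auto
  then have Ub: "99/100 \<le> U p" "U p \<le> 101/100" using U_near[OF pR] tr(3) y01 unfolding P_def by linarith+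
  have "(V p)^2 \<le> (1/10)^2" using V_near[OF pR] y01 by (subst abs_le_square_iff[symmetric]) simp
  moreover have "(U p)^2 \<ge> (99/100)^2" using Ub by (intro power_mono) auto
  moreover have s2: "(U p)^2 + (V p)^2 < C p" using sub RD pR by blast
  ultimately have F: "1/2 \<le> C p - (V p)^2" using zero_le_power2[of "V p"] by (simp add: power_divide)
  have al: "(s + 2) * (1 + a p) = 2 + fst p / 4"
  proof -
    have "1 + a p = (1 - \<kappa>) + 2 * l / y0 * fst p" using p(3) by simp
    moreover have "2 * l / y0 = 1 / (4 * w)" using y0 w by (simp add: l_def)
    ultimately have eq: "1 + a p = (1 - \<kappa>) + 1 / (4 * w) * fst p" by metis
    have "w * (1 + a p) = w * (1 - \<kappa>) + w * (1 / (4 * w) * fst p)" unfolding eq by (rule distrib_left)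
    moreover have "w * (1 / (4 * w) * fst p) = fst p / 4" using w by simp
    ultimately show ?thesis using \<kappa>(3) unfolding w_def[symmetric] by linarith
  qed
  have "U p * (1 + a p) * (2 - (s + 2) * (1 + a p)) - (s + 2) * (1 + a p) * V p * b p + 2 * V p * b p - 2 * U p * (b p)^2
      - (1 + d p) * (s * U p * (1 + a p) + (s + 2) * V p * b p)
      < (C p - (V p)^2) * (60 * l) - (C p - (U p)^2) * (2 * l / y0)"
  proof (rule barrier_estimate[OF s y0(1) _ pr(1,2) tr(2) _ al _ _ E2 F _ _ V_near[OF pR]])
    show "b p = - l * (1 / 2 + 60 * snd p)" using p(4) by (simp add: algebra_simps)
    show "0 \<le> C p - (U p)^2" using s2 zero_le_power2[of "V p"] by linarith
    show "(C p - (U p)^2) * (1 + a p) - 2 * U p * V p * b p + (C p - (V p)^2) * (1 + d p) = 0"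
      using pde RD pR by blast
  qed (use y0w l Ub in \<open>auto simp: w_def\<close>)
  moreover have "(Cx p - 2 * U p * a p) * (1 + a p) - 2 * (a p * V p + U p * b p) * b p
       + (Cx p - 2 * V p * b p) * (1 + d p)
     = U p * (1 + a p) * (2 - (s + 2) * (1 + a p)) - (s + 2) * (1 + a p) * V p * b p + 2 * V p * b p - 2 * U p * (b p)^2
      - (1 + d p) * (s * U p * (1 + a p) + (s + 2) * V p * b p)"
    unfolding Cx_def by (simp add: algebra_simps power2_eq_square)
  moreover have "(C p - (U p)^2) * (- 2 * l / y0) = - ((C p - (U p)^2) * (2 * l / y0))" by simp
  ultimately show False using ineq by linarith
qed

end

section \<open>Regularity up to a Lipschitz graph\<close>

lemma abs_inner_pair_le: "\<bar>A * fst h + B * snd h\<bar> \<le> (\<bar>A\<bar> + \<bar>B\<bar>) * norm (h :: plane)"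
proof -
  have "\<bar>A * fst h + B * snd h\<bar> \<le> \<bar>A\<bar> * \<bar>fst h\<bar> + \<bar>B\<bar> * \<bar>snd h\<bar>"
    by (metis abs_mult abs_triangle_ineq)
  also have "\<dots> \<le> \<bar>A\<bar> * norm h + \<bar>B\<bar> * norm h"
    using norm_fst_le[of "fst h" "snd h"] norm_snd_le[of "snd h" "fst h"] by (intro add_mono mult_left_mono) auto
  finally show ?thesis by (simp add: algebra_simps)
qed

lemma segment_increment_bound:
  fixes H :: "plane \<Rightarrow> real"
  assumes "\<And>q. q \<in> closed_segment x y \<Longrightarrow> (H has_derivative (lin (A q) (B q))) (at q)"
    and "\<And>q. q \<in> closed_segment x y \<Longrightarrow> \<bar>A q\<bar> \<le> \<epsilon> \<and> \<bar>B q\<bar> \<le> \<epsilon>"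
  shows "\<bar>H y - H x\<bar> \<le> 2 * \<epsilon> * norm (y - x)"
proof -
  have "norm (H y - H x) \<le> (2 * \<epsilon>) * norm (y - x)"
  proof (rule differentiable_bound[OF convex_closed_segment[of x y]])
    show "(H has_derivative (lin (A q) (B q))) (at q within closed_segment x y)"
      if "q \<in> closed_segment x y" for q
      using assms(1)[OF that] by (rule has_derivative_at_withinI)
    show "onorm (lin (A q) (B q)) \<le> 2 * \<epsilon>" if "q \<in> closed_segment x y" for q
    proof (rule onorm_le)
      fix h :: plane
      have "\<bar>A q * fst h + B q * snd h\<bar> \<le> (\<bar>A q\<bar> + \<bar>B q\<bar>) * norm h" by (rule abs_inner_pair_le)
      also have "\<dots> \<le> (2 * \<epsilon>) * norm h" using assms(2)[OF that] by (intro mult_right_mono) auto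
      finally show "norm (A q * fst h + B q * snd h) \<le> 2 * \<epsilon> * norm h" by simp
    qed
  qed auto
  then show ?thesis by simp
qed

text \<open>Boundary values of derivatives are given only as limits from inside. Up to a Lipschitz
  graph such limits are genuine derivatives relative to the closed side: \<open>F\<close> minus its
  linear part has a small gradient near \<open>p\<close>, and nearby points can be joined inside the
  open side by paths of comparable length. The chain rule along the curve and the gluing of the two
  sides depend on this.\<close>

lemma has_derivative_upto_Lipschitz_graph:
  fixes F A B :: "plane \<Rightarrow> real" and t e Q :: plane and r :: real and f :: "real \<Rightarrow> real"
  defines "S \<equiv> {p. f (p \<bullet> t) < p \<bullet> e} \<inter> ball Q r" and "cS \<equiv> {p. f (p \<bullet> t) \<le> p \<bullet> e} \<inter> ball Q r"
  assumes te: "norm t = 1" "norm e = 1" "t \<bullet> e = 0"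
    and \<Lambda>: "\<Lambda> \<ge> 0" "\<And>p q. p \<in> ball Q r \<Longrightarrow> q \<in> ball Q r \<Longrightarrow> \<bar>f (p \<bullet> t) - f (q \<bullet> t)\<bar> \<le> \<Lambda> * \<bar>p \<bullet> t - q \<bullet> t\<bar>"
    and der: "\<And>p. p \<in> S \<Longrightarrow> (F has_derivative (lin (A p) (B p))) (at p)"
    and cont: "continuous_on cS F" "continuous_on cS A" "continuous_on cS B"
    and p: "p \<in> cS"
  shows "(F has_derivative (lin (A p) (B p))) (at p within cS)"
  unfolding has_derivative_within_alt
proof (intro conjI allI impI)
  show "bounded_linear (lin (A p) (B p))"
    by (intro bounded_linear_intros)
  fix \<epsilon>0 :: real assume \<epsilon>0: "\<epsilon>0 > 0"
  \<comment> \<open>\<open>M * N\<close> will be the length of the path: twice the lift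
    \<open>T = (\<Lambda> + 1) * N\<close> plus the crossing \<open>N\<close>.\<close>
  define M where "M = 2 * \<Lambda> + 3"
  have M: "M \<ge> 3" using \<Lambda> by (simp add: M_def)
  define \<epsilon> where "\<epsilon> = \<epsilon>0 / (2 * M)"
  have \<epsilon>: "\<epsilon> > 0" using \<epsilon>0 M by (simp add: \<epsilon>_def)
  obtain d1 where d1: "d1 > 0" "\<And>q. q \<in> cS \<Longrightarrow> dist q p < d1 \<Longrightarrow> dist (A q) (A p) < \<epsilon>"
    using cont(2) p \<epsilon> unfolding continuous_on_iff by metis
  obtain d2 where d2: "d2 > 0" "\<And>q. q \<in> cS \<Longrightarrow> dist q p < d2 \<Longrightarrow> dist (B q) (B p) < \<epsilon>"
    using cont(3) p \<epsilon> unfolding continuous_on_iff by metis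
  have pQ: "p \<in> ball Q r" using p by (simp add: cS_def)
  define \<delta> where "\<delta> = min (min d1 d2) (r - dist Q p)"
  have \<delta>: "\<delta> > 0" "\<delta> \<le> d1" "\<delta> \<le> d2" using d1 d2 pQ by (auto simp: \<delta>_def)
  have inball: "q \<in> ball Q r" if "norm (q - p) < \<delta>" for q
  proof -
    have "dist Q q \<le> dist Q p + norm (q - p)" by (metis dist_commute dist_norm dist_triangle)
    then show ?thesis using that by (auto simp: \<delta>_def)
  qed
  have te': "\<bar>v \<bullet> t\<bar> \<le> norm v" "\<bar>v \<bullet> e\<bar> \<le> norm v" for v
    using Cauchy_Schwarz_ineq2[of v t] Cauchy_Schwarz_ineq2[of v e] te by auto
  have ee: "e \<bullet> e = 1" "e \<bullet> t = 0" using te by (auto simp: dot_square_norm inner_commute)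
  define H where "H q = F q - (A p * fst q + B p * snd q)" for q
  have derH: "(H has_derivative (lin (A q - A p) (B q - B p))) (at q)" if "q \<in> S" for q
    unfolding H_def
    by (rule derivative_eq_intros der[OF that] | rule refl)+ (simp add: fun_eq_iff algebra_simps)
  have contH: "continuous_on cS H"
    unfolding H_def by (intro continuous_intros cont)
  show "\<exists>d>0. \<forall>q\<in>cS. norm (q - p) < d \<longrightarrow>
      norm (F q - F p - (A p * fst (q - p) + B p * snd (q - p))) \<le> \<epsilon>0 * norm (q - p)"
  proof (intro exI[of _ "\<delta> / (2 * M)"] conjI ballI impI)
    show "\<delta> / (2 * M) > 0" using \<delta> M by simp
    fix q assume q: "q \<in> cS" "norm (q - p) < \<delta> / (2 * M)"
    define N where "N = norm (q - p)"
    have MN: "M * N < \<delta> / 2" using q M by (simp add: N_def field_simps)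
    have N0: "N \<ge> 0" by (simp add: N_def)
    \<comment> \<open>During the crossing the graph rises by at most \<open>\<Lambda> * N\<close>
      and the moving point sinks by at most \<open>N\<close>; this lift covers both.\<close>
    define T where "T = (\<Lambda> + 1) * N"
    have T: "T \<ge> 0" "2 * T + N = M * N" using \<Lambda> N0 by (auto simp: T_def M_def algebra_simps)
    have small: "\<bar>A z - A p\<bar> \<le> \<epsilon> \<and> \<bar>B z - B p\<bar> \<le> \<epsilon>" if "z \<in> S" "norm (z - p) < \<delta>" for z
      using d1(2)[of z] d2(2)[of z] that \<delta> by (auto simp: S_def cS_def dist_norm)
    \<comment> \<open>The segment from \<open>p\<close> to \<open>q\<close> may leave \<open>S\<close>; go up by \<open>T\<close>, across, and down instead. The shift by \<open>s\<close> keeps the path off the graph.\<close>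
    have shifted: "\<bar>H (q + s *\<^sub>R e) - H (p + s *\<^sub>R e)\<bar> \<le> 2 * \<epsilon> * (M * N)" if s: "0 < s" "s < \<delta> / 2" for s
    proof -
      have vert: "z + u *\<^sub>R e \<in> S \<and> norm (z + u *\<^sub>R e - p) < \<delta>"
        if z: "z \<in> {p, q}" and u: "s \<le> u" "u \<le> s + T" for z u
      proof -
        have zc: "z \<in> cS" "norm (z - p) \<le> N" using z p q by (auto simp: N_def)
        have "norm (z + u *\<^sub>R e - p) \<le> norm (z - p) + norm (u *\<^sub>R e)"
          by (metis add_diff_eq diff_add_eq norm_triangle_ineq)
        also have "\<dots> \<le> N + (s + T)" using zc u s te by auto
        also have "\<dots> < \<delta>" using T MN s N0 by linarith
        finally have n: "norm (z + u *\<^sub>R e - p) < \<delta>" .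
        have "f (z \<bullet> t) \<le> z \<bullet> e" using zc by (simp add: cS_def)
        then show ?thesis using inball[OF n] n u s by (simp add: S_def inner_add_left ee)
      qed
      have seg: "z \<in> S \<and> norm (z - p) < \<delta>"
        if z: "z \<in> closed_segment (p + (s + T) *\<^sub>R e) (q + (s + T) *\<^sub>R e)" for z
      proof -
        obtain c where c: "0 \<le> c" "c \<le> 1" "z = p + (s + T) *\<^sub>R e + c *\<^sub>R (q - p)"
          using z by (auto simp: in_segment algebra_simps)
        have cN: "norm (c *\<^sub>R (q - p)) \<le> N" using c mult_right_mono[of c 1 N] N0 by (simp add: N_def)
        have "norm (z - p) \<le> norm ((s + T) *\<^sub>R e) + norm (c *\<^sub>R (q - p))"
          using norm_triangle_ineq[of "(s + T) *\<^sub>R e" "c *\<^sub>R (q - p)"] by (simp add: c(3) algebra_simps)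
        also have "\<dots> \<le> (s + T) + N" using cN s T te by simp
        also have "\<dots> < \<delta>" using T MN s N0 by linarith
        finally have n: "norm (z - p) < \<delta>" .
        have zt: "z \<bullet> t - p \<bullet> t = (c *\<^sub>R (q - p)) \<bullet> t" by (simp add: c(3) inner_add_left inner_diff_left ee)
        have ze: "z \<bullet> e = p \<bullet> e + s + T + (c *\<^sub>R (q - p)) \<bullet> e" by (simp add: c(3) inner_add_left inner_diff_left ee algebra_simps)
        have "f (z \<bullet> t) \<le> f (p \<bullet> t) + \<Lambda> * \<bar>z \<bullet> t - p \<bullet> t\<bar>"
          using \<Lambda>(2)[OF inball[OF n] pQ] by linarith
        also have "\<dots> \<le> p \<bullet> e + \<Lambda> * N"
          using p te'(1)[of "c *\<^sub>R (q - p)"] cN \<Lambda>(1) unfolding zt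
          by (intro add_mono mult_left_mono) (auto simp: cS_def)
        also have "\<dots> < z \<bullet> e"
          using te'(2)[of "c *\<^sub>R (q - p)"] cN s unfolding ze T_def by (simp add: algebra_simps abs_le_iff)
        finally show ?thesis using inball[OF n] n by (simp add: S_def)
      qed
      have vseg: "z \<in> S \<and> norm (z - p) < \<delta>"
        if z: "z \<in> closed_segment (w + s *\<^sub>R e) (w + (s + T) *\<^sub>R e)" and w: "w \<in> {p, q}" for z w
      proof -
        obtain c where c: "0 \<le> c" "c \<le> 1" "z = w + (s + c * T) *\<^sub>R e"
          using z by (auto simp: in_segment algebra_simps)
        show ?thesis unfolding c(3) using vert[OF w, of "s + c * T"] c T mult_right_mono[of c 1 T] by simp
      qed
      have b1: "\<bar>H (w + (s + T) *\<^sub>R e) - H (w + s *\<^sub>R e)\<bar> \<le> 2 * \<epsilon> * T" if w: "w \<in> {p, q}" for w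
      proof -
        have "\<bar>H (w + (s + T) *\<^sub>R e) - H (w + s *\<^sub>R e)\<bar> \<le> 2 * \<epsilon> * norm ((w + (s + T) *\<^sub>R e) - (w + s *\<^sub>R e))"
          by (rule segment_increment_bound[OF derH]) (use vseg w small in blast)+
        also have "(w + (s + T) *\<^sub>R e) - (w + s *\<^sub>R e) = T *\<^sub>R e" by (simp add: algebra_simps)
        finally show ?thesis using te T by simp
      qed
      have "\<bar>H (q + (s + T) *\<^sub>R e) - H (p + (s + T) *\<^sub>R e)\<bar> \<le> 2 * \<epsilon> * norm ((q + (s + T) *\<^sub>R e) - (p + (s + T) *\<^sub>R e))"
        by (rule segment_increment_bound[OF derH]) (use seg small in blast)+
      then have b2: "\<bar>H (q + (s + T) *\<^sub>R e) - H (p + (s + T) *\<^sub>R e)\<bar> \<le> 2 * \<epsilon> * N" by (simp add: N_def)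
      have "2 * \<epsilon> * (M * N) = 2 * \<epsilon> * T + 2 * \<epsilon> * N + 2 * \<epsilon> * T"
        unfolding T(2)[symmetric] by (simp add: algebra_simps)
      moreover have "\<bar>H (p + (s + T) *\<^sub>R e) - H (p + s *\<^sub>R e)\<bar> \<le> 2 * \<epsilon> * T"
        "\<bar>H (q + (s + T) *\<^sub>R e) - H (q + s *\<^sub>R e)\<bar> \<le> 2 * \<epsilon> * T"
        by (rule b1, simp)+
      ultimately show ?thesis using b2 by linarith
    qed
    \<comment> \<open>Continuity of \<open>H\<close> up to the graph removes the auxiliary shift by
      \<open>s\<close>.\<close>
    have lim: "((\<lambda>s. H (w + s *\<^sub>R e)) \<longlongrightarrow> H w) (at_right 0)" if w: "w \<in> {p, q}" for w
    proof -
      have wc: "w \<in> cS" "norm (w - p) < \<delta> / 2" using w p q MN N0 M \<delta> mult_right_mono[of 1 M N] by (auto simp: N_def)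
      have "((\<lambda>s. w + s *\<^sub>R e) \<longlongrightarrow> w + 0 *\<^sub>R e) (at_right 0)" by (intro tendsto_intros)
      then have l1: "((\<lambda>s. w + s *\<^sub>R e) \<longlongrightarrow> w) (at_right 0)" by simp
      have "\<forall>\<^sub>F s in at_right (0::real). 0 < s \<and> s < \<delta> / 2"
        unfolding eventually_at_right_field using \<delta>(1) by (intro exI[of _ "\<delta> / 2"]) auto
      then have l2: "\<forall>\<^sub>F s in at_right (0::real). w + s *\<^sub>R e \<in> cS"
      proof eventually_elim
        case (elim s)
        have "norm (w + s *\<^sub>R e - p) \<le> norm (w - p) + norm (s *\<^sub>R e)"
          by (metis add_diff_eq diff_add_eq norm_triangle_ineq)
        also have "\<dots> < \<delta>" using wc te elim by simp
        finally have "norm (w + s *\<^sub>R e - p) < \<delta>" .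
        then show ?case using inball wc elim by (auto simp: cS_def inner_add_left ee)
      qed
      show ?thesis
        by (rule continuous_on_tendsto_compose[OF contH l1 wc(1) l2])
    qed
    have "\<bar>H q - H p\<bar> \<le> 2 * \<epsilon> * (M * N)"
    proof (rule tendsto_le[OF _ tendsto_const tendsto_rabs[OF tendsto_diff[OF lim lim]]])
      show "\<forall>\<^sub>F s in at_right (0::real). \<bar>H (q + s *\<^sub>R e) - H (p + s *\<^sub>R e)\<bar> \<le> 2 * \<epsilon> * (M * N)"
        unfolding eventually_at_right_field using shifted \<delta>(1) by (intro exI[of _ "\<delta> / 2"]) auto
    qed auto
    also have "2 * \<epsilon> * (M * N) = \<epsilon>0 * norm (q - p)" using M by (simp add: \<epsilon>_def N_def)
    finally show "norm (F q - F p - (A p * fst (q - p) + B p * snd (q - p))) \<le> \<epsilon>0 * norm (q - p)"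
      by (simp add: H_def algebra_simps)
  qed
qed

lemma has_derivative_within_Un:
  assumes "(F has_derivative F') (at p within S)" "(F has_derivative F') (at p within T)"
  shows "(F has_derivative F') (at p within S \<union> T)"
  using assms unfolding has_derivative_within by (simp add: at_within_union filterlim_sup)

text \<open>Schwarz's theorem, from the second-order difference of \<phi> over a small square,
  evaluated by the mean value theorem in both orders. \<open>C2_upto\<close> treats the two mixed
  derivatives separately, so their equality has to be derived.\<close>

lemma mixed_partials_commute:
  fixes \<phi> U V a b b' d :: "plane \<Rightarrow> real"
  assumes D: "open D" "p \<in> D"
    and der: "\<And>p. p \<in> D \<Longrightarrow> (\<phi> has_derivative (lin (U p) (V p))) (at p)"
       "\<And>p. p \<in> D \<Longrightarrow> (U has_derivative (lin (a p) (b p))) (at p)"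
       "\<And>p. p \<in> D \<Longrightarrow> (V has_derivative (lin (b' p) (d p))) (at p)"
    and cont: "isCont b p" "isCont b' p"
  shows "b p = b' p"
proof (rule ccontr)
  assume ne: "b p \<noteq> b' p"
  define \<epsilon> where "\<epsilon> = \<bar>b p - b' p\<bar> / 2"
  have \<epsilon>: "\<epsilon> > 0" using ne by (simp add: \<epsilon>_def)
  obtain d1 where d1: "d1 > 0" "\<And>q. dist q p < d1 \<Longrightarrow> dist (b q) (b p) < \<epsilon>"
    using cont(1) \<epsilon> unfolding continuous_at_eps_delta by (metis dist_norm)
  obtain d2 where d2: "d2 > 0" "\<And>q. dist q p < d2 \<Longrightarrow> dist (b' q) (b' p) < \<epsilon>"
    using cont(2) \<epsilon> unfolding continuous_at_eps_delta by (metis dist_norm)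
  obtain d3 where d3: "d3 > 0" "ball p d3 \<subseteq> D" using D openE by blast
  define h where "h = min d1 (min d2 d3) / 3"
  have h: "h > 0" "3 * h \<le> d1" "3 * h \<le> d2" "3 * h \<le> d3" using d1 d2 d3 by (auto simp: h_def)
  obtain x y where p: "p = (x, y)" by (cases p)
  have near: "dist (x + u, y + v) p < 3 * h" if "0 \<le> u" "u \<le> h" "0 \<le> v" "v \<le> h" for u v
  proof -
    have "dist (x + u, y + v) p = norm (u, v)" by (simp add: p dist_norm)
    also have "\<dots> \<le> \<bar>u\<bar> + \<bar>v\<bar>" using norm_Pair_le[of u v] by simp
    finally show ?thesis using that h by linarith
  qed
  have inD: "(x + u, y + v) \<in> D" if "0 \<le> u" "u \<le> h" "0 \<le> v" "v \<le> h" for u v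
    using near[OF that] d3 h by (auto simp: dist_commute)
  have along_x: "((\<lambda>u. F (x + u, y + v)) has_real_derivative A (x + u, y + v)) (at u)"
    if "\<And>p. p \<in> D \<Longrightarrow> (F has_derivative (lin (A p) (B p))) (at p)"
      "0 \<le> u" "u \<le> h" "0 \<le> v" "v \<le> h" for F A B :: "plane \<Rightarrow> real" and u v
    using has_real_derivative_along_line[of F "A (x + u, y + v)" "B (x + u, y + v)" "(x, y + v)" u "(1, 0)"]
      that(1)[OF inD[OF that(2-)]] by simp
  have along_y: "((\<lambda>v. F (x + u, y + v)) has_real_derivative B (x + u, y + v)) (at v)"
    if "\<And>p. p \<in> D \<Longrightarrow> (F has_derivative (lin (A p) (B p))) (at p)"
      "0 \<le> u" "u \<le> h" "0 \<le> v" "v \<le> h" for F A B :: "plane \<Rightarrow> real" and u v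
    using has_real_derivative_along_line[of F "A (x + u, y + v)" "B (x + u, y + v)" "(x + u, y)" v "(0, 1)"]
      that(1)[OF inD[OF that(2-)]] by simp
  define \<Delta> where "\<Delta> = \<phi> (x + h, y + h) - \<phi> (x + h, y) - (\<phi> (x, y + h) - \<phi> (x, y))"
  have "\<exists>u>0. u < h \<and> (\<phi> (x + h, y + h) - \<phi> (x + h, y + 0)) - (\<phi> (x + 0, y + h) - \<phi> (x + 0, y + 0))
      = (h - 0) * (U (x + u, y + h) - U (x + u, y + 0))"
    by (rule MVT2, (use h in simp)[1], intro DERIV_diff along_x[OF der(1)]) (use h in simp_all)
  then obtain u where u: "0 < u" "u < h" "\<Delta> = h * (U (x + u, y + h) - U (x + u, y + 0))"
    by (auto simp: \<Delta>_def)
  have "\<exists>v>0. v < h \<and> U (x + u, y + h) - U (x + u, y + 0) = (h - 0) * b (x + u, y + v)"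
    by (rule MVT2, (use h u in simp)[1], intro along_y[OF der(2)]) (use h u in simp_all)
  then obtain v where v: "0 < v" "v < h" "\<Delta> = h * (h * b (x + u, y + v))" using u by auto
  have "\<exists>v>0. v < h \<and> (\<phi> (x + h, y + h) - \<phi> (x + 0, y + h)) - (\<phi> (x + h, y + 0) - \<phi> (x + 0, y + 0))
      = (h - 0) * (V (x + h, y + v) - V (x + 0, y + v))"
    by (rule MVT2, (use h in simp)[1], intro DERIV_diff along_y[OF der(1)]) (use h in simp_all)
  then obtain v' where v': "0 < v'" "v' < h" "\<Delta> = h * (V (x + h, y + v') - V (x + 0, y + v'))"
    by (auto simp: \<Delta>_def)
  have "\<exists>u>0. u < h \<and> V (x + h, y + v') - V (x + 0, y + v') = (h - 0) * b' (x + u, y + v')"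
    by (rule MVT2, (use h v' in simp)[1], intro along_x[OF der(3)]) (use h v' in simp_all)
  then obtain u' where u': "0 < u'" "u' < h" "\<Delta> = h * (h * b' (x + u', y + v'))" using v' by auto
  have "b (x + u, y + v) = b' (x + u', y + v')" using u' v h by simp
  moreover have "dist (b (x + u, y + v)) (b p) < \<epsilon>" using near[of u v] u v h by (intro d1) auto
  moreover have "dist (b' (x + u', y + v')) (b' p) < \<epsilon>" using near[of u' v'] u' v' h by (intro d2) auto
  ultimately have "\<bar>b p - b' p\<bar> < \<epsilon> + \<epsilon>" unfolding dist_real_def by linarith
  then show False by (simp add: \<epsilon>_def)
qed

section \<open>The flow on one side of the sonic curve\<close>

lemma has_derivative_pd:
  assumes "\<phi> differentiable (at p)"
  shows "(\<phi> has_derivative (lin (pd1 \<phi> p) (pd2 \<phi> p))) (at p)"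
    and "(\<phi> has_derivative (lin A B)) (at p) \<Longrightarrow> pd1 \<phi> p = A \<and> pd2 \<phi> p = B"
proof -
  have *: "pd1 \<phi> p = A \<and> pd2 \<phi> p = B" if "(\<phi> has_derivative (lin A B)) (at p)" for A B
  proof -
    obtain x y where p: "p = (x, y)" by (cases p)
    have "((\<lambda>u. \<phi> ((0, y) + u *\<^sub>R (1, 0))) has_real_derivative A * fst (1::real, 0::real) + B * snd (1::real, 0::real)) (at x)"
      by (rule has_real_derivative_along_line) (use that in \<open>simp add: p\<close>)
    then have 1: "((\<lambda>u. \<phi> (u, y)) has_real_derivative A) (at x)" by simp
    have "((\<lambda>u. \<phi> ((x, 0) + u *\<^sub>R (0, 1))) has_real_derivative A * fst (0::real, 1::real) + B * snd (0::real, 1::real)) (at y)"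
      by (rule has_real_derivative_along_line) (use that in \<open>simp add: p\<close>)
    then have 2: "((\<lambda>u. \<phi> (x, u)) has_real_derivative B) (at y)" by simp
    show ?thesis using 1 2 by (auto simp: pd1_def pd2_def p intro!: DERIV_imp_deriv)
  qed
  then show "(\<phi> has_derivative (lin A B)) (at p) \<Longrightarrow> pd1 \<phi> p = A \<and> pd2 \<phi> p = B" .
  obtain F where F: "(\<phi> has_derivative F) (at p)" using assms by (auto simp: differentiable_def)
  interpret F: bounded_linear F using F by (rule has_derivative_bounded_linear)
  have "F h = F (1, 0) * fst h + F (0, 1) * snd h" for h
  proof -
    have "h = fst h *\<^sub>R (1, 0) + snd h *\<^sub>R (0, 1)" by (simp add: prod_eq_iff)
    then have "F h = F (fst h *\<^sub>R (1, 0) + snd h *\<^sub>R (0, 1))" by simp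
    also have "\<dots> = fst h * F (1, 0) + snd h * F (0, 1)" by (simp only: F.add F.scaleR real_scaleR_def)
    finally show ?thesis by simp
  qed
  then have eq: "F = (lin (F (1, 0)) (F (0, 1)))" by (rule ext)
  have "(\<phi> has_derivative (lin (F (1, 0)) (F (0, 1)))) (at p)"
    using F by (rule has_derivative_eq_rhs) (rule eq)
  with *[OF this] show "(\<phi> has_derivative (lin (pd1 \<phi> p) (pd2 \<phi> p))) (at p)" by simp
qed

lemma pd_eqI:
  assumes "(\<phi> has_derivative (lin A B)) (at p)"
  shows "pd1 \<phi> p = A" "pd2 \<phi> p = B"
  using has_derivative_pd(2)[OF _ assms] assms by (auto simp: differentiable_def)

lemma value_from_in: "p \<in> \<Omega> \<Longrightarrow> value_from \<Omega> g p = g p"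
  by (simp add: value_from_def)

lemma bernoulli_eq:
  "bernoulli K \<Omega> \<phi> p = K - \<phi> p - ((value_from \<Omega> (pd1 \<phi>) p)^2 + (value_from \<Omega> (pd2 \<phi>) p)^2) / 2"
  by (simp add: bernoulli_def grad_from_def norm_Pair)

lemma has_derivative_value_from:
  assumes "open \<Omega>" "p \<in> \<Omega>" "(g has_derivative g') (at p)"
  shows "(value_from \<Omega> g has_derivative g') (at p)"
  by (rule has_derivative_transform_within_open[OF assms(3) assms(1,2)]) (simp add: value_from_in)

text \<open>Positivity of the Bernoulli term makes \<open>powr\<close> differentiable and allows the
  common factor \<open>B powr (k - 1)\<close> to be cancelled from the divergence, which leaves the
  quasilinear form. The mixed derivatives \<open>b\<close> and \<open>b'\<close> are kept apart,
  since no continuity of second derivatives is assumed here.\<close>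

lemma potential_flow_nondivergence:
  fixes \<gamma> K :: real
  assumes "\<gamma> > 1" and flow: "potential_flow \<gamma> K \<Omega> \<phi>" and \<Omega>: "open \<Omega>" "p \<in> \<Omega>"
    and diff: "\<phi> differentiable_on \<Omega>" "pd1 \<phi> differentiable_on \<Omega>" "pd2 \<phi> differentiable_on \<Omega>"
    and pos: "bernoulli K \<Omega> \<phi> p > 0"
  defines "U \<equiv> pd1 \<phi> p" and "V \<equiv> pd2 \<phi> p" and "a \<equiv> pd1 (pd1 \<phi>) p" and "b \<equiv> pd2 (pd1 \<phi>) p"
    and "b' \<equiv> pd1 (pd2 \<phi>) p" and "d \<equiv> pd2 (pd2 \<phi>) p"
  shows "(\<gamma> - 1) * bernoulli K \<Omega> \<phi> p * (2 + a + d) = U^2 * (1 + a) + U * V * (b + b') + V^2 * (1 + d)"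
    and "(bernoulli K \<Omega> \<phi> has_derivative (lin (- (U + U * a + V * b')) (- (V + U * b + V * d)))) (at p)"
proof -
  have diffp: "\<phi> differentiable (at p)" "pd1 \<phi> differentiable (at p)" "pd2 \<phi> differentiable (at p)"
    using diff \<Omega> by (simp_all add: differentiable_on_eq_differentiable_at)
  note der = has_derivative_pd(1)[OF diffp(1), folded U_def V_def]
    has_derivative_pd(1)[OF diffp(2), folded a_def b_def] has_derivative_pd(1)[OF diffp(3), folded b'_def d_def]
  define B where "B = bernoulli K \<Omega> \<phi> p"
  have Bpos: "B > 0" using pos by (simp add: B_def)
  have "((\<lambda>q. K - \<phi> q - ((pd1 \<phi> q)^2 + (pd2 \<phi> q)^2) / 2) has_derivative
      (lin (- (U + U * a + V * b')) (- (V + U * b + V * d)))) (at p)"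
    by (rule derivative_eq_intros der | rule refl | (simp; fail))+
      (simp add: fun_eq_iff algebra_simps U_def V_def)
  then show dB: "(bernoulli K \<Omega> \<phi> has_derivative (lin (- (U + U * a + V * b')) (- (V + U * b + V * d)))) (at p)"
    by (rule has_derivative_transform_within_open[OF _ \<Omega>]) (simp add: bernoulli_eq value_from_in)
  define k where "k = 1 / (\<gamma> - 1)"
  have k: "k * (\<gamma> - 1) = 1" using assms(1) by (simp add: k_def)
  have dens: "density \<gamma> K \<Omega> \<phi> = (\<lambda>q. bernoulli K \<Omega> \<phi> q powr k)"
    by (rule ext) (simp add: density_def k_def)
  have "((\<lambda>z. z powr k) has_derivative (\<lambda>h. h * (k * B powr (k - 1)))) (at (bernoulli K \<Omega> \<phi> p))"
    using has_real_derivative_powr[OF Bpos, of k] unfolding has_field_derivative_def B_def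
    by (rule has_derivative_eq_rhs) (simp add: fun_eq_iff)
  from has_derivative_compose[OF dB this[unfolded B_def]]
  have d\<rho>: "(density \<gamma> K \<Omega> \<phi> has_derivative (\<lambda>h. (- (U + U * a + V * b') * fst h + - (V + U * b + V * d) * snd h) * (k * B powr (k - 1)))) (at p)"
    unfolding dens B_def .
  define \<rho> where "\<rho> = density \<gamma> K \<Omega> \<phi> p"
  have \<rho>: "\<rho> = B powr (k - 1) * B"
  proof -
    have "B powr k = B powr (k - 1) * B powr 1" by (simp only: powr_add[symmetric]) simp
    then show ?thesis using Bpos by (simp add: \<rho>_def density_def B_def k_def)
  qed
  have p1: "pd1 (\<lambda>q. fst (density \<gamma> K \<Omega> \<phi> q *\<^sub>R grad \<phi> q)) p = - (U + U * a + V * b') * (k * B powr (k - 1)) * U + \<rho> * a"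
  proof (rule pd_eqI)
    show "((\<lambda>q. fst (density \<gamma> K \<Omega> \<phi> q *\<^sub>R grad \<phi> q)) has_derivative
       (lin (- (U + U * a + V * b') * (k * B powr (k - 1)) * U + \<rho> * a) (- (V + U * b + V * d) * (k * B powr (k - 1)) * U + \<rho> * b))) (at p)"
      unfolding grad_def fst_scaleR fst_conv real_scaleR_def
      by (rule has_derivative_eq_rhs[OF has_derivative_mult[OF d\<rho> der(2)]])
        (simp add: fun_eq_iff algebra_simps \<rho>_def U_def)
  qed
  have p2: "pd2 (\<lambda>q. snd (density \<gamma> K \<Omega> \<phi> q *\<^sub>R grad \<phi> q)) p = - (V + U * b + V * d) * (k * B powr (k - 1)) * V + \<rho> * d"
  proof (rule pd_eqI)
    show "((\<lambda>q. snd (density \<gamma> K \<Omega> \<phi> q *\<^sub>R grad \<phi> q)) has_derivative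
       (lin (- (U + U * a + V * b') * (k * B powr (k - 1)) * V + \<rho> * b') (- (V + U * b + V * d) * (k * B powr (k - 1)) * V + \<rho> * d))) (at p)"
      unfolding grad_def snd_scaleR snd_conv real_scaleR_def
      by (rule has_derivative_eq_rhs[OF has_derivative_mult[OF d\<rho> der(3)]])
        (simp add: fun_eq_iff algebra_simps \<rho>_def V_def)
  qed
  have "pd1 (\<lambda>q. fst (density \<gamma> K \<Omega> \<phi> q *\<^sub>R grad \<phi> q)) p + pd2 (\<lambda>q. snd (density \<gamma> K \<Omega> \<phi> q *\<^sub>R grad \<phi> q)) p + 2 * \<rho> = 0"
    using flow \<Omega> by (auto simp: potential_flow_def divergence_def \<rho>_def)
  then have "B powr (k - 1) * (B * (2 + a + d) - k * (U^2 * (1 + a) + U * V * (b + b') + V^2 * (1 + d))) = 0"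
    unfolding p1 p2 \<rho> by (simp add: algebra_simps power2_eq_square)
  then have "B * (2 + a + d) = k * (U^2 * (1 + a) + U * V * (b + b') + V^2 * (1 + d))"
    using Bpos by simp
  then have "(\<gamma> - 1) * (B * (2 + a + d)) = (k * (\<gamma> - 1)) * (U^2 * (1 + a) + U * V * (b + b') + V^2 * (1 + d))"
    by simp
  then show "(\<gamma> - 1) * bernoulli K \<Omega> \<phi> p * (2 + a + d) = U^2 * (1 + a) + U * V * (b + b') + V^2 * (1 + d)"
    unfolding k B_def by (simp add: mult.assoc)
qed

lemma closed_epigraph_subset_closure:
  fixes t e Q :: plane and r :: real and f :: "real \<Rightarrow> real"
  assumes te: "norm t = 1" "norm e = 1" "t \<bullet> e = 0"
  defines "S \<equiv> {p. f (p \<bullet> t) < p \<bullet> e} \<inter> ball Q r" and "cS \<equiv> {p. f (p \<bullet> t) \<le> p \<bullet> e} \<inter> ball Q r"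
  shows "cS \<subseteq> closure S"
proof
  fix p assume p: "p \<in> cS"
  have ee: "e \<bullet> e = 1" "e \<bullet> t = 0" using te by (auto simp: dot_square_norm inner_commute)
  have pr: "dist Q p < r" using p by (simp add: cS_def)
  have "((\<lambda>s. p + s *\<^sub>R e) \<longlongrightarrow> p + 0 *\<^sub>R e) (at_right 0)" by (intro tendsto_intros)
  then have lim: "((\<lambda>s. p + s *\<^sub>R e) \<longlongrightarrow> p) (at_right 0)" by simp
  have "\<forall>\<^sub>F s in at_right (0::real). 0 < s \<and> s < r - dist Q p"
    unfolding eventually_at_right_field using pr by (intro exI[of _ "r - dist Q p"]) auto
  then have ev: "\<forall>\<^sub>F s in at_right (0::real). p + s *\<^sub>R e \<in> closure S"
  proof eventually_elim
    case (elim s)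
    have "dist Q (p + s *\<^sub>R e) \<le> dist Q p + norm (s *\<^sub>R e)"
      by (metis add_diff_cancel_left' dist_norm dist_triangle norm_minus_commute)
    also have "\<dots> < r" using elim te by simp
    finally have "p + s *\<^sub>R e \<in> S" using p elim by (auto simp: S_def cS_def inner_add_left ee)
    then show ?case using closure_subset by blast
  qed
  show "p \<in> closure S" by (rule Lim_in_closed_set[OF closed_closure ev _ lim]) simp
qed

text \<open>One flow on the upper side of a Lipschitz graph inside a ball, with \<open>t\<close> and
  \<open>e\<close> the axes of the rotated frame. The lower side is an instance with
  \<open>- e\<close> and \<open>- f\<close>, so both sides of the curve share all results.\<close>

locale flow_side =
  fixes \<gamma> K :: real and \<Omega> X :: "plane set" and \<phi> :: "plane \<Rightarrow> real"
    and t e Q :: plane and r \<Lambda> :: real and f :: "real \<Rightarrow> real" and S cS :: "plane set"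
  assumes S_def: "S = {p. f (p \<bullet> t) < p \<bullet> e} \<inter> ball Q r" and cS_def: "cS = {p. f (p \<bullet> t) \<le> p \<bullet> e} \<inter> ball Q r"
    and \<gamma>: "\<gamma> > 1" and C2: "C2_upto \<Omega> X \<phi>" and flow: "potential_flow \<gamma> K \<Omega> \<phi>"
    and te: "norm t = 1" "norm e = 1" "t \<bullet> e = 0"
    and \<Lambda>: "\<Lambda> \<ge> 0" "\<And>p q. p \<in> ball Q r \<Longrightarrow> q \<in> ball Q r \<Longrightarrow> \<bar>f (p \<bullet> t) - f (q \<bullet> t)\<bar> \<le> \<Lambda> * \<bar>p \<bullet> t - q \<bullet> t\<bar>"
    and S_sub: "S \<subseteq> \<Omega>" and cS_sub: "cS \<subseteq> X"
    and pos: "\<And>p. p \<in> S \<Longrightarrow> bernoulli K \<Omega> \<phi> p > 0"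
begin

text \<open>Boundary values from within \<Omega>, so that these functions are meaningful on the
  curve and agree with the partial derivatives inside.\<close>

definition "U = value_from \<Omega> (pd1 \<phi>)"
definition "V = value_from \<Omega> (pd2 \<phi>)"
definition "a = value_from \<Omega> (pd1 (pd1 \<phi>))"
definition "b = value_from \<Omega> (pd2 (pd1 \<phi>))"
definition "b' = value_from \<Omega> (pd1 (pd2 \<phi>))"
definition "d = value_from \<Omega> (pd2 (pd2 \<phi>))"

lemma open_\<Omega>: "open \<Omega>" and diff: "\<phi> differentiable_on \<Omega>" "pd1 \<phi> differentiable_on \<Omega>" "pd2 \<phi> differentiable_on \<Omega>"
  using C2 unfolding C2_upto_def by blast+

lemma S_cS: "S \<subseteq> cS" by (auto simp: S_def cS_def)

lemma cont:
  "continuous_on cS \<phi>" "continuous_on cS U" "continuous_on cS V" "continuous_on cS a"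
  "continuous_on cS b" "continuous_on cS b'" "continuous_on cS d"
proof -
  have *: "continuous_on X \<phi>" "\<And>g. g \<in> {pd1 \<phi>, pd2 \<phi>, pd1 (pd1 \<phi>), pd2 (pd1 \<phi>), pd1 (pd2 \<phi>), pd2 (pd2 \<phi>)}
      \<Longrightarrow> continuous_on X (value_from \<Omega> g)"
    using C2 unfolding C2_upto_def by blast+
  show "continuous_on cS \<phi>" "continuous_on cS U" "continuous_on cS V" "continuous_on cS a"
    "continuous_on cS b" "continuous_on cS b'" "continuous_on cS d"
    unfolding U_def V_def a_def b_def b'_def d_def
    by (rule continuous_on_subset[OF _ cS_sub], rule *, simp?)+
qed

lemma der_\<Omega>:
  assumes "p \<in> \<Omega>"
  shows "(\<phi> has_derivative (lin (U p) (V p))) (at p)"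
    "(U has_derivative (lin (a p) (b p))) (at p)"
    "(V has_derivative (lin (b' p) (d p))) (at p)"
proof -
  have diffp: "\<phi> differentiable (at p)" "pd1 \<phi> differentiable (at p)" "pd2 \<phi> differentiable (at p)"
    using diff assms open_\<Omega> by (simp_all add: differentiable_on_eq_differentiable_at)
  then show "(\<phi> has_derivative (lin (U p) (V p))) (at p)"
    "(U has_derivative (lin (a p) (b p))) (at p)"
    "(V has_derivative (lin (b' p) (d p))) (at p)"
    unfolding U_def V_def a_def b_def b'_def d_def value_from_in[OF assms]
    by (auto intro!: has_derivative_value_from has_derivative_pd(1) open_\<Omega> assms)
qed

lemma cS_closure: "cS \<subseteq> closure S"
  unfolding S_def cS_def by (rule closed_epigraph_subset_closure[OF te])

text \<open>Carries identities from the open side to the curve by density: the symmetry of the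
  second derivatives and the equation itself.\<close>

lemma zero_on_cS:
  assumes "continuous_on cS g" "\<And>p. p \<in> S \<Longrightarrow> g p = (0::real)" "p \<in> cS"
  shows "g p = 0"
proof (cases "p \<in> S")
  case False
  then obtain x where x: "\<And>n. x n \<in> S" "x \<longlonglongrightarrow> p"
    using cS_closure assms(3) closure_sequential by blast
  have "(\<lambda>n. g (x n)) \<longlonglongrightarrow> g p"
    by (rule continuous_on_tendsto_compose[OF assms(1) x(2) assms(3)]) (use x(1) S_cS in \<open>auto intro!: always_eventually\<close>)
  moreover have "(\<lambda>n. g (x n)) = (\<lambda>n. 0)" using assms(2) x(1) by auto
  ultimately show ?thesis using LIMSEQ_unique[OF _ tendsto_const[of 0]] by simp
qed (use assms in auto)

lemma open_S: "open S"
proof (subst open_subopen, intro ballI)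
  fix p assume p: "p \<in> S"
  define \<delta> where "\<delta> = min ((p \<bullet> e - f (p \<bullet> t)) / (\<Lambda> + 1)) (r - dist Q p)"
  have \<delta>: "\<delta> > 0" using p \<Lambda> by (auto simp: \<delta>_def S_def)
  have "q \<in> S" if q: "q \<in> ball p \<delta>" for q
  proof -
    have n: "norm (q - p) < \<delta>" using q by (simp add: dist_norm norm_minus_commute)
    have "dist Q q \<le> dist Q p + norm (q - p)" by (metis dist_commute dist_norm dist_triangle)
    then have qQ: "q \<in> ball Q r" using n by (auto simp: \<delta>_def)
    have 1: "\<bar>q \<bullet> t - p \<bullet> t\<bar> \<le> norm (q - p)" "\<bar>q \<bullet> e - p \<bullet> e\<bar> \<le> norm (q - p)"
      using Cauchy_Schwarz_ineq2[of "q - p" t] Cauchy_Schwarz_ineq2[of "q - p" e] te by (auto simp: inner_diff_left)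
    have "\<bar>f (q \<bullet> t) - f (p \<bullet> t)\<bar> \<le> \<Lambda> * norm (q - p)"
      using \<Lambda>(2)[OF qQ, of p] p mult_left_mono[OF 1(1) \<Lambda>(1)] by (auto simp: S_def)
    moreover have "(\<Lambda> + 1) * norm (q - p) < p \<bullet> e - f (p \<bullet> t)"
      using n \<Lambda>(1) by (auto simp: \<delta>_def pos_less_divide_eq mult.commute)
    ultimately have "f (q \<bullet> t) < q \<bullet> e" using 1(2) by (simp add: algebra_simps abs_le_iff)
    then show ?thesis using qQ by (simp add: S_def)
  qed
  then show "\<exists>T. open T \<and> p \<in> T \<and> T \<subseteq> S" using \<delta> by (intro exI[of _ "ball p \<delta>"]) auto
qed

lemma b'_eq: "p \<in> cS \<Longrightarrow> b' p = b p"
proof -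
  have eq: "b q = b' q" if "q \<in> S" for q
  proof (rule mixed_partials_commute[OF open_S that der_\<Omega>])
    show "isCont b q" "isCont b' q"
      using cont(5,6) that open_S S_cS continuous_on_subset continuous_on_eq_continuous_at by blast+
  qed (use S_sub in auto)
  assume "p \<in> cS"
  then have "b' p - b p = 0" by (rule zero_on_cS[rotated 2]) (auto intro!: continuous_intros cont simp: eq)
  then show ?thesis by simp
qed

lemma der_cS:
  assumes "p \<in> cS"
  shows "(\<phi> has_derivative (lin (U p) (V p))) (at p within cS)"
    "(U has_derivative (lin (a p) (b p))) (at p within cS)"
    "(V has_derivative (lin (b p) (d p))) (at p within cS)"
proof -
  note L = has_derivative_upto_Lipschitz_graph[where t=t and e=e and f=f and Q=Q and r=r and \<Lambda>=\<Lambda>, OF te \<Lambda>, folded S_def cS_def]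
  show "(\<phi> has_derivative (lin (U p) (V p))) (at p within cS)"
    by (rule L[where F=\<phi> and A=U and B=V]) (use S_sub assms in \<open>auto intro: cont der_\<Omega>\<close>)
  show "(U has_derivative (lin (a p) (b p))) (at p within cS)"
    by (rule L[where F=U and A=a and B=b]) (use S_sub assms in \<open>auto intro: cont der_\<Omega>\<close>)
  have "(V has_derivative (lin (b' p) (d p))) (at p within cS)"
    by (rule L[where F=V and A=b' and B=d]) (use S_sub assms in \<open>auto intro: cont der_\<Omega>\<close>)
  then show "(V has_derivative (lin (b p) (d p))) (at p within cS)"
    using b'_eq[OF assms] by simp
qed

definition "C p = (\<gamma> - 1) * (K - \<phi> p - ((U p)^2 + (V p)^2) / 2)"

lemma C_bernoulli: "C p = (\<gamma> - 1) * bernoulli K \<Omega> \<phi> p"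
  unfolding C_def bernoulli_eq U_def V_def by (rule refl)

lemma pde:
  assumes "p \<in> cS"
  shows "(C p - (U p)^2) * (1 + a p) - 2 * U p * V p * b p + (C p - (V p)^2) * (1 + d p) = 0"
proof (rule zero_on_cS[OF _ _ assms])
  show "continuous_on cS (\<lambda>p. (C p - (U p)^2) * (1 + a p) - 2 * U p * V p * b p + (C p - (V p)^2) * (1 + d p))"
    unfolding C_def[abs_def] by (intro continuous_intros cont) auto
  fix q assume q: "q \<in> S"
  then have q\<Omega>: "q \<in> \<Omega>" "q \<in> cS" using S_sub S_cS by auto
  have "C q * (2 + a q + d q) = (U q)^2 * (1 + a q) + U q * V q * (b q + b' q) + (V q)^2 * (1 + d q)"
    using potential_flow_nondivergence(1)[OF \<gamma> flow open_\<Omega> q\<Omega>(1) diff pos[OF q]]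
    unfolding C_bernoulli U_def V_def a_def b_def b'_def d_def by (simp add: value_from_in[OF q\<Omega>(1)])
  then show "(C q - (U q)^2) * (1 + a q) - 2 * U q * V q * b q + (C q - (V q)^2) * (1 + d q) = 0"
    unfolding b'_eq[OF q\<Omega>(2)] by (simp add: algebra_simps)
qed

text \<open>\<open>perp_deriv_c\<close> involves one-sided limits of the partial derivatives of the
  sonic speed. Inside, these are the explicit functions \<open>G1\<close> and \<open>G2\<close>,
  which are continuous up to \<open>Q\<close> because \<open>C Q > 0\<close>, so the limits are
  their values at \<open>Q\<close>.\<close>

lemma perp_deriv:
  assumes Q: "Q \<in> cS" "Q \<notin> \<Omega>" "\<Omega> \<inter> ball Q r \<subseteq> S" and CQ: "C Q > 0"
  shows "perp_deriv_c \<gamma> K \<Omega> \<phi> Q = - (\<gamma> - 1) / (2 * sqrt (C Q)) *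
     (V Q * (U Q + U Q * a Q + V Q * b Q) - U Q * (V Q + U Q * b Q + V Q * d Q))"
proof -
  let ?s = "sonic_speed \<gamma> K \<Omega> \<phi>"
  define G1 where "G1 p = - (\<gamma> - 1) * (U p + U p * a p + V p * b p) / (2 * sqrt (C p))" for p
  define G2 where "G2 p = - (\<gamma> - 1) * (V p + U p * b p + V p * d p) / (2 * sqrt (C p))" for p
  have s_eq: "?s = (\<lambda>p. sqrt (C p))" by (simp add: sonic_speed_def[abs_def] C_bernoulli)
  have pds: "pd1 ?s p = G1 p" "pd2 ?s p = G2 p" if "p \<in> S" for p
  proof -
    have p: "p \<in> \<Omega>" "p \<in> cS" using that S_sub S_cS by auto
    have Cp: "C p > 0" using pos[OF that] \<gamma> by (simp add: C_bernoulli)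
    have dB: "(bernoulli K \<Omega> \<phi> has_derivative (lin (- (U p + U p * a p + V p * b p)) (- (V p + U p * b p + V p * d p)))) (at p)"
      using potential_flow_nondivergence(2)[OF \<gamma> flow open_\<Omega> p(1) diff pos[OF that]] b'_eq[OF p(2)]
      unfolding U_def V_def a_def b_def b'_def d_def by (simp add: value_from_in[OF p(1)])
    have "(C has_derivative (\<lambda>h. (\<gamma> - 1) * (- (U p + U p * a p + V p * b p) * fst h + - (V p + U p * b p + V p * d p) * snd h))) (at p)"
      unfolding C_bernoulli[abs_def] by (rule has_derivative_mult_right[OF dB])
    from has_derivative_real_sqrt[OF Cp this]
    have "(?s has_derivative (lin (G1 p) (G2 p))) (at p)"
      unfolding s_eq
    proof (rule has_derivative_eq_rhs, intro ext)
      have *: "(\<gamma> - 1) * (- A * x + - B * y) * (w / 2) = - (\<gamma> - 1) * A * (w / 2) * x + - (\<gamma> - 1) * B * (w / 2) * y"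
        for A B x y w :: real
        by (simp add: algebra_simps add_divide_distrib diff_divide_distrib)
      have **: "- (\<gamma> - 1) * A / (2 * sqrt (C p)) = - (\<gamma> - 1) * A * (inverse (sqrt (C p)) / 2)" for A
        by (simp add: inverse_eq_divide)
      show "(\<gamma> - 1) * (- (U p + U p * a p + V p * b p) * fst h + - (V p + U p * b p + V p * d p) * snd h) * (inverse (sqrt (C p)) / 2)
         = G1 p * fst h + G2 p * snd h" for h
        unfolding G1_def G2_def ** by (rule *)
    qed
    then show "pd1 ?s p = G1 p" "pd2 ?s p = G2 p" by (auto dest: pd_eqI)
  qed
  have r: "r > 0" using Q(1) by (auto simp: cS_def intro: le_less_trans[OF zero_le_dist])
  have "Q \<in> closure S" using Q cS_closure by blast
  \<comment> \<open>\<open>Lim\<close> identifies a limit only along a nontrivial filter, that is,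
    if \<open>Q\<close> is an accumulation point of \<Omega>.\<close>
  then have nb: "at Q within \<Omega> \<noteq> bot"
    using Q(2) closure_mono[OF S_sub] by (auto simp: at_within_eq_bot_iff)
  have contC: "continuous_on cS C" unfolding C_def[abs_def] by (intro continuous_intros cont) auto
  have lim: "(F \<longlongrightarrow> G Q) (at Q within \<Omega>)"
    if G: "continuous (at Q within cS) G" and eq: "\<And>p. p \<in> S \<Longrightarrow> F p = G p" for F G :: "plane \<Rightarrow> real"
  proof (rule Lim_transform_eventually)
    have ev: "\<forall>\<^sub>F p in at Q within \<Omega>. p \<in> S"
      unfolding eventually_at using r Q(3) by (intro exI[of _ r]) (auto simp: dist_commute)
    show "\<forall>\<^sub>F p in at Q within \<Omega>. G p = F p" using ev by eventually_elim (simp add: eq)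
    have "(G \<longlongrightarrow> G Q) (at Q within S)"
      using G S_cS by (auto simp: continuous_within intro: tendsto_within_subset)
    moreover have "at Q within \<Omega> = at Q within S"
      by (rule at_within_nhd[of _ "ball Q r"]) (use r Q(3) S_sub in \<open>auto simp: S_def\<close>)
    ultimately show "(G \<longlongrightarrow> G Q) (at Q within \<Omega>)" by simp
  qed
  have cw: "continuous (at Q within cS) g" if "continuous_on cS g" for g :: "plane \<Rightarrow> real"
    using that Q(1) by (simp add: continuous_on_eq_continuous_within)
  have sq: "sqrt (C Q) \<noteq> 0" using CQ by simp
  have cwC: "continuous (at Q within cS) (\<lambda>p. sqrt (C p))" using cw[OF contC] by (rule continuous_real_sqrt)
  have "continuous (at Q within cS) G1" "continuous (at Q within cS) G2"
    unfolding G1_def[abs_def] G2_def[abs_def]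
    by (rule continuous_at_within_divide, (intro continuous_intros cw cont cwC)+, (use sq in simp))+
  then have "value_from \<Omega> (pd1 ?s) Q = G1 Q" "value_from \<Omega> (pd2 ?s) Q = G2 Q"
    using Q(2) by (auto simp: value_from_def intro!: tendsto_Lim[OF nb] lim pds)
  then show ?thesis
    by (simp add: perp_deriv_c_def grad_from_def U_def[symmetric] V_def[symmetric] Let_def G1_def G2_def)
       (simp add: algebra_simps add_divide_distrib diff_divide_distrib)
qed

end

section \<open>The Hessian at a non-exceptional sonic point\<close>

text \<open>The gradient is differentiable at the single point \<open>Q\<close> only. The remainder
  is therefore bounded by the mean value theorem along the segment to \<open>Q + h\<close>, applied
  after the quadratic polynomial has been subtracted.\<close>

lemma second_order_Taylor:
  fixes g GU GV :: "plane \<Rightarrow> real"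
  assumes r: "r > 0" and g: "\<And>p. p \<in> ball Q r \<Longrightarrow> (g has_derivative (lin (GU p) (GV p))) (at p)"
    and GU: "(GU has_derivative (lin a b)) (at Q)"
    and GV: "(GV has_derivative (lin b d)) (at Q)" and \<epsilon>: "\<epsilon> > 0"
  obtains \<delta> where "\<delta> > 0" "\<And>h. norm h < \<delta> \<Longrightarrow>
    \<bar>g (Q + h) - g Q - (GU Q * fst h + GV Q * snd h)
      - (a * (fst h)^2 + 2 * b * fst h * snd h + d * (snd h)^2) / 2\<bar> \<le> \<epsilon> * (norm h)^2"
proof -
  have e2: "\<epsilon> / 2 > 0" using \<epsilon> by simp
  obtain d1 where d1: "d1 > 0" "\<And>y. norm (y - Q) < d1 \<Longrightarrow>
      norm (GU y - GU Q - (a * fst (y - Q) + b * snd (y - Q))) \<le> \<epsilon> / 2 * norm (y - Q)"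
    using GU e2 unfolding has_derivative_at_alt by metis
  obtain d2 where d2: "d2 > 0" "\<And>y. norm (y - Q) < d2 \<Longrightarrow>
      norm (GV y - GV Q - (b * fst (y - Q) + d * snd (y - Q))) \<le> \<epsilon> / 2 * norm (y - Q)"
    using GV e2 unfolding has_derivative_at_alt by metis
  define \<delta> where "\<delta> = min r (min d1 d2)"
  show thesis
  proof (rule that[of \<delta>])
    show "\<delta> > 0" using r d1 d2 by (simp add: \<delta>_def)
    fix h :: plane assume h: "norm h < \<delta>"
    define k where "k s = g (Q + s *\<^sub>R h) - s * (GU Q * fst h + GV Q * snd h)
      - s^2 * ((a * (fst h)^2 + 2 * b * fst h * snd h + d * (snd h)^2) / 2)" for s
    define X where "X s = GU (Q + s *\<^sub>R h) - GU Q - (a * fst (s *\<^sub>R h) + b * snd (s *\<^sub>R h))" for s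
    define Y where "Y s = GV (Q + s *\<^sub>R h) - GV Q - (b * fst (s *\<^sub>R h) + d * snd (s *\<^sub>R h))" for s
    have sh: "norm (s *\<^sub>R h) \<le> norm h" if "0 \<le> s" "s \<le> 1" for s
      using that mult_right_mono[of s 1 "norm h"] by simp
    have dk: "(k has_real_derivative (X s * fst h + Y s * snd h)) (at s)" if s: "0 \<le> s" "s \<le> 1" for s
    proof -
      have "Q + s *\<^sub>R h \<in> ball Q r" using sh[OF s] h by (simp add: \<delta>_def dist_norm)
      note dg = has_real_derivative_along_line[OF g[OF this]]
      show ?thesis unfolding k_def
        by (rule derivative_eq_intros dg | rule refl)+
           (simp add: X_def Y_def algebra_simps power2_eq_square)
    qed
    obtain z where z: "0 < z" "z < 1" "k 1 - k 0 = (1 - 0) * (X z * fst h + Y z * snd h)"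
      using MVT2[OF zero_less_one dk] by blast
    have XY: "\<bar>X z\<bar> \<le> \<epsilon> / 2 * norm h" "\<bar>Y z\<bar> \<le> \<epsilon> / 2 * norm h"
    proof -
      have n: "norm (Q + z *\<^sub>R h - Q) < d1" "norm (Q + z *\<^sub>R h - Q) < d2" "norm (z *\<^sub>R h) \<le> norm h"
        using sh[of z] z h by (auto simp: \<delta>_def)
      have "\<epsilon> / 2 * norm (z *\<^sub>R h) \<le> \<epsilon> / 2 * norm h" using n(3) e2 by (intro mult_left_mono) auto
      then show "\<bar>X z\<bar> \<le> \<epsilon> / 2 * norm h" "\<bar>Y z\<bar> \<le> \<epsilon> / 2 * norm h"
        using d1(2)[OF n(1)] d2(2)[OF n(2)] by (simp_all add: X_def Y_def)
    qed
    have "\<bar>X z * fst h + Y z * snd h\<bar> \<le> (\<bar>X z\<bar> + \<bar>Y z\<bar>) * norm h" by (rule abs_inner_pair_le)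
    also have "\<dots> \<le> (\<epsilon> * norm h) * norm h" using XY by (intro mult_right_mono) auto
    finally have "\<bar>k 1 - k 0\<bar> \<le> \<epsilon> * (norm h)^2" using z(3) by (simp add: power2_eq_square)
    then show "\<bar>g (Q + h) - g Q - (GU Q * fst h + GV Q * snd h)
      - (a * (fst h)^2 + 2 * b * fst h * snd h + d * (snd h)^2) / 2\<bar> \<le> \<epsilon> * (norm h)^2"
      by (simp add: k_def algebra_simps)
  qed
qed

text \<open>The numbers \<open>x\<close>, \<open>y\<close>, \<open>z\<close> are the entries of the
  jump of the Hessian. It annihilates the tangent \<open>(t1, t2)\<close>, hence is a multiple of
  the square of the normal; the third equation makes its quadratic form vanish on the vector
  orthogonal to \<open>(U, V)\<close>, whose product with the normal is, up to sign, the nonzero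
  number \<open>U * t1 + V * t2\<close>.\<close>

lemma symmetric_rank_one_eq:
  fixes x y z t1 t2 U V :: real
  assumes "x * t1 + y * t2 = 0" "y * t1 + z * t2 = 0" "V^2 * x - 2 * U * V * y + U^2 * z = 0" "U * t1 + V * t2 \<noteq> 0"
  shows "x = 0 \<and> y = 0 \<and> z = 0"
proof -
  define T where "T = t1^2 + t2^2"
  have T: "T \<noteq> 0" using assms(4) by (auto simp: T_def sum_power2_eq_zero_iff)
  \<comment> \<open>The trace is the only possibly nonzero eigenvalue, and the eigenvector
    \<open>(t2, - t1)\<close> has squared length \<open>T\<close>.\<close>
  define l where "l = (x + z) / T"
  have "T * x = (x + z) * t2^2" "T * y = - (x + z) * (t1 * t2)" "T * z = (x + z) * t1^2"
    using assms(1,2) unfolding T_def by algebra+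
  then have xyz: "x = l * t2^2" "y = - l * (t1 * t2)" "z = l * t1^2"
    using T by (auto simp: l_def field_simps)
  have "l * (U * t1 + V * t2)^2 = 0" using assms(3) unfolding xyz by algebra
  then have "l = 0" using assms(4) by simp
  then show ?thesis using xyz by simp
qed

text \<open>Once \<open>perp\<close> and \<open>pde\<close> have reduced the matrix to a multiple of
  the projection onto \<open>(U, V)\<close>, only its trace is unknown. \<open>tang\<close> is a
  single equation along the curve and determines the trace because the factor
  \<open>U * t1 + V * t2\<close> is nonzero; non-exceptionality enters here.\<close>

lemma sonic_Hessian:
  fixes al be de U V Cq t1 t2 g :: real
  assumes g: "g > 1" and Cq: "Cq = U^2 + V^2" "Cq > 0"
    and pde: "(Cq - U^2) * al - 2 * U * V * be + (Cq - V^2) * de = 0"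
    and perp: "V * (U * al + V * be) - U * (U * be + V * de) = 0"
    and tang: "(g + 1) * ((U * al + V * be) * t1 + (U * be + V * de) * t2) = 2 * (U * t1 + V * t2)"
    and ne: "U * t1 + V * t2 \<noteq> 0"
  shows "al = 2 / (g + 1) * U^2 / Cq" "be = 2 / (g + 1) * (U * V) / Cq" "de = 2 / (g + 1) * V^2 / Cq"
proof -
  have p: "V^2 * al - 2 * U * V * be + U^2 * de = 0" using pde unfolding Cq by algebra
  have "Cq * (U * be - V * al) = 0" "Cq * (U * de - V * be) = 0"
    using p perp unfolding Cq by algebra+
  \<comment> \<open>In other words, the matrix annihilates \<open>(- V, U)\<close>.\<close>
  then have k: "U * be = V * al" "U * de = V * be" using Cq(2) by auto
  have MW: "U * al + V * be = (al + de) * U" "U * be + V * de = (al + de) * V"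
    using k by (simp_all add: algebra_simps)
  have "(g + 1) * (al + de) * (U * t1 + V * t2) = 2 * (U * t1 + V * t2)"
    using tang unfolding MW by (simp add: algebra_simps)
  then have "(g + 1) * (al + de) = 2" using ne mult_cancel_right[of _ "U * t1 + V * t2" 2] by blast
  then have m: "al + de = 2 / (g + 1)" using g by (simp add: field_simps)
  have "Cq * al = (al + de) * U^2" "Cq * be = (al + de) * (U * V)" "Cq * de = (al + de) * V^2"
    using k unfolding Cq by algebra+
  note * = this[unfolded m]
  have "y = x / Cq" if "Cq * y = x" for x y using that Cq(2) by auto
  from this[OF *(1)] this[OF *(2)] this[OF *(3)]
  show "al = 2 / (g + 1) * U^2 / Cq" "be = 2 / (g + 1) * (U * V) / Cq" "de = 2 / (g + 1) * V^2 / Cq" .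
qed

text \<open>The sign \<open>k\<close> records the orientation of the frame, which is not fixed
  because \<open>e\<close> may be replaced by its negative.\<close>

lemma orthonormal_plane:
  fixes t e :: plane
  assumes "norm t = 1" "norm e = 1" "t \<bullet> e = 0"
  obtains k t1 t2 where "t = (t1, t2)" "e = (- k * t2, k * t1)" "k * k = 1" "t1 * t1 + t2 * t2 = 1"
proof -
  obtain t1 t2 where t: "t = (t1, t2)" by (cases t)
  obtain e1 e2 where e: "e = (e1, e2)" by (cases e)
  have "t \<bullet> t = 1" "e \<bullet> e = 1" using assms by (simp_all add: dot_square_norm)
  then have *: "t1 * t1 + t2 * t2 = 1" "e1 * e1 + e2 * e2 = 1" and o: "t1 * e1 = - (t2 * e2)"
    using assms(3) by (auto simp: t e inner_Pair)
  define k where "k = e2 * t1 - e1 * t2"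
  have "e1 = e1 * (t1 * t1 + t2 * t2)" using * by simp
  also have "\<dots> = t1 * (t1 * e1) + e1 * t2 * t2" by (simp add: algebra_simps)
  also have "\<dots> = - k * t2" unfolding o k_def by (simp add: algebra_simps)
  finally have e1: "e1 = - k * t2" .
  have "e2 = e2 * (t1 * t1 + t2 * t2)" using * by simp
  also have "\<dots> = e2 * t1 * t1 + t2 * (t2 * e2)" by (simp add: algebra_simps)
  also have "t2 * e2 = - (t1 * e1)" using o by simp
  also have "e2 * t1 * t1 + t2 * - (t1 * e1) = k * t1" unfolding k_def by (simp add: algebra_simps)
  finally have e2: "e2 = k * t1" .
  have "k * k * (t1 * t1 + t2 * t2) = 1" using *(2) unfolding e1 e2 by (simp add: algebra_simps)
  then have "k * k = 1" using *(1) by simp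
  with * t e e1 e2 show thesis by (intro that) auto
qed

lemma orthonormal_expansion:
  fixes t e x :: plane
  assumes "norm t = 1" "norm e = 1" "t \<bullet> e = 0"
  shows "x = (x \<bullet> t) *\<^sub>R t + (x \<bullet> e) *\<^sub>R e"
proof -
  obtain k t1 t2 where k: "t = (t1, t2)" "e = (- k * t2, k * t1)" "k * k = 1" "t1 * t1 + t2 * t2 = 1"
    using orthonormal_plane[OF assms] by blast
  obtain x1 x2 where x: "x = (x1, x2)" by (cases x)
  have "(x1 * t1 + x2 * t2) * t1 + (x1 * (- k * t2) + x2 * (k * t1)) * (- k * t2)
      = x1 * (t1 * t1 + k * k * (t2 * t2)) + x2 * (t1 * t2 - k * k * (t1 * t2))" by (simp add: algebra_simps)
  moreover have "(x1 * t1 + x2 * t2) * t2 + (x1 * (- k * t2) + x2 * (k * t1)) * (k * t1)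
      = x1 * (t1 * t2 - k * k * (t1 * t2)) + x2 * (t2 * t2 + k * k * (t1 * t1))" by (simp add: algebra_simps)
  ultimately show ?thesis using k(3,4) by (simp add: x k(1,2) inner_Pair add.commute)
qed

text \<open>Here \<open>e\<close> points towards the subsonic side. The estimate with
  \<open>L\<close> is the form in which C^{1,1} regularity is used at \<open>Q\<close> itself: it
  yields the tangent and guarantees that the subsonic side contains a region above a parabola, as
  the barrier argument requires.\<close>

locale sonic_point =
  m: flow_side \<gamma> K \<Omega>m "closure \<Omega>m" \<phi>m t "- e" Q r \<Lambda> "\<lambda>x. - f x" Sm cSm +
  p: flow_side \<gamma> K \<Omega>p "\<Omega>p \<union> \<Gamma>" \<phi>p t e Q r \<Lambda> f Sp cSp
  for \<gamma> K :: real and \<Omega>m \<Omega>p \<Gamma> :: "plane set" and \<phi>m \<phi>p :: "plane \<Rightarrow> real"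
    and t e Q :: plane and r \<Lambda> :: real and f :: "real \<Rightarrow> real" and Sm cSm Sp cSp :: "plane set" +
  fixes f' L :: real
  assumes r: "r > 0" and Q\<Gamma>: "Q \<in> \<Gamma>"
    and \<Gamma>: "\<Gamma> \<inter> ball Q r = {x. f (x \<bullet> t) = x \<bullet> e} \<inter> ball Q r"
    and disj: "\<Omega>m \<inter> \<Omega>p = {}" "\<Gamma> \<inter> \<Omega>m = {}" "\<Gamma> \<inter> \<Omega>p = {}"
    and match: "\<And>x. x \<in> \<Gamma> \<Longrightarrow> \<phi>p x = \<phi>m x" "\<And>x. x \<in> \<Gamma> \<Longrightarrow> p.U x = m.U x" "\<And>x. x \<in> \<Gamma> \<Longrightarrow> p.V x = m.V x"
    and sonic: "\<And>x. x \<in> \<Gamma> \<Longrightarrow> (m.U x)^2 + (m.V x)^2 = m.C x"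
    and subsonic: "\<And>x. x \<in> Sp \<Longrightarrow> (p.U x)^2 + (p.V x)^2 < p.C x"
    and f': "L \<ge> 0" "\<And>x. \<bar>x - Q \<bullet> t\<bar> < r \<Longrightarrow> \<bar>f x - f (Q \<bullet> t) - f' * (x - Q \<bullet> t)\<bar> \<le> L * (x - Q \<bullet> t)^2"
    and nonexceptional: "(m.U Q, m.V Q) \<bullet> (t + f' *\<^sub>R e) \<noteq> 0"
    and perp: "perp_deriv_c \<gamma> K \<Omega>m \<phi>m Q = 0 \<or> perp_deriv_c \<gamma> K \<Omega>p \<phi>p Q = 0"
begin

lemma te: "norm t = 1" "norm e = 1" "t \<bullet> e = 0" "e \<bullet> t = 0" "t \<bullet> t = 1" "e \<bullet> e = 1"
  using p.te inner_commute[of e t] by (simp_all add: dot_square_norm)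

lemma mem_iff:
  "x \<in> Sm \<longleftrightarrow> x \<in> ball Q r \<and> x \<bullet> e < f (x \<bullet> t)" "x \<in> cSm \<longleftrightarrow> x \<in> ball Q r \<and> x \<bullet> e \<le> f (x \<bullet> t)"
  "x \<in> Sp \<longleftrightarrow> x \<in> ball Q r \<and> f (x \<bullet> t) < x \<bullet> e" "x \<in> cSp \<longleftrightarrow> x \<in> ball Q r \<and> f (x \<bullet> t) \<le> x \<bullet> e"
  unfolding m.S_def m.cS_def p.S_def p.cS_def by auto

lemma \<Gamma>_iff: "x \<in> ball Q r \<Longrightarrow> x \<in> \<Gamma> \<longleftrightarrow> f (x \<bullet> t) = x \<bullet> e"
  using \<Gamma> by blast

lemma cover: "x \<in> ball Q r \<Longrightarrow> x \<in> Sm \<or> x \<in> Sp \<or> x \<in> \<Gamma>" "x \<in> ball Q r \<Longrightarrow> x \<in> \<Gamma> \<Longrightarrow> x \<in> cSm \<and> x \<in> cSp"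
  "ball Q r \<subseteq> cSm \<union> cSp"
  "x \<in> cSm \<Longrightarrow> x \<in> Sm \<or> x \<in> \<Gamma>" "x \<in> cSp \<Longrightarrow> x \<in> Sp \<or> x \<in> \<Gamma>"
  unfolding mem_iff subset_iff Un_iff using \<Gamma>_iff by fastforce+

lemma \<Omega>_ball: "\<Omega>m \<inter> ball Q r \<subseteq> Sm" "\<Omega>p \<inter> ball Q r \<subseteq> Sp"
  using cover(1) disj m.S_sub p.S_sub by blast+

lemma Q_in: "Q \<in> ball Q r" "Q \<in> cSm" "Q \<in> cSp" "f (Q \<bullet> t) = Q \<bullet> e"
proof -
  show "Q \<in> ball Q r" using r by simp
  then show "Q \<in> cSm" "Q \<in> cSp" using cover(2) Q\<Gamma> by auto
  show "f (Q \<bullet> t) = Q \<bullet> e" using \<Gamma>_iff[of Q] Q\<Gamma> r by simp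
qed

definition T :: plane where "T = t + f' *\<^sub>R e"

definition curve :: "real \<Rightarrow> plane" where "curve x = x *\<^sub>R t + f x *\<^sub>R e"

lemma f_deriv: "(f has_real_derivative f') (at (Q \<bullet> t))"
  unfolding has_field_derivative_def has_derivative_at_alt
proof (intro conjI allI impI)
  fix \<epsilon> :: real assume "\<epsilon> > 0"
  show "\<exists>d>0. \<forall>y. norm (y - Q \<bullet> t) < d \<longrightarrow> norm (f y - f (Q \<bullet> t) - f' * (y - Q \<bullet> t)) \<le> \<epsilon> * norm (y - Q \<bullet> t)"
  proof (intro exI[of _ "min r (\<epsilon> / (L + 1))"] conjI allI impI)
    show "min r (\<epsilon> / (L + 1)) > 0" using r f'(1) \<open>\<epsilon> > 0\<close> by simp
    fix y assume y: "norm (y - Q \<bullet> t) < min r (\<epsilon> / (L + 1))"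
    have "\<bar>y - Q \<bullet> t\<bar> * (L + 1) \<le> \<epsilon>" using y f'(1) by (simp add: pos_less_divide_eq)
    then have "L * \<bar>y - Q \<bullet> t\<bar> \<le> \<epsilon>" by (simp add: algebra_simps)
    then have "(L * \<bar>y - Q \<bullet> t\<bar>) * \<bar>y - Q \<bullet> t\<bar> \<le> \<epsilon> * \<bar>y - Q \<bullet> t\<bar>" by (intro mult_right_mono) auto
    moreover have "L * (y - Q \<bullet> t)^2 = (L * \<bar>y - Q \<bullet> t\<bar>) * \<bar>y - Q \<bullet> t\<bar>"
      by (simp only: mult.assoc abs_mult_self_eq power2_eq_square)
    moreover have "\<bar>f y - f (Q \<bullet> t) - f' * (y - Q \<bullet> t)\<bar> \<le> L * (y - Q \<bullet> t)^2" using f'(2)[of y] y by simp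
    ultimately show "norm (f y - f (Q \<bullet> t) - f' * (y - Q \<bullet> t)) \<le> \<epsilon> * norm (y - Q \<bullet> t)"
      unfolding real_norm_def by linarith
  qed
qed (rule bounded_linear_mult_right)

lemma curve_deriv: "(curve has_derivative (\<lambda>h. h *\<^sub>R T)) (at (Q \<bullet> t))"
  unfolding curve_def[abs_def] T_def
  by (rule has_derivative_eq_rhs)
    (rule derivative_intros f_deriv[unfolded has_field_derivative_def] | simp add: fun_eq_iff algebra_simps)+

lemma curve_Q: "curve (Q \<bullet> t) = Q"
  unfolding curve_def Q_in(4) by (rule orthonormal_expansion[symmetric, OF te(1-3)])

lemma curve_\<Gamma>: obtains I where "open I" "Q \<bullet> t \<in> I" "\<And>x. x \<in> I \<Longrightarrow> curve x \<in> \<Gamma> \<inter> ball Q r"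
proof -
  have "isCont curve (Q \<bullet> t)" using curve_deriv has_derivative_continuous by blast
  then have "(curve \<longlongrightarrow> Q) (at (Q \<bullet> t))" by (simp add: isCont_def curve_Q)
  then have "\<forall>\<^sub>F x in at (Q \<bullet> t). curve x \<in> ball Q r"
    using r by (intro topological_tendstoD) auto
  then have "\<forall>\<^sub>F x in nhds (Q \<bullet> t). curve x \<in> ball Q r"
    using Q_in(1) by (simp add: eventually_nhds_conv_at curve_Q)
  then obtain I where I: "open I" "Q \<bullet> t \<in> I" "\<And>x. x \<in> I \<Longrightarrow> curve x \<in> ball Q r"
    unfolding eventually_nhds by blast
  have "f (curve x \<bullet> t) = curve x \<bullet> e" for x by (simp add: curve_def inner_add_left te)
  then have "curve x \<in> \<Gamma> \<inter> ball Q r" if "x \<in> I" for x using I(3)[OF that] \<Gamma>_iff by simp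
  with I show thesis by (intro that) auto
qed

text \<open>The curve lies in both closed sides, so a derivative relative to either of them can be
  composed with it. For a function with equal traces the two sides give two expressions for the same
  derivative.\<close>

lemma deriv_along_curve:
  assumes F: "(F has_derivative (lin A B)) (at Q within S)"
    and S: "\<And>x. x \<in> \<Gamma> \<Longrightarrow> x \<in> ball Q r \<Longrightarrow> x \<in> S"
    and eq: "\<And>x. x \<in> \<Gamma> \<Longrightarrow> x \<in> ball Q r \<Longrightarrow> F x = G x"
  shows "((\<lambda>x. G (curve x)) has_real_derivative (A * fst T + B * snd T)) (at (Q \<bullet> t))"
proof -
  obtain I where I: "open I" "Q \<bullet> t \<in> I" "\<And>x. x \<in> I \<Longrightarrow> curve x \<in> \<Gamma> \<inter> ball Q r" using curve_\<Gamma> by metis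
  have c: "(curve has_derivative (\<lambda>h. h *\<^sub>R T)) (at (Q \<bullet> t) within I)"
    using curve_deriv by (rule has_derivative_at_withinI)
  have F': "(F has_derivative (lin A B)) (at (curve (Q \<bullet> t)) within curve ` I)"
    unfolding curve_Q by (rule has_derivative_subset[OF F]) (use S I in blast)
  have "((\<lambda>x. F (curve x)) has_derivative (\<lambda>h. A * fst (h *\<^sub>R T) + B * snd (h *\<^sub>R T))) (at (Q \<bullet> t) within I)"
    by (rule has_derivative_in_compose[OF c F'])
  then have "((\<lambda>x. F (curve x)) has_derivative (\<lambda>h. A * fst (h *\<^sub>R T) + B * snd (h *\<^sub>R T))) (at (Q \<bullet> t))"
    by (simp add: at_within_open[OF I(2,1)])
  then have "((\<lambda>x. G (curve x)) has_derivative (\<lambda>h. A * fst (h *\<^sub>R T) + B * snd (h *\<^sub>R T))) (at (Q \<bullet> t))"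
    by (rule has_derivative_transform_within_open[OF _ I(1,2)]) (use I(3) eq in blast)
  then show ?thesis unfolding has_field_derivative_def
    by (rule has_derivative_eq_rhs) (simp add: fun_eq_iff algebra_simps)
qed

lemma CQ: "m.C Q = (m.U Q)^2 + (m.V Q)^2" "m.C Q > 0" "p.C Q = m.C Q"
proof -
  show 1: "m.C Q = (m.U Q)^2 + (m.V Q)^2" using sonic[OF Q\<Gamma>] by simp
  have "(m.U Q, m.V Q) \<noteq> 0" using nonexceptional by force
  then show "m.C Q > 0" unfolding 1 by (simp add: sum_power2_gt_zero_iff zero_prod_def)
  show "p.C Q = m.C Q" unfolding p.C_def m.C_def using match Q\<Gamma> by simp
qed

text \<open>\<open>U\<close> and \<open>V\<close> have equal traces from both sides, so the two
  Hessians agree on the tangent \<open>T\<close>; the difference of the two equations supplies the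
  third relation of \<open>symmetric_rank_one_eq\<close>.\<close>

lemma Hessians_agree: "p.a Q = m.a Q" "p.b Q = m.b Q" "p.d Q = m.d Q"
proof -
  note dm = m.der_cS[OF Q_in(2)] and dp = p.der_cS[OF Q_in(3)]
  have "m.a Q * fst T + m.b Q * snd T = p.a Q * fst T + p.b Q * snd T"
    by (rule DERIV_unique[OF deriv_along_curve[OF dm(2), of p.U] deriv_along_curve[OF dp(2), of p.U]])
      (use cover(2) match in auto)
  moreover have "m.b Q * fst T + m.d Q * snd T = p.b Q * fst T + p.d Q * snd T"
    by (rule DERIV_unique[OF deriv_along_curve[OF dm(3), of p.V] deriv_along_curve[OF dp(3), of p.V]])
      (use cover(2) match in auto)
  moreover have "m.U Q * fst T + m.V Q * snd T \<noteq> 0"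
    using nonexceptional by (simp add: T_def inner_prod_def)
  moreover have "(m.V Q)^2 * (p.a Q - m.a Q) - 2 * m.U Q * m.V Q * (p.b Q - m.b Q) + (m.U Q)^2 * (p.d Q - m.d Q) = 0"
    using m.pde[OF Q_in(2)] p.pde[OF Q_in(3)] unfolding CQ(3) match[OF Q\<Gamma>] CQ(1)
    by (simp add: algebra_simps)
  ultimately have "p.a Q - m.a Q = 0 \<and> p.b Q - m.b Q = 0 \<and> p.d Q - m.d Q = 0"
    by (intro symmetric_rank_one_eq[of _ "fst T" _ "snd T"]) (auto simp: algebra_simps)
  then show "p.a Q = m.a Q" "p.b Q = m.b Q" "p.d Q = m.d Q" by auto
qed

text \<open>Since the Hessians agree, both one-sided values of \<open>perp_deriv_c\<close> are the
  same number, and it does not matter from which side it is assumed to vanish.\<close>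

lemma perp_eq: "m.V Q * (m.U Q * (1 + m.a Q) + m.V Q * m.b Q) - m.U Q * (m.U Q * m.b Q + m.V Q * (1 + m.d Q)) = 0"
proof -
  have Qn: "Q \<notin> \<Omega>m" "Q \<notin> \<Omega>p" using disj Q\<Gamma> by auto
  have 1: "perp_deriv_c \<gamma> K \<Omega>m \<phi>m Q = - (\<gamma> - 1) / (2 * sqrt (m.C Q)) *
     (m.V Q * (m.U Q + m.U Q * m.a Q + m.V Q * m.b Q) - m.U Q * (m.V Q + m.U Q * m.b Q + m.V Q * m.d Q))"
    by (rule m.perp_deriv[OF Q_in(2) Qn(1) \<Omega>_ball(1) CQ(2)])
  have 2: "perp_deriv_c \<gamma> K \<Omega>p \<phi>p Q = - (\<gamma> - 1) / (2 * sqrt (m.C Q)) *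
     (m.V Q * (m.U Q + m.U Q * m.a Q + m.V Q * m.b Q) - m.U Q * (m.V Q + m.U Q * m.b Q + m.V Q * m.d Q))"
    using p.perp_deriv[OF Q_in(3) Qn(2) \<Omega>_ball(2)] CQ(2,3) Hessians_agree match[OF Q\<Gamma>] by simp
  have "- (\<gamma> - 1) / (2 * sqrt (m.C Q)) \<noteq> 0" using m.\<gamma> CQ(2) by simp
  then have "m.V Q * (m.U Q + m.U Q * m.a Q + m.V Q * m.b Q) - m.U Q * (m.V Q + m.U Q * m.b Q + m.V Q * m.d Q) = 0"
    using perp unfolding 1 2 by (simp only: mult_eq_0_iff) blast
  then show ?thesis by (simp add: algebra_simps)
qed

text \<open>\<open>|W|^2 - c^2\<close> is zero all along the curve; its tangential derivative at
  \<open>Q\<close> is the relation \<open>tang\<close> of \<open>sonic_Hessian\<close>.\<close>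

lemma Hessian:
  "1 + m.a Q = 2 / (\<gamma> + 1) * (m.U Q)^2 / m.C Q"
  "m.b Q = 2 / (\<gamma> + 1) * (m.U Q * m.V Q) / m.C Q"
  "1 + m.d Q = 2 / (\<gamma> + 1) * (m.V Q)^2 / m.C Q"
proof -
  note dm = m.der_cS[OF Q_in(2)]
  have "((\<lambda>x. (m.U x)^2 + (m.V x)^2 - m.C x) has_derivative
     (lin (2 * m.U Q * m.a Q + 2 * m.V Q * m.b Q + (\<gamma> - 1) * (m.U Q + m.U Q * m.a Q + m.V Q * m.b Q)) (2 * m.U Q * m.b Q + 2 * m.V Q * m.d Q + (\<gamma> - 1) * (m.V Q + m.U Q * m.b Q + m.V Q * m.d Q)))) (at Q within cSm)"
    unfolding m.C_def
    by (rule derivative_eq_intros dm | rule refl | (simp; fail))+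
      (simp add: fun_eq_iff field_simps)
  then have "((\<lambda>x. 0) has_real_derivative
     ((2 * m.U Q * m.a Q + 2 * m.V Q * m.b Q + (\<gamma> - 1) * (m.U Q + m.U Q * m.a Q + m.V Q * m.b Q)) * fst T
        + (2 * m.U Q * m.b Q + 2 * m.V Q * m.d Q + (\<gamma> - 1) * (m.V Q + m.U Q * m.b Q + m.V Q * m.d Q)) * snd T)) (at (Q \<bullet> t))"
    by (rule deriv_along_curve[where G="\<lambda>x. 0"]) (use cover(2) sonic in auto)
  then have "(2 * m.U Q * m.a Q + 2 * m.V Q * m.b Q + (\<gamma> - 1) * (m.U Q + m.U Q * m.a Q + m.V Q * m.b Q)) * fst T
        + (2 * m.U Q * m.b Q + 2 * m.V Q * m.d Q + (\<gamma> - 1) * (m.V Q + m.U Q * m.b Q + m.V Q * m.d Q)) * snd T = 0"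
    by (rule DERIV_unique[OF _ DERIV_const])
  then have tang: "(\<gamma> + 1) * ((m.U Q * (1 + m.a Q) + m.V Q * m.b Q) * fst T + (m.U Q * m.b Q + m.V Q * (1 + m.d Q)) * snd T)
     = 2 * (m.U Q * fst T + m.V Q * snd T)" by (simp add: algebra_simps)
  have ne: "m.U Q * fst T + m.V Q * snd T \<noteq> 0"
    using nonexceptional by (simp add: T_def inner_prod_def)
  show "1 + m.a Q = 2 / (\<gamma> + 1) * (m.U Q)^2 / m.C Q"
    "m.b Q = 2 / (\<gamma> + 1) * (m.U Q * m.V Q) / m.C Q"
    "1 + m.d Q = 2 / (\<gamma> + 1) * (m.V Q)^2 / m.C Q"
    using sonic_Hessian[OF m.\<gamma> CQ(1,2) m.pde[OF Q_in(2)] perp_eq tang ne] by auto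
qed

section \<open>Gluing the two potentials across the sonic curve\<close>

abbreviation "g \<equiv> glue \<Omega>m \<phi>m \<phi>p"

definition "GU x = (if x \<in> \<Omega>m then m.U x else p.U x)"
definition "GV x = (if x \<in> \<Omega>m then m.V x else p.V x)"

lemma glued_eq:
  "x \<in> cSm \<Longrightarrow> g x = \<phi>m x \<and> GU x = m.U x \<and> GV x = m.V x"
  "x \<in> cSp \<Longrightarrow> g x = \<phi>p x \<and> GU x = p.U x \<and> GV x = p.V x"
proof -
  assume "x \<in> cSm"
  then consider "x \<in> \<Omega>m" | "x \<in> \<Gamma>" using cover(4) m.S_sub by blast
  then show "g x = \<phi>m x \<and> GU x = m.U x \<and> GV x = m.V x"
  proof cases
    case 2
    then have "x \<notin> \<Omega>m" using disj by blast
    then show ?thesis using match[OF 2] by (simp add: glue_def GU_def GV_def)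
  qed (simp add: glue_def GU_def GV_def)
next
  assume "x \<in> cSp"
  then have "x \<notin> \<Omega>m" using cover(5) p.S_sub disj by blast
  then show "g x = \<phi>p x \<and> GU x = p.U x \<and> GV x = p.V x" by (simp add: glue_def GU_def GV_def)
qed

text \<open>The two closed sides cover the ball, so one-sided derivatives with a common value
  combine to a full derivative.\<close>

lemma glued_derivative_\<Gamma>:
  assumes x: "x \<in> \<Gamma>" "x \<in> ball Q r"
    and F: "(Fm has_derivative F') (at x within cSm)" "(Fp has_derivative F') (at x within cSp)"
    and eq: "\<And>y. y \<in> cSm \<Longrightarrow> F y = Fm y" "\<And>y. y \<in> cSp \<Longrightarrow> F y = Fp y"
  shows "(F has_derivative F') (at x)"
proof -
  have "(F has_derivative F') (at x within cSm)" "(F has_derivative F') (at x within cSp)"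
    using has_derivative_transform[OF _ _ F(1)] has_derivative_transform[OF _ _ F(2)] cover(2)[OF x(2,1)] eq by auto
  then have "(F has_derivative F') (at x within cSm \<union> cSp)" by (rule has_derivative_within_Un)
  then have "(F has_derivative F') (at x within ball Q r)" using cover(3) by (rule has_derivative_subset)
  then show ?thesis unfolding at_within_open[OF x(2) open_ball] .
qed

lemma glued_derivative:
  assumes x: "x \<in> ball Q r"
  shows "(g has_derivative (lin (GU x) (GV x))) (at x)"
proof -
  consider "x \<in> \<Gamma>" | "x \<in> Sm" | "x \<in> Sp" using cover(1)[OF x] by blast
  then show ?thesis
  proof cases
    case 1
    note c = cover(2)[OF x 1]
    have eq: "GU x = m.U x" "GV x = m.V x" "GU x = p.U x" "GV x = p.V x"
      using glued_eq(1)[OF conjunct1[OF c]] glued_eq(2)[OF conjunct2[OF c]] by blast+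
    show ?thesis
    proof (rule glued_derivative_\<Gamma>[OF 1 x])
      show "(\<phi>m has_derivative (lin (GU x) (GV x))) (at x within cSm)"
        unfolding eq(1,2) by (rule m.der_cS(1)[OF conjunct1[OF c]])
      show "(\<phi>p has_derivative (lin (GU x) (GV x))) (at x within cSp)"
        unfolding eq(3,4) by (rule p.der_cS(1)[OF conjunct2[OF c]])
    qed (use glued_eq in blast)+
  next
    case 2
    then have "x \<in> cSm" "x \<in> \<Omega>m" using m.S_cS m.S_sub by auto
    then have eq: "GU x = m.U x" "GV x = m.V x" using glued_eq(1)[of x] by blast+
    show ?thesis unfolding eq
      by (rule has_derivative_transform_within_open[OF m.der_\<Omega>(1)[OF \<open>x \<in> \<Omega>m\<close>] m.open_\<Omega> \<open>x \<in> \<Omega>m\<close>])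
        (simp add: glue_def)
  next
    case 3
    then have xp: "x \<in> cSp" "x \<in> \<Omega>p" using p.S_cS p.S_sub by auto
    have eq: "GU x = p.U x" "GV x = p.V x" using glued_eq(2)[OF xp(1)] by blast+
    show ?thesis unfolding eq
      by (rule has_derivative_transform_within_open[OF p.der_\<Omega>(1)[OF xp(2)] p.open_\<Omega> xp(2)])
        (use disj in \<open>auto simp: glue_def\<close>)
  qed
qed

lemma glued_second_derivative:
  "(GU has_derivative (lin (m.a Q) (m.b Q))) (at Q)"
  "(GV has_derivative (lin (m.b Q) (m.d Q))) (at Q)"
  using glued_derivative_\<Gamma>[OF Q\<Gamma> Q_in(1) m.der_cS(2)[OF Q_in(2)] p.der_cS(2)[OF Q_in(3), unfolded Hessians_agree], of GU]
    glued_derivative_\<Gamma>[OF Q\<Gamma> Q_in(1) m.der_cS(3)[OF Q_in(2)] p.der_cS(3)[OF Q_in(3), unfolded Hessians_agree], of GV]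
    glued_eq by blast+

end

section \<open>Second-order expansion of \<psi> at the sonic point\<close>

context sonic_point
begin

definition W :: plane where "W = grad_from \<Omega>m \<phi>m Q"
definition \<psi> :: "plane \<Rightarrow> real" where "\<psi> = psi \<Omega>m \<phi>m \<phi>p Q"

lemma W_eq: "W = (m.U Q, m.V Q)"
  by (simp add: W_def grad_from_def m.U_def m.V_def)

lemma \<psi>_eq: "\<psi> x = g x + ((fst x)^2 + (snd x)^2 - ((fst Q)^2 + (snd Q)^2)) / 2
    - (m.U Q + fst Q) * (fst x - fst Q) - (m.V Q + snd Q) * (snd x - snd Q) - g Q"
  unfolding \<psi>_def psi_def phi2_def Let_def W_def[symmetric] W_eq by (simp add: algebra_simps add_divide_distrib diff_divide_distrib)

lemma \<psi>_derivative:
  assumes "x \<in> ball Q r"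
  shows "(\<psi> has_derivative (lin (GU x + fst x - (m.U Q + fst Q)) (GV x + snd x - (m.V Q + snd Q)))) (at x)"
  unfolding \<psi>_eq[abs_def]
  by (rule derivative_eq_intros glued_derivative[OF assms] | rule refl | (simp; fail))+
    (simp add: fun_eq_iff field_simps)

lemma twice_differentiable: "twice_differentiable_at \<psi> Q"
  unfolding twice_differentiable_at_def
proof
  have "\<forall>\<^sub>F x in nhds Q. x \<in> ball Q r" using Q_in(1) by (intro eventually_nhds_in_open) auto
  then show "\<forall>\<^sub>F x in nhds Q. \<psi> differentiable (at x)"
    by eventually_elim (use \<psi>_derivative in \<open>unfold differentiable_def, blast\<close>)
  have "((\<lambda>x. (GU x + fst x - (m.U Q + fst Q), GV x + snd x - (m.V Q + snd Q))) has_derivative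
     (\<lambda>h. (m.a Q * fst h + m.b Q * snd h + fst h, m.b Q * fst h + m.d Q * snd h + snd h))) (at Q)"
    by (rule has_derivative_eq_rhs, (rule derivative_intros glued_second_derivative)+) simp
  then have "(grad \<psi> has_derivative
     (\<lambda>h. (m.a Q * fst h + m.b Q * snd h + fst h, m.b Q * fst h + m.d Q * snd h + snd h))) (at Q)"
  proof (rule has_derivative_transform_within_open[OF _ open_ball Q_in(1)])
    show "(GU x + fst x - (m.U Q + fst Q), GV x + snd x - (m.V Q + snd Q)) = grad \<psi> x" if "x \<in> ball Q r" for x
      unfolding grad_def using pd_eqI[OF \<psi>_derivative[OF that]] by simp
  qed
  then show "grad \<psi> differentiable (at Q)" unfolding differentiable_def by blast
qed

lemma \<psi>_expansion:
  assumes "\<epsilon> > 0"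
  obtains \<delta> where "\<delta> > 0" "\<And>h. norm h < \<delta> \<Longrightarrow> \<bar>\<psi> (Q + h) - 1 / (\<gamma> + 1) * (h \<bullet> W)^2 / m.C Q\<bar> \<le> \<epsilon> * (norm h)^2"
proof -
  obtain \<delta> where \<delta>: "\<delta> > 0" "\<And>h. norm h < \<delta> \<Longrightarrow>
    \<bar>g (Q + h) - g Q - (GU Q * fst h + GV Q * snd h)
      - (m.a Q * (fst h)^2 + 2 * m.b Q * fst h * snd h + m.d Q * (snd h)^2) / 2\<bar> \<le> \<epsilon> * (norm h)^2"
    using second_order_Taylor[OF r glued_derivative glued_second_derivative assms] by metis
  have G: "GU Q = m.U Q" "GV Q = m.V Q" using glued_eq(1)[OF Q_in(2)] by auto
  \<comment> \<open>Subtracting \<open>phi2\<close> adds the identity to the Hessian of the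
    potential, which cancels the \<open>- 1\<close> in \<open>m.a Q\<close> and
    \<open>m.d Q\<close>; only the rank-one form in \<open>h \<bullet> W\<close> is left.\<close>
  have "\<psi> (Q + h) - 1 / (\<gamma> + 1) * (h \<bullet> W)^2 / m.C Q = g (Q + h) - g Q - (GU Q * fst h + GV Q * snd h)
      - (m.a Q * (fst h)^2 + 2 * m.b Q * fst h * snd h + m.d Q * (snd h)^2) / 2" for h
  proof -
    define k where "k = 1 / (\<gamma> + 1) / m.C Q"
    have k: "2 / (\<gamma> + 1) * z / m.C Q = 2 * (k * z)" "1 / (\<gamma> + 1) * z / m.C Q = k * z" for z
      by (simp_all add: k_def)
    have M: "m.a Q = 2 * (k * (m.U Q)^2) - 1" "m.b Q = 2 * (k * (m.U Q * m.V Q))" "m.d Q = 2 * (k * (m.V Q)^2) - 1"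
      using Hessian unfolding k by linarith+
    have hW: "h \<bullet> W = m.U Q * fst h + m.V Q * snd h" by (simp add: W_eq inner_prod_def)
    have "\<psi> (Q + h) = g (Q + h) - g Q - (GU Q * fst h + GV Q * snd h) + ((fst h)^2 + (snd h)^2) / 2"
      unfolding \<psi>_eq G by (simp add: field_simps power2_eq_square)
    then show ?thesis unfolding k M hW by (simp add: field_simps power2_eq_square)
  qed
  with \<delta> show thesis by (intro that[of \<delta>]) auto
qed

lemma \<psi>_lower_bound:
  assumes v: "v \<bullet> W \<noteq> 0" and \<epsilon>0: "\<epsilon>0 > 0"
  obtains \<epsilon> where "\<epsilon> > 0" "\<And>s. \<bar>s\<bar> < \<epsilon> \<Longrightarrow> (1 / (\<gamma> + 1) - \<epsilon>0) * ((v \<bullet> W) / sqrt (m.C Q))^2 * s^2 \<le> \<psi> (Q + s *\<^sub>R v)"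
proof -
  have nv: "norm v > 0" using v by auto
  define A where "A = ((v \<bullet> W) / sqrt (m.C Q))^2"
  have A: "A = (v \<bullet> W)^2 / m.C Q" using CQ(2) by (simp add: A_def power_divide)
  have Apos: "A > 0" unfolding A using v CQ(2) by simp
  \<comment> \<open>With this choice the Taylor error at parameter \<open>s\<close> is
    \<open>\<epsilon>0 * A * s^2\<close>, exactly the allowance in the claim. It is positive because
    \<open>v \<bullet> W\<close> is nonzero.\<close>
  define \<epsilon>1 where "\<epsilon>1 = \<epsilon>0 * A / (norm v)^2"
  have "\<epsilon>1 > 0" using \<epsilon>0 Apos nv by (simp add: \<epsilon>1_def)
  then obtain \<delta> where \<delta>: "\<delta> > 0" "\<And>h. norm h < \<delta> \<Longrightarrow> \<bar>\<psi> (Q + h) - 1 / (\<gamma> + 1) * (h \<bullet> W)^2 / m.C Q\<bar> \<le> \<epsilon>1 * (norm h)^2"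
    by (rule \<psi>_expansion) blast
  show thesis
  proof (rule that[of "\<delta> / norm v"])
    show "\<delta> / norm v > 0" using \<delta> nv by simp
    fix s assume "\<bar>s\<bar> < \<delta> / norm v"
    then have "norm (s *\<^sub>R v) < \<delta>" using nv by (simp add: pos_less_divide_eq)
    then have "\<bar>\<psi> (Q + s *\<^sub>R v) - 1 / (\<gamma> + 1) * (s *\<^sub>R v \<bullet> W)^2 / m.C Q\<bar> \<le> \<epsilon>1 * (norm (s *\<^sub>R v))^2" by (rule \<delta>(2))
    moreover have "1 / (\<gamma> + 1) * (s *\<^sub>R v \<bullet> W)^2 / m.C Q = 1 / (\<gamma> + 1) * A * s^2" by (simp add: A power_mult_distrib)
    moreover have "\<epsilon>1 * (norm (s *\<^sub>R v))^2 = \<epsilon>0 * A * s^2" using nv by (simp add: \<epsilon>1_def power_mult_distrib)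
    moreover have "(1 / (\<gamma> + 1) - \<epsilon>0) * A * s^2 = 1 / (\<gamma> + 1) * A * s^2 - \<epsilon>0 * A * s^2"
      by (simp only: left_diff_distrib)
    ultimately show "(1 / (\<gamma> + 1) - \<epsilon>0) * ((v \<bullet> W) / sqrt (m.C Q))^2 * s^2 \<le> \<psi> (Q + s *\<^sub>R v)"
      unfolding A_def[symmetric] by linarith
  qed
qed

end

section \<open>Excluding a velocity tangent to the sonic curve\<close>

context sonic_point
begin

lemma no_tangential_velocity:
  assumes v: "v \<noteq> 0" "v \<bullet> T = 0"
  shows "v \<bullet> W \<noteq> 0"
proof
  assume vW: "v \<bullet> W = 0"
  define q where "q = sqrt (m.C Q)"
  have q: "q > 0" "q^2 = m.C Q" using CQ(2) by (auto simp: q_def)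
  define x1 where "x1 = m.U Q / q"
  define y1 where "y1 = m.V Q / q"
  have UV: "m.U Q = q * x1" "m.V Q = q * y1" using q by (auto simp: x1_def y1_def)
  have "q^2 * (x1^2 + y1^2) = q^2 * 1"
    using CQ(1) q(2) unfolding UV by (simp add: power_mult_distrib algebra_simps)
  then have e1: "x1^2 + y1^2 = 1" using q(1) by (subst (asm) mult_cancel_left) simp
  \<comment> \<open>An unnormalised normal of the curve at \<open>Q\<close>, pointing to the
    subsonic side.\<close>
  define N where "N = e - f' *\<^sub>R t"
  have NT: "N \<bullet> T = 0" by (simp add: N_def T_def inner_diff_left inner_add_right te)
  have NN: "N \<bullet> N = 1 + f'^2"
    by (simp add: N_def inner_diff_left inner_diff_right te power2_eq_square)
  have "T \<bullet> T = 1 + f'^2"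
    by (simp add: T_def inner_add_left inner_add_right te power2_eq_square)
  then have T0: "T \<noteq> 0" using zero_le_power2[of f'] by (metis add_nonneg_eq_0_iff inner_zero_left zero_le_one zero_neq_one)
  have "fst v * (fst T * snd W - snd T * fst W) = 0" "snd v * (fst T * snd W - snd T * fst W) = 0"
    using v(2) vW unfolding inner_prod_def inner_real_def by algebra+
  \<comment> \<open>In the plane, two vectors orthogonal to a nonzero \<open>v\<close> are parallel;
    so \<open>W\<close> is tangent to the curve.\<close>
  then have par: "fst T * snd W = snd T * fst W" using v(1) by (auto simp: prod_eq_iff)
  have "fst T * (N \<bullet> W) = 0" "snd T * (N \<bullet> W) = 0"
    using par NT unfolding inner_prod_def inner_real_def by algebra+
  then have "N \<bullet> W = 0" using T0 by (auto simp: prod_eq_iff)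
  then have "q * (fst N * x1 + snd N * y1) = 0" by (simp add: W_eq UV inner_prod_def algebra_simps)
  then have Ne1: "fst N * x1 + snd N * y1 = 0" using q by simp
  \<comment> \<open>The sign that makes the new y-axis, which is orthogonal to \<open>W\<close>,
    point to the subsonic side.\<close>
  define k where "k = sgn (snd N * x1 - fst N * y1)"
  define n2 where "n2 = \<bar>snd N * x1 - fst N * y1\<bar>"
  \<comment> \<open>Lagrange's identity: as \<open>N\<close> is orthogonal to \<open>W\<close>, the
    number \<open>n2\<close> is the length of \<open>N\<close>.\<close>
  have "(snd N * x1 - fst N * y1)^2 = (snd N * x1 - fst N * y1)^2 + (fst N * x1 + snd N * y1)^2" using Ne1 by simp
  also have "\<dots> = ((fst N)^2 + (snd N)^2) * (x1^2 + y1^2)" by algebra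
  also have "\<dots> = N \<bullet> N" unfolding e1 by (simp add: inner_prod_def power2_eq_square)
  finally have "(snd N * x1 - fst N * y1)^2 = 1 + f'^2" unfolding NN .
  then have "n2^2 \<ge> 1^2" by (simp add: n2_def)
  then have n2: "n2 \<ge> 1" by (rule power2_le_imp_le) (simp add: n2_def)
  then have "snd N * x1 - fst N * y1 \<noteq> 0" by (auto simp: n2_def)
  then have k: "k * k = 1" and kn: "k * (snd N * x1 - fst N * y1) = n2"
    by (auto simp: k_def n2_def sgn_mult_self_eq sgn_if)

  \<comment> \<open>Rescaled coordinates at \<open>Q\<close>: \<open>x\<close> along \<open>W\<close>, \<open>y\<close> into the subsonic side, \<open>\<bar>W\<bar> = 1\<close>.\<close>
  define \<eta> where "\<eta> p = (q * (x1 * fst p - k * y1 * snd p), q * (y1 * fst p + k * x1 * snd p))" for p :: plane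
  define X where "X p = Q + \<eta> p" for p
  have norm_\<eta>: "norm (\<eta> p) = q * norm p" for p
  proof -
    have n2: "(norm z)^2 = (fst z)^2 + (snd z)^2" for z :: plane by (simp add: norm_prod_def)
    have "(norm (\<eta> p))^2 = q^2 * ((x1^2 + y1^2) * (fst p)^2 + k * k * (x1^2 + y1^2) * (snd p)^2)"
      unfolding n2 \<eta>_def fst_conv snd_conv by algebra
    also have "\<dots> = (q * norm p)^2" unfolding e1 k power_mult_distrib n2 by simp
    finally show ?thesis using q by (simp add: power2_eq_iff_nonneg)
  qed
  have \<eta>N: "\<eta> p \<bullet> N = q * n2 * snd p" for p
  proof -
    have "\<eta> p \<bullet> N = q * (fst p * (fst N * x1 + snd N * y1) + snd p * (k * (snd N * x1 - fst N * y1)))"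
      by (simp add: \<eta>_def inner_prod_def algebra_simps)
    then show ?thesis unfolding Ne1 kn by simp
  qed
  have \<eta>_der: "(X has_derivative \<eta>) (at p)" for p
  proof -
    have "bounded_linear \<eta>" unfolding \<eta>_def[abs_def]
      by (intro bounded_linear_Pair bounded_linear_intros)
    then have "(\<eta> has_derivative \<eta>) (at p)" by (rule bounded_linear_imp_has_derivative)
    then show ?thesis unfolding X_def[abs_def]
      by (intro derivative_eq_intros | assumption)+ auto
  qed
  have cont_X: "continuous_on A X" for A
    using \<eta>_der by (meson continuous_at_imp_continuous_on has_derivative_continuous)
  define D where "D = X -` Sp"
  have D: "p \<in> D \<longleftrightarrow> X p \<in> Sp" for p by (simp add: D_def)
  have "open D" unfolding D_def by (rule open_vimage[OF p.open_S cont_X])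
  have inD: "X p \<in> \<Omega>p" "X p \<in> cSp" if "p \<in> D" for p using that p.S_sub p.S_cS by (auto simp: D)
  \<comment> \<open>\<open>X\<close> multiplies lengths by \<open>q\<close>; division by
    \<open>q^2\<close> then divides the velocity by \<open>q\<close> and leaves second derivatives
    unchanged apart from the rotation.\<close>
  define phi where "phi p = (\<phi>p (X p) - \<phi>p Q) / q^2" for p
  define UU where "UU p = (x1 * p.U (X p) + y1 * p.V (X p)) / q" for p
  define VV where "VV p = k * (x1 * p.V (X p) - y1 * p.U (X p)) / q" for p
  define aa where "aa p = x1^2 * p.a (X p) + 2 * x1 * y1 * p.b (X p) + y1^2 * p.d (X p)" for p
  define bb where "bb p = k * (x1 * y1 * (p.d (X p) - p.a (X p)) + (x1^2 - y1^2) * p.b (X p))" for p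
  define dd where "dd p = y1^2 * p.a (X p) - 2 * x1 * y1 * p.b (X p) + x1^2 * p.d (X p)" for p
  define s where "s = \<gamma> - 1"
  \<comment> \<open>The Bernoulli constant of a flow whose potential vanishes and whose speed and
    sonic speed are both 1 at the origin.\<close>
  define KK where "KK = (s + 2) / (2 * s)"
  have s: "s > 0" using m.\<gamma> by (simp add: s_def)
  have q0: "q \<noteq> 0" using q by simp
  note comp = has_derivative_compose[OF \<eta>_der]
  have b'b: "p.b' (X p) = p.b (X p)" if "p \<in> D" for p using p.b'_eq inD(2)[OF that] by blast
  have kk: "k * (k * z) = z" for z using k by (metis mult.assoc mult_1)
  interpret c: C2_potential D phi UU VV aa bb dd s KK
  proof
    show "open D" by fact
    show "(phi has_derivative (lin (UU p) (VV p))) (at p)" if "p \<in> D" for p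
    proof -
      have "((\<lambda>p. (\<phi>p (X p) - \<phi>p Q) / q^2) has_derivative
          (\<lambda>h. (p.U (X p) * fst (\<eta> h) + p.V (X p) * snd (\<eta> h)) / q^2)) (at p)"
        by (rule derivative_eq_intros comp[OF p.der_\<Omega>(1)[OF inD(1)[OF that]]] | rule refl | (use q0 in simp; fail))+
      then show ?thesis unfolding phi_def[abs_def]
        by (rule has_derivative_eq_rhs)
          (use q0 in \<open>simp add: fun_eq_iff UU_def VV_def \<eta>_def power2_eq_square field_simps\<close>)
    qed
    have dU: "((\<lambda>p. p.U (X p)) has_derivative (\<lambda>h. p.a (X p) * fst (\<eta> h) + p.b (X p) * snd (\<eta> h))) (at p)"
      and dV: "((\<lambda>p. p.V (X p)) has_derivative (\<lambda>h. p.b (X p) * fst (\<eta> h) + p.d (X p) * snd (\<eta> h))) (at p)"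
      if "p \<in> D" for p
      using comp[OF p.der_\<Omega>(2)[OF inD(1)[OF that]]] comp[OF p.der_\<Omega>(3)[OF inD(1)[OF that]]] b'b[OF that] by auto
    show "(UU has_derivative (lin (aa p) (bb p))) (at p)" if "p \<in> D" for p
    proof -
      have "((\<lambda>p. (x1 * p.U (X p) + y1 * p.V (X p)) / q) has_derivative
          (\<lambda>h. (x1 * (p.a (X p) * fst (\<eta> h) + p.b (X p) * snd (\<eta> h)) + y1 * (p.b (X p) * fst (\<eta> h) + p.d (X p) * snd (\<eta> h))) / q)) (at p)"
        by (rule derivative_eq_intros dU[OF that] dV[OF that] | rule refl | (use q0 in simp; fail))+
      then show ?thesis unfolding UU_def[abs_def]
        by (rule has_derivative_eq_rhs)
          (use q0 in \<open>simp add: fun_eq_iff aa_def bb_def \<eta>_def power2_eq_square field_simps\<close>)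
    qed
    show "(VV has_derivative (lin (bb p) (dd p))) (at p)" if "p \<in> D" for p
    proof -
      have "((\<lambda>p. k * (x1 * p.V (X p) - y1 * p.U (X p)) / q) has_derivative
          (\<lambda>h. k * (x1 * (p.b (X p) * fst (\<eta> h) + p.d (X p) * snd (\<eta> h)) - y1 * (p.a (X p) * fst (\<eta> h) + p.b (X p) * snd (\<eta> h))) / q)) (at p)"
        by (rule derivative_eq_intros dU[OF that] dV[OF that] | rule refl | (use q0 in simp; fail))+
      then show ?thesis unfolding VV_def[abs_def]
        by (rule has_derivative_eq_rhs)
          (use q0 in \<open>simp add: fun_eq_iff bb_def dd_def \<eta>_def power2_eq_square field_simps kk\<close>)
    qed
    have cc: "continuous_on D (\<lambda>p. F (X p))" if "continuous_on cSp F" for F :: "plane \<Rightarrow> real"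
      by (rule continuous_on_compose2[OF that cont_X]) (use inD in auto)
    note cs = cc[OF p.cont(4)] cc[OF p.cont(5)] cc[OF p.cont(7)]
    show "continuous_on D aa" "continuous_on D bb" "continuous_on D dd"
      unfolding aa_def[abs_def] bb_def[abs_def] dd_def[abs_def] by (intro continuous_intros cs)+
  qed
  have sum_UV: "(UU p)^2 + (VV p)^2 = ((p.U (X p))^2 + (p.V (X p))^2) / q^2" for p
  proof -
    have "(UU p)^2 + (VV p)^2 = ((x1 * p.U (X p) + y1 * p.V (X p))^2 + k * k * (x1 * p.V (X p) - y1 * p.U (X p))^2) / q^2"
      unfolding UU_def VV_def
      by (simp only: power_divide power_mult_distrib add_divide_distrib[symmetric] power2_eq_square[of k])
    also have "(x1 * p.U (X p) + y1 * p.V (X p))^2 + k * k * (x1 * p.V (X p) - y1 * p.U (X p))^2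
       = (x1^2 + y1^2) * ((p.U (X p))^2 + (p.V (X p))^2)" unfolding k by algebra
    finally show ?thesis unfolding e1 by simp
  qed
  have sK: "s * KK = (s + 2) / 2" using s by (simp add: KK_def)
  have CC: "c.C p = p.C (X p) / q^2" for p
  proof -
    have "q^2 = s * (K - \<phi>p Q - q^2 / 2)"
      using CQ(1,3) match[OF Q\<Gamma>] unfolding p.C_def s_def q(2) by simp
    then have K: "s * (K - \<phi>p Q) = (s + 2) / 2 * q^2" by (simp add: field_simps)
    have "q^2 * c.C p = q^2 * (s * KK) - s * (\<phi>p (X p) - \<phi>p Q) - s * ((p.U (X p))^2 + (p.V (X p))^2) / 2"
      unfolding c.C_def sum_UV phi_def using q0 by (simp add: field_simps)
    also have "q^2 * (s * KK) = s * (K - \<phi>p Q)" unfolding sK K by simp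
    also have "s * (K - \<phi>p Q) - s * (\<phi>p (X p) - \<phi>p Q) - s * ((p.U (X p))^2 + (p.V (X p))^2) / 2 = p.C (X p)"
      unfolding p.C_def s_def by (simp add: field_simps)
    finally show ?thesis using q0 by (simp add: field_simps)
  qed
  have sub: "(UU p)^2 + (VV p)^2 < c.C p" if "p \<in> D" for p
    unfolding sum_UV CC using subsonic[of "X p"] that q(1) by (intro divide_strict_right_mono) (auto simp: D)
  \<comment> \<open>Besides \<open>C\<close>, the equation involves only the trace of the Hessian,
    its quadratic form on the velocity and the length of the velocity, all invariant under rotation
    and reflection.\<close>
  have pde: "(c.C p - (UU p)^2) * (1 + aa p) - 2 * UU p * VV p * bb p + (c.C p - (VV p)^2) * (1 + dd p) = 0"
    if "p \<in> D" for p
  proof -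
    define u w A B E F where "u = p.U (X p)" and "w = p.V (X p)" and "A = p.a (X p)" and "B = p.b (X p)"
      and "E = p.d (X p)" and "F = p.C (X p)"
    have pd: "(F - u^2) * (1 + A) - 2 * u * w * B + (F - w^2) * (1 + E) = 0"
      using p.pde[OF inD(2)[OF that]] by (simp add: u_def w_def A_def B_def E_def F_def)
    define al where "al = x1 * u + y1 * w"
    define be where "be = x1 * w - y1 * u"
    define a' where "a' = x1^2 * A + 2 * x1 * y1 * B + y1^2 * E"
    define b' where "b' = x1 * y1 * (E - A) + (x1^2 - y1^2) * B"
    define d' where "d' = y1^2 * A - 2 * x1 * y1 * B + x1^2 * E"
    have Q0: "UU p = al / q" "VV p = k * be / q" "aa p = a'" "bb p = k * b'" "dd p = d'" "c.C p = F / q^2"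
      unfolding UU_def VV_def aa_def bb_def dd_def CC al_def be_def a'_def b'_def d'_def u_def w_def A_def B_def E_def F_def
      by simp_all
    have tr: "a' + d' = A + E"
    proof -
      have "a' + d' = (x1^2 + y1^2) * (A + E)" unfolding a'_def d'_def by (simp add: algebra_simps)
      then show ?thesis using e1 by simp
    qed
    have "al^2 * a' + 2 * al * be * b' + be^2 * d' = (x1^2 + y1^2)^2 * (u^2 * A + 2 * u * w * B + w^2 * E)"
      unfolding a'_def b'_def d'_def al_def be_def by algebra
    then have qf: "al^2 * a' + 2 * al * be * b' + be^2 * d' = u^2 * A + 2 * u * w * B + w^2 * E" using e1 by simp
    have "al^2 + be^2 = (x1^2 + y1^2) * (u^2 + w^2)" unfolding al_def be_def by algebra
    then have nm: "al^2 + be^2 = u^2 + w^2" using e1 by simp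
    have "(F - al^2) * (1 + a') - 2 * al * be * b' + (F - be^2) * (1 + d')
       = F * (2 + (a' + d')) - (al^2 + be^2) - (al^2 * a' + 2 * al * be * b' + be^2 * d')"
      by (simp add: algebra_simps)
    also have "\<dots> = 0" unfolding tr qf nm using pd by (simp add: algebra_simps)
    finally have z: "(F - al^2) * (1 + a') - 2 * al * be * b' + (F - be^2) * (1 + d') = 0" .
    have "(F / q^2 - (al / q)^2) * (1 + a') - 2 * (al / q) * (k * be / q) * (k * b') + (F / q^2 - (k * be / q)^2) * (1 + d')
      = ((F - al^2) * (1 + a') - 2 * al * be * (k * k) * b' + (F - (k * k) * be^2) * (1 + d')) / q^2"
      using q0 by (simp add: field_simps power2_eq_square)
    then show ?thesis unfolding Q0 using z k by simp
  qed
  have QX: "X p - Q = \<eta> p" "X p = Q + \<eta> p" for p by (simp_all add: X_def)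
  \<comment> \<open>The graph deviates from its tangent by at most
    \<open>L * (h \<bullet> t)^2\<close>, hence by \<open>L * q^2 * (x^2 + y^2)\<close>.
    \<open>L'\<close> takes care of the part in \<open>x^2\<close>, and
    \<open>r0 \<le> 1 / L'\<close> absorbs the part in \<open>y^2\<close>.\<close>
  define L' where "L' = 2 * L * q + 1"
  define r0 where "r0 = min (r / (2 * q)) (1 / L')"
  have L': "L' \<ge> 1" using f'(1) q by (simp add: L'_def)
  have r0: "r0 > 0" "r0 * (2 * q) \<le> r" "r0 * L' \<le> 1"
    using r q L' by (auto simp: r0_def min_le_iff_disj pos_le_divide_eq[symmetric] min_mult_distrib_right)
  have dom: "(x, y) \<in> D" if xy: "\<bar>x\<bar> < r0" "y < r0" "L' * x^2 < y" for x y
  proof -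
    have "L' * x^2 \<ge> 0" using L' by simp
    then have y: "y > 0" using xy(3) by linarith
    define h where "h = \<eta> (x, y)"
    have nh: "norm h = q * norm (x, y)" by (simp add: h_def norm_\<eta>)
    have "norm (x, y) \<le> \<bar>x\<bar> + \<bar>y\<bar>" using norm_Pair_le[of x y] by simp
    also have "\<dots> < 2 * r0" using xy y by linarith
    finally have "norm h < q * (2 * r0)" unfolding nh using q(1) by (rule mult_strict_left_mono)
    then have hr: "norm h < r" using r0(2) by (simp add: algebra_simps)
    have ht: "\<bar>h \<bullet> t\<bar> \<le> norm h" using Cauchy_Schwarz_ineq2[of h t] te by simp
    have "(h \<bullet> t)^2 \<le> (norm h)^2" using ht abs_le_square_iff[of "h \<bullet> t" "norm h"] by simp
    also have "\<dots> = q^2 * (x^2 + y^2)" unfolding nh by (simp add: power_mult_distrib norm_Pair)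
    finally have "L * (h \<bullet> t)^2 \<le> L * (q^2 * (x^2 + y^2))" using f'(1) by (rule mult_left_mono)
    also have "\<dots> = q * ((L * q) * x^2 + (L * q) * (y * y))" by (simp add: power2_eq_square algebra_simps)
    also have "\<dots> < q * y"
    proof (rule mult_strict_left_mono[OF _ q(1)])
      have Lq: "2 * (L * q) \<le> L'" by (simp add: L'_def)
      then have "2 * (L * q) * x^2 \<le> L' * x^2" by (rule mult_right_mono) simp
      then have 1: "(L * q) * x^2 < y / 2" using xy(3) by simp
      have "2 * (L * q) * y \<le> L' * r0" using Lq xy(2) y f'(1) q L' by (intro mult_mono) auto
      then have "2 * (L * q) * y \<le> 1" using r0(3) by (simp add: mult.commute)
      then have "(2 * (L * q) * y) * y \<le> 1 * y" using y by (intro mult_right_mono) auto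
      then have 2: "(L * q) * (y * y) \<le> y / 2" by simp
      show "(L * q) * x^2 + (L * q) * (y * y) < y" using 1 2 by linarith
    qed
    also have "\<dots> \<le> q * n2 * y" using n2 q y by simp
    also have "\<dots> = h \<bullet> e - f' * (h \<bullet> t)" using \<eta>N[of "(x, y)"] by (simp add: h_def N_def inner_diff_right)
    finally have 1: "L * (h \<bullet> t)^2 < h \<bullet> e - f' * (h \<bullet> t)" .
    have ct: "X (x, y) \<bullet> t = Q \<bullet> t + h \<bullet> t" "X (x, y) \<bullet> e = Q \<bullet> e + h \<bullet> e"
      by (simp_all add: X_def h_def inner_add_left)
    have "\<bar>f (Q \<bullet> t + h \<bullet> t) - f (Q \<bullet> t) - f' * (h \<bullet> t)\<bar> \<le> L * (h \<bullet> t)^2"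
      using f'(2)[of "Q \<bullet> t + h \<bullet> t"] ht hr by simp
    then have "f (X (x, y) \<bullet> t) < X (x, y) \<bullet> e" unfolding ct using 1 Q_in(4) by linarith
    moreover have "X (x, y) \<in> ball Q r" using hr by (simp add: X_def h_def dist_norm)
    ultimately show ?thesis by (simp add: D mem_iff)
  qed
  have GQ: "GU Q = q * x1" "GV Q = q * y1" using glued_eq(1)[OF Q_in(2)] UV by auto
  define mm where "mm = 2 / (\<gamma> + 1)"
  have Hq: "m.a Q = mm * x1^2 - 1" "m.b Q = mm * (x1 * y1)" "m.d Q = mm * y1^2 - 1"
  proof -
    have "mm * (q * x1)^2 / m.C Q = mm * x1^2" "mm * (q * x1 * (q * y1)) / m.C Q = mm * (x1 * y1)"
      "mm * (q * y1)^2 / m.C Q = mm * y1^2"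
      unfolding q(2)[symmetric] using q0 by (simp_all add: power2_eq_square)
    then show "m.a Q = mm * x1^2 - 1" "m.b Q = mm * (x1 * y1)" "m.d Q = mm * y1^2 - 1"
      using Hessian unfolding UV mm_def[symmetric] by linarith+
  qed
  have mm: "1 - mm = s / (s + 2)" using s by (simp add: mm_def s_def field_simps)
  \<comment> \<open>In the new frame the Hessian at \<open>Q\<close> is diagonal with entries
    \<open>mm - 1\<close> and \<open>- 1\<close>, so the expansions of the glued potential and its
    gradient take the normalised form.\<close>
  have asy: "\<exists>\<rho>>0. \<forall>x y. (x, y) \<in> D \<longrightarrow> norm (x, y) < \<rho> \<longrightarrow>
        \<bar>UU (x, y) - 1 + s / (s + 2) * x\<bar> \<le> \<epsilon> * norm (x, y) \<and> \<bar>VV (x, y) + y\<bar> \<le> \<epsilon> * norm (x, y) \<and>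
        \<bar>phi (x, y) - x + (s / (s + 2) * x^2 + y^2) / 2\<bar> \<le> \<epsilon> * (norm (x, y))^2"
    if \<epsilon>: "\<epsilon> > 0" for \<epsilon>
  proof -
    have e2: "\<epsilon> / 2 > 0" using \<epsilon> by simp
    obtain d1 where d1: "d1 > 0" "\<And>y. norm (y - Q) < d1 \<Longrightarrow>
        norm (GU y - GU Q - (m.a Q * fst (y - Q) + m.b Q * snd (y - Q))) \<le> \<epsilon> / 2 * norm (y - Q)"
      using glued_second_derivative(1) e2 unfolding has_derivative_at_alt by metis
    obtain d2 where d2: "d2 > 0" "\<And>y. norm (y - Q) < d2 \<Longrightarrow>
        norm (GV y - GV Q - (m.b Q * fst (y - Q) + m.d Q * snd (y - Q))) \<le> \<epsilon> / 2 * norm (y - Q)"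
      using glued_second_derivative(2) e2 unfolding has_derivative_at_alt by metis
    obtain d3 where d3: "d3 > 0" "\<And>h. norm h < d3 \<Longrightarrow>
      \<bar>g (Q + h) - g Q - (GU Q * fst h + GV Q * snd h)
      - (m.a Q * (fst h)^2 + 2 * m.b Q * fst h * snd h + m.d Q * (snd h)^2) / 2\<bar> \<le> \<epsilon> * (norm h)^2"
      using second_order_Taylor[OF r glued_derivative glued_second_derivative \<epsilon>] by metis
    define \<rho> where "\<rho> = min d1 (min d2 d3) / q"
    show ?thesis
    proof (intro exI[of _ \<rho>] conjI allI impI)
      show "\<rho> > 0" using d1 d2 d3 q by (simp add: \<rho>_def)
      fix x y assume xyD: "(x, y) \<in> D" and "norm (x, y) < \<rho>"
      then have "q * norm (x, y) < min d1 (min d2 d3)" using q by (simp add: \<rho>_def pos_less_divide_eq mult.commute)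
      then have n: "norm (\<eta> (x, y)) < d1" "norm (\<eta> (x, y)) < d2" "norm (\<eta> (x, y)) < d3" by (simp_all add: norm_\<eta>)
      define h1 where "h1 = q * (x1 * x - k * y1 * y)"
      define h2 where "h2 = q * (y1 * x + k * x1 * y)"
      have h: "\<eta> (x, y) = (h1, h2)" by (simp add: \<eta>_def h1_def h2_def)
      have nh: "norm (h1, h2) = q * norm (x, y)" using norm_\<eta>[of "(x, y)"] h by simp
      have gl: "g (Q + (h1, h2)) = \<phi>p (X (x, y))" "GU (Q + (h1, h2)) = p.U (X (x, y))" "GV (Q + (h1, h2)) = p.V (X (x, y))"
        using glued_eq(2)[OF inD(2)[OF xyD]] by (auto simp: X_def h)
      have gQ: "g Q = \<phi>p Q" using glued_eq(2)[OF Q_in(3)] by simp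
      define E1 where "E1 = p.U (X (x, y)) - q * x1 - (m.a Q * h1 + m.b Q * h2)"
      define E2 where "E2 = p.V (X (x, y)) - q * y1 - (m.b Q * h1 + m.d Q * h2)"
      have E: "\<bar>E1\<bar> \<le> \<epsilon> / 2 * (q * norm (x, y))" "\<bar>E2\<bar> \<le> \<epsilon> / 2 * (q * norm (x, y))"
        using d1(2)[of "Q + (h1, h2)"] d2(2)[of "Q + (h1, h2)"] n unfolding gl GQ h nh E1_def E2_def by (simp_all add: nh)
      have lin: "x1 * h1 + y1 * h2 = q * x" "x1 * h2 - y1 * h1 = q * (k * y)"
      proof -
        have "x1 * h1 + y1 * h2 = q * ((x1^2 + y1^2) * x)" "x1 * h2 - y1 * h1 = q * ((x1^2 + y1^2) * (k * y))"
          unfolding h1_def h2_def by algebra+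
        then show "x1 * h1 + y1 * h2 = q * x" "x1 * h2 - y1 * h1 = q * (k * y)" using e1 by simp_all
      qed
      have xyb: "\<bar>x1\<bar> \<le> 1" "\<bar>y1\<bar> \<le> 1" "\<bar>k\<bar> = 1"
      proof -
        have "x1^2 \<le> 1^2" "y1^2 \<le> 1^2" using e1 zero_le_power2[of x1] zero_le_power2[of y1] by (simp_all only: one_power2)
        then show "\<bar>x1\<bar> \<le> 1" "\<bar>y1\<bar> \<le> 1" using abs_le_square_iff[of x1 1] abs_le_square_iff[of y1 1] by auto
        have "k^2 = 1" using k by (simp add: power2_eq_square)
        then show "\<bar>k\<bar> = 1" by (auto simp: power2_eq_1_iff)
      qed
      have comb: "\<bar>\<alpha> * E1 + \<beta> * E2\<bar> / q \<le> \<epsilon> * norm (x, y)" if "\<bar>\<alpha>\<bar> \<le> 1" "\<bar>\<beta>\<bar> \<le> 1" for \<alpha> \<beta>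
      proof -
        have "\<bar>\<alpha> * E1 + \<beta> * E2\<bar> \<le> \<bar>\<alpha>\<bar> * \<bar>E1\<bar> + \<bar>\<beta>\<bar> * \<bar>E2\<bar>" by (metis abs_mult abs_triangle_ineq)
        also have "\<dots> \<le> 1 * (\<epsilon> / 2 * (q * norm (x, y))) + 1 * (\<epsilon> / 2 * (q * norm (x, y)))"
          using that E by (intro add_mono mult_mono) auto
        also have "\<dots> = (\<epsilon> * norm (x, y)) * q" by simp
        finally show ?thesis using q(1) by (simp add: pos_divide_le_eq)
      qed
      show "\<bar>UU (x, y) - 1 + s / (s + 2) * x\<bar> \<le> \<epsilon> * norm (x, y)"
      proof -
        have "q * (UU (x, y) - 1 + (1 - mm) * x) = x1 * p.U (X (x, y)) + y1 * p.V (X (x, y)) - q * (x1^2 + y1^2) + (1 - mm) * (q * x)"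
        proof -
          have "q * UU (x, y) = x1 * p.U (X (x, y)) + y1 * p.V (X (x, y))" unfolding UU_def using q0 by simp
          then show ?thesis unfolding e1 by (simp add: algebra_simps)
        qed
        also have "\<dots> = x1 * E1 + y1 * E2 + (mm * (x1^2 + y1^2) - 1) * (x1 * h1 + y1 * h2) + (1 - mm) * (q * x)"
          unfolding E1_def E2_def Hq by algebra
        also have "\<dots> = x1 * E1 + y1 * E2" unfolding e1 lin by (simp add: algebra_simps)
        finally have "UU (x, y) - 1 + (1 - mm) * x = (x1 * E1 + y1 * E2) / q" using q0 by (metis nonzero_mult_div_cancel_left)
        then show ?thesis using comb[of x1 y1] xyb q(1) unfolding mm by simp
      qed
      show "\<bar>VV (x, y) + y\<bar> \<le> \<epsilon> * norm (x, y)"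
      proof -
        have "q * (VV (x, y) + y) = k * (x1 * p.V (X (x, y)) - y1 * p.U (X (x, y))) + k * (q * (k * y))"
        proof -
          have "q * VV (x, y) = k * (x1 * p.V (X (x, y)) - y1 * p.U (X (x, y)))" unfolding VV_def using q0 by simp
          moreover have "k * (q * (k * y)) = q * y" using kk[of "q * y"] by (simp add: mult_ac)
          ultimately show ?thesis by (simp only: distrib_left)
        qed
        also have "\<dots> = k * (x1 * p.V (X (x, y)) - y1 * p.U (X (x, y))) + k * (x1 * h2 - y1 * h1)" unfolding lin ..
        also have "\<dots> = - (k * y1) * E1 + k * x1 * E2"
          unfolding E1_def E2_def Hq by algebra
        finally have "VV (x, y) + y = (- (k * y1) * E1 + k * x1 * E2) / q" using q0 by (metis nonzero_mult_div_cancel_left)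
        then show ?thesis using comb[of "- (k * y1)" "k * x1"] xyb q(1) by (simp add: abs_mult)
      qed
      show "\<bar>phi (x, y) - x + (s / (s + 2) * x^2 + y^2) / 2\<bar> \<le> \<epsilon> * (norm (x, y))^2"
      proof -
        define R where "R = g (Q + (h1, h2)) - g Q - (GU Q * h1 + GV Q * h2)
          - (m.a Q * h1^2 + 2 * m.b Q * h1 * h2 + m.d Q * h2^2) / 2"
        have Rb: "\<bar>R\<bar> \<le> \<epsilon> * (q * norm (x, y))^2" using d3(2)[of "(h1, h2)"] n(3) unfolding R_def h nh by simp
        have "h1^2 + h2^2 = (q * norm (x, y))^2" unfolding nh[symmetric] by (simp add: norm_Pair)
        then have hh: "h1^2 + h2^2 = q^2 * (x^2 + y^2)" by (simp add: power_mult_distrib norm_Pair)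
        have "m.a Q * h1^2 + 2 * m.b Q * h1 * h2 + m.d Q * h2^2 = mm * (x1 * h1 + y1 * h2)^2 - (h1^2 + h2^2)"
          unfolding Hq by algebra
        then have quad: "m.a Q * h1^2 + 2 * m.b Q * h1 * h2 + m.d Q * h2^2 = q^2 * ((mm - 1) * x^2 - y^2)"
          unfolding lin hh by (simp add: power_mult_distrib algebra_simps)
        have "GU Q * h1 + GV Q * h2 = q * (x1 * h1 + y1 * h2)" unfolding GQ by (simp add: algebra_simps)
        then have linG: "GU Q * h1 + GV Q * h2 = q^2 * x" unfolding lin by (simp add: power2_eq_square)
        have "q^2 * (phi (x, y) - x + ((1 - mm) * x^2 + y^2) / 2) = R"
          unfolding R_def quad linG gl gQ phi_def using q0 by (simp add: field_simps)
        then have "phi (x, y) - x + ((1 - mm) * x^2 + y^2) / 2 = R / q^2"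
          using q0 by (metis nonzero_mult_div_cancel_left power_not_zero)
        then have "\<bar>phi (x, y) - x + ((1 - mm) * x^2 + y^2) / 2\<bar> = \<bar>R\<bar> / q^2" by simp
        also have "\<dots> \<le> \<epsilon> * (q * norm (x, y))^2 / q^2" using Rb by (intro divide_right_mono) auto
        also have "\<dots> = \<epsilon> * (norm (x, y))^2" using q0 by (simp add: power_mult_distrib)
        finally show ?thesis unfolding mm .
      qed
    qed
  qed
  show False
    by (rule c.no_tangential_sonic_point[OF s sK sub pde r0(1) dom asy])
qed

end

section \<open>Charts of the sonic curve\<close>

lemma rot_Pair: "rot \<theta> (x, y) = x *\<^sub>R rot \<theta> (1, 0) + y *\<^sub>R rot \<theta> (0, 1)"
  by (simp add: rot_def algebra_simps)

lemma rot_scaleR: "rot \<theta> (k *\<^sub>R p) = k *\<^sub>R rot \<theta> p"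
  by (simp add: rot_def algebra_simps)

lemma rot_orthonormal:
  "norm (rot \<theta> (1, 0)) = 1" "norm (rot \<theta> (0, 1)) = 1" "rot \<theta> (1, 0) \<bullet> rot \<theta> (0, 1) = 0"
  by (simp_all add: rot_def norm_Pair inner_Pair)

lemma rot_coords: "rot \<theta> p \<bullet> rot \<theta> (1, 0) = fst p" "rot \<theta> p \<bullet> rot \<theta> (0, 1) = snd p"
proof -
  have "rot \<theta> p \<bullet> rot \<theta> (1, 0) = fst p * ((cos \<theta>)^2 + (sin \<theta>)^2)"
    "rot \<theta> p \<bullet> rot \<theta> (0, 1) = snd p * ((cos \<theta>)^2 + (sin \<theta>)^2)"
    unfolding rot_def inner_Pair fst_conv snd_conv inner_real_def by algebra+
  then show "rot \<theta> p \<bullet> rot \<theta> (1, 0) = fst p" "rot \<theta> p \<bullet> rot \<theta> (0, 1) = snd p" by simp_all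
qed

lemma rot_inv: "x = rot \<theta> (x \<bullet> rot \<theta> (1, 0), x \<bullet> rot \<theta> (0, 1))"
  by (subst rot_Pair) (rule orthonormal_expansion[OF rot_orthonormal])

text \<open>A Lipschitz bound for \<open>deriv f\<close> on a compact interval around
  \<open>x0\<close> bounds \<open>deriv f\<close> itself, and, applied to \<open>f\<close> minus its
  tangent, gives the quadratic remainder.\<close>

lemma C11_local_bounds:
  assumes f: "C11_on l1 l2 f" and x0: "l1 < x0" "x0 < l2"
  obtains \<rho> \<Lambda> L where "\<rho> > 0" "\<Lambda> \<ge> 0" "L \<ge> 0" "l1 < x0 - \<rho>" "x0 + \<rho> < l2"
    "\<And>x y. \<bar>x - x0\<bar> \<le> \<rho> \<Longrightarrow> \<bar>y - x0\<bar> \<le> \<rho> \<Longrightarrow> \<bar>f x - f y\<bar> \<le> \<Lambda> * \<bar>x - y\<bar>"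
    "\<And>x. \<bar>x - x0\<bar> \<le> \<rho> \<Longrightarrow> \<bar>f x - f x0 - deriv f x0 * (x - x0)\<bar> \<le> L * (x - x0)^2"
proof -
  define \<rho> where "\<rho> = min (x0 - l1) (l2 - x0) / 2"
  have \<rho>: "\<rho> > 0" "l1 < x0 - \<rho>" "x0 + \<rho> < l2" using x0 by (auto simp: \<rho>_def min_def field_simps)
  obtain L where L: "L-lipschitz_on {x0 - \<rho>..x0 + \<rho>} (deriv f)"
    using f \<rho> unfolding C11_on_def by blast
  have L0: "L \<ge> 0" using L by (rule lipschitz_on_nonneg)
  have df: "(f has_real_derivative deriv f x) (at x)" if "\<bar>x - x0\<bar> \<le> \<rho>" for x
  proof -
    have "x \<in> {l1<..<l2}" using that \<rho> by (auto simp: abs_le_iff)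
    then have "f differentiable (at x)" using f by (simp add: C11_on_def differentiable_on_eq_differentiable_at)
    then show ?thesis by (simp add: DERIV_deriv_iff_real_differentiable)
  qed
  have dL: "\<bar>deriv f x - deriv f x0\<bar> \<le> L * \<bar>x - x0\<bar>" if "\<bar>x - x0\<bar> \<le> \<rho>" for x
    using lipschitz_onD[OF L, of x x0] that \<rho> by (auto simp: dist_real_def abs_le_iff)
  have seg: "\<bar>z - x0\<bar> \<le> max \<bar>x - x0\<bar> \<bar>y - x0\<bar>" if "z \<in> closed_segment x y" for x y z :: real
    using that by (auto simp: closed_segment_eq_real_ivl split: if_splits)
  define \<Lambda> where "\<Lambda> = \<bar>deriv f x0\<bar> + L * \<rho>"
  have \<Lambda>0: "\<Lambda> \<ge> 0" using L0 \<rho> by (simp add: \<Lambda>_def)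
  have bound: "\<bar>h x - h y\<bar> \<le> B * \<bar>x - y\<bar>"
    if "\<And>z. z \<in> closed_segment x y \<Longrightarrow> (h has_real_derivative h' z) (at z)"
       "\<And>z. z \<in> closed_segment x y \<Longrightarrow> \<bar>h' z\<bar> \<le> B" for h h' :: "real \<Rightarrow> real" and x y B
  proof -
    have "norm (h x - h y) \<le> B * norm (x - y)"
      by (rule field_differentiable_bound[OF convex_closed_segment[of x y], of h h'])
        (simp_all add: that has_field_derivative_at_within)
    then show ?thesis by simp
  qed
  show thesis
  proof (rule that[OF \<rho>(1) \<Lambda>0 L0 \<rho>(2,3)])
    fix x y assume xy: "\<bar>x - x0\<bar> \<le> \<rho>" "\<bar>y - x0\<bar> \<le> \<rho>"
    show "\<bar>f x - f y\<bar> \<le> \<Lambda> * \<bar>x - y\<bar>"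
    proof (rule bound[of x y f "deriv f"])
      fix z assume "z \<in> closed_segment x y"
      then have z: "\<bar>z - x0\<bar> \<le> \<rho>" using seg[of z x y] xy by linarith
      show "(f has_real_derivative deriv f z) (at z)" by (rule df[OF z])
      have "L * \<bar>z - x0\<bar> \<le> L * \<rho>" using z L0 by (rule mult_left_mono)
      then show "\<bar>deriv f z\<bar> \<le> \<Lambda>" using dL[OF z] unfolding \<Lambda>_def by linarith
    qed
  next
    fix x assume x: "\<bar>x - x0\<bar> \<le> \<rho>"
    define h where "h z = f z - deriv f x0 * z" for z
    have "\<bar>h x - h x0\<bar> \<le> (L * \<bar>x - x0\<bar>) * \<bar>x - x0\<bar>"
    proof (rule bound[of x x0 h "\<lambda>z. deriv f z - deriv f x0"])
      fix z assume "z \<in> closed_segment x x0"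
      then have z': "\<bar>z - x0\<bar> \<le> \<bar>x - x0\<bar>" using seg[of z x x0] by linarith
      then have z: "\<bar>z - x0\<bar> \<le> \<rho>" using x by linarith
      show "(h has_real_derivative deriv f z - deriv f x0) (at z)"
        unfolding h_def by (rule derivative_eq_intros df[OF z] | rule refl)+ simp
      have "L * \<bar>z - x0\<bar> \<le> L * \<bar>x - x0\<bar>" using z' L0 by (rule mult_left_mono)
      then show "\<bar>deriv f z - deriv f x0\<bar> \<le> L * \<bar>x - x0\<bar>" using dL[OF z] by linarith
    qed
    moreover have "h x - h x0 = f x - f x0 - deriv f x0 * (x - x0)" by (simp add: h_def algebra_simps)
    moreover have "(L * \<bar>x - x0\<bar>) * \<bar>x - x0\<bar> = L * (x - x0)^2"
      by (simp only: mult.assoc abs_mult_self_eq power2_eq_square)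
    ultimately show "\<bar>f x - f x0 - deriv f x0 * (x - x0)\<bar> \<le> L * (x - x0)^2" by simp
  qed
qed

section \<open>From a sonic configuration to the local setting at one point\<close>

lemma sonic_configuration_disjoint:
  assumes conf: "sonic_configuration \<gamma> K \<Omega>m \<Omega>p \<Gamma> \<phi>m \<phi>p"
  shows "\<Omega>m \<inter> \<Omega>p = {}" "\<Gamma> \<inter> \<Omega>m = {}" "\<Gamma> \<inter> \<Omega>p = {}"
proof -
  note c = conf[unfolded sonic_configuration_def]
  show "\<Omega>m \<inter> \<Omega>p = {}" using c by (elim conjE)
  have m: "\<forall>x\<in>\<Omega>m. norm (grad \<phi>m x) > sonic_speed \<gamma> K \<Omega>m \<phi>m x" using c by (elim conjE)
  have p: "\<forall>x\<in>\<Omega>p. norm (grad \<phi>p x) < sonic_speed \<gamma> K \<Omega>p \<phi>p x" using c by (elim conjE)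
  have on: "\<forall>x\<in>\<Gamma>. \<phi>p x = \<phi>m x \<and> grad_from \<Omega>p \<phi>p x = grad_from \<Omega>m \<phi>m x \<and>
      norm (grad_from \<Omega>m \<phi>m x) = sonic_speed \<gamma> K \<Omega>m \<phi>m x" using c by (elim conjE)
  \<comment> \<open>At points of \<Omega> the one-sided values are the ordinary ones, so the strict
    inequalities inside conflict with sonicity on the curve.\<close>
  have gf: "grad_from \<Omega> \<phi> x = grad \<phi> x" if "x \<in> \<Omega>" for \<Omega> \<phi> x
    using that by (simp add: grad_from_def grad_def value_from_in)
  show "\<Gamma> \<inter> \<Omega>m = {}"
  proof (rule equals0I)
    fix x assume "x \<in> \<Gamma> \<inter> \<Omega>m"
    then have x: "x \<in> \<Gamma>" "x \<in> \<Omega>m" by auto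
    show False using bspec[OF m x(2)] bspec[OF on x(1)] gf[OF x(2), of \<phi>m] by simp
  qed
  show "\<Gamma> \<inter> \<Omega>p = {}"
  proof (rule equals0I)
    fix x assume "x \<in> \<Gamma> \<inter> \<Omega>p"
    then have x: "x \<in> \<Gamma>" "x \<in> \<Omega>p" by auto
    have o: "\<phi>p x = \<phi>m x" "grad_from \<Omega>p \<phi>p x = grad_from \<Omega>m \<phi>m x"
      "norm (grad_from \<Omega>m \<phi>m x) = sonic_speed \<gamma> K \<Omega>m \<phi>m x" using bspec[OF on x(1)] by blast+
    have "sonic_speed \<gamma> K \<Omega>p \<phi>p x = sonic_speed \<gamma> K \<Omega>m \<phi>m x" by (simp add: sonic_speed_def bernoulli_def o(1,2))
    then have "norm (grad \<phi>p x) = sonic_speed \<gamma> K \<Omega>p \<phi>p x" using o(2,3) gf[OF x(2), of \<phi>p] by simp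
    then show False using bspec[OF p x(2)] by simp
  qed
qed

lemma continuous_on_bernoulli:
  assumes "C2_upto \<Omega> X \<phi>"
  shows "continuous_on X (bernoulli K \<Omega> \<phi>)"
proof -
  have "continuous_on X \<phi>" "continuous_on X (value_from \<Omega> (pd1 \<phi>))" "continuous_on X (value_from \<Omega> (pd2 \<phi>))"
    using assms unfolding C2_upto_def by blast+
  then show ?thesis unfolding bernoulli_eq[abs_def] by (intro continuous_intros) auto
qed

text \<open>The graph is oriented so that \<open>e\<close> points to the subsonic side. The
  conclusions involve \<open>e\<close> and \<open>f'\<close> only through the tangent
  \<open>t + f' *\<^sub>R e\<close>, so the other orientation follows by changing the signs of
  \<open>e\<close>, \<open>f\<close> and \<open>f'\<close>.\<close>

lemma sonic_point_behaviour:
  fixes \<gamma> K :: real and \<Omega>m \<Omega>p \<Gamma> :: "plane set" and \<phi>m \<phi>p :: "plane \<Rightarrow> real"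
    and t e Q :: plane and r \<Lambda> L f' :: real and f :: "real \<Rightarrow> real"
  defines "W \<equiv> grad_from \<Omega>m \<phi>m Q" and "\<psi> \<equiv> psi \<Omega>m \<phi>m \<phi>p Q" and "c \<equiv> sonic_speed \<gamma> K \<Omega>m \<phi>m Q"
  assumes \<gamma>: "\<gamma> > 1" and conf: "sonic_configuration \<gamma> K \<Omega>m \<Omega>p \<Gamma> \<phi>m \<phi>p" and Q: "Q \<in> \<Gamma>"
    and te: "norm t = 1" "norm e = 1" "t \<bullet> e = 0" and r: "r > 0"
    and \<Gamma>: "\<Gamma> \<inter> ball Q r = {x. f (x \<bullet> t) = x \<bullet> e} \<inter> ball Q r"
    and sides: "{x. f (x \<bullet> t) < x \<bullet> e} \<inter> ball Q r \<subseteq> \<Omega>p" "{x. x \<bullet> e < f (x \<bullet> t)} \<inter> ball Q r \<subseteq> \<Omega>m"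
    and \<Lambda>: "\<Lambda> \<ge> 0" "\<And>x y. \<bar>x - Q \<bullet> t\<bar> < r \<Longrightarrow> \<bar>y - Q \<bullet> t\<bar> < r \<Longrightarrow> \<bar>f x - f y\<bar> \<le> \<Lambda> * \<bar>x - y\<bar>"
    and L: "L \<ge> 0" "\<And>x. \<bar>x - Q \<bullet> t\<bar> < r \<Longrightarrow> \<bar>f x - f (Q \<bullet> t) - f' * (x - Q \<bullet> t)\<bar> \<le> L * (x - Q \<bullet> t)^2"
    and nonexceptional: "W \<bullet> (t + f' *\<^sub>R e) \<noteq> 0"
    and perp: "perp_deriv_c \<gamma> K \<Omega>m \<phi>m Q = 0 \<or> perp_deriv_c \<gamma> K \<Omega>p \<phi>p Q = 0"
  shows "twice_differentiable_at \<psi> Q"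
    and "\<And>v. v \<noteq> 0 \<Longrightarrow> v \<bullet> (t + f' *\<^sub>R e) = 0 \<Longrightarrow> v \<bullet> W \<noteq> 0"
    and "\<And>v \<epsilon>0. v \<bullet> W \<noteq> 0 \<Longrightarrow> \<epsilon>0 > 0 \<Longrightarrow>
      \<exists>\<epsilon>>0. \<forall>s. \<bar>s\<bar> < \<epsilon> \<longrightarrow> (1 / (\<gamma> + 1) - \<epsilon>0) * ((v \<bullet> W) / c)^2 * s^2 \<le> \<psi> (Q + s *\<^sub>R v)"
proof -
  note c = conf[unfolded sonic_configuration_def]
  have C2m: "C2_upto \<Omega>m (closure \<Omega>m) \<phi>m" using c by (elim conjE)
  have flowm: "potential_flow \<gamma> K \<Omega>m \<phi>m" using c by (elim conjE)
  have C2p: "C2_upto \<Omega>p (\<Omega>p \<union> \<Gamma>) \<phi>p" using c by (elim conjE)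
  have flowp: "potential_flow \<gamma> K \<Omega>p \<phi>p" using c by (elim conjE)
  have subs': "\<forall>x\<in>\<Omega>p. norm (grad \<phi>p x) < sonic_speed \<gamma> K \<Omega>p \<phi>p x" using c by (elim conjE)
  have on\<Gamma>': "\<forall>x\<in>\<Gamma>. \<phi>p x = \<phi>m x \<and> grad_from \<Omega>p \<phi>p x = grad_from \<Omega>m \<phi>m x \<and>
      norm (grad_from \<Omega>m \<phi>m x) = sonic_speed \<gamma> K \<Omega>m \<phi>m x" using c by (elim conjE)
  note subs = bspec[OF subs']
  have on\<Gamma>: "\<And>x. x \<in> \<Gamma> \<Longrightarrow> \<phi>p x = \<phi>m x" "\<And>x. x \<in> \<Gamma> \<Longrightarrow> grad_from \<Omega>p \<phi>p x = grad_from \<Omega>m \<phi>m x"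
      "\<And>x. x \<in> \<Gamma> \<Longrightarrow> norm (grad_from \<Omega>m \<phi>m x) = sonic_speed \<gamma> K \<Omega>m \<phi>m x"
    using on\<Gamma>' by blast+
  \<comment> \<open>Non-exceptionality gives a nonzero speed, hence a positive sonic speed at
    \<open>Q\<close>; by continuity the Bernoulli term stays positive on a smaller ball.\<close>
  have "W \<noteq> 0" using nonexceptional by auto
  then have "norm W > 0" by simp
  then have "sonic_speed \<gamma> K \<Omega>m \<phi>m Q > 0" using on\<Gamma>(3)[OF Q] unfolding W_def by simp
  then have bm: "bernoulli K \<Omega>m \<phi>m Q > 0" using \<gamma> by (simp add: sonic_speed_def zero_less_mult_iff)
  then have bp: "bernoulli K \<Omega>p \<phi>p Q > 0" using on\<Gamma>(1,2)[OF Q] by (simp add: bernoulli_def)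
  have te': "norm (- e) = 1" "t \<bullet> (- e) = 0" using te by simp_all
  have on_graph: "x \<in> \<Gamma> \<longleftrightarrow> f (x \<bullet> t) = x \<bullet> e" if "x \<in> ball Q r" for x using \<Gamma> that by blast
  have Qe: "f (Q \<bullet> t) = Q \<bullet> e" using on_graph[of Q] Q r by simp
  have flip: "{x. - f (x \<bullet> t) < x \<bullet> - e} = {x. x \<bullet> e < f (x \<bullet> t)}" by auto
  have closm: "{x. - f (x \<bullet> t) \<le> x \<bullet> - e} \<inter> ball Q r \<subseteq> closure \<Omega>m"
    using closed_epigraph_subset_closure[OF te(1) te', of "\<lambda>x. - f x" Q r] closure_mono[OF sides(2)]
    unfolding flip by blast
  have closp: "{x. f (x \<bullet> t) \<le> x \<bullet> e} \<inter> ball Q r \<subseteq> \<Omega>p \<union> \<Gamma>"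
  proof
    fix x assume x: "x \<in> {x. f (x \<bullet> t) \<le> x \<bullet> e} \<inter> ball Q r"
    then consider "f (x \<bullet> t) < x \<bullet> e" | "f (x \<bullet> t) = x \<bullet> e" by fastforce
    then show "x \<in> \<Omega>p \<union> \<Gamma>" using x sides(1) on_graph by cases blast+
  qed
  have Qm: "Q \<in> closure \<Omega>m" 
  proof (rule subsetD[OF closm])
    show "Q \<in> {x. - f (x \<bullet> t) \<le> x \<bullet> - e} \<inter> ball Q r" using r Qe by simp
  qed
  have Qp: "Q \<in> \<Omega>p \<union> \<Gamma>" using Q by simp
  obtain r1 where r1: "r1 > 0" "\<And>x. x \<in> closure \<Omega>m \<Longrightarrow> dist x Q < r1 \<Longrightarrow> dist (bernoulli K \<Omega>m \<phi>m x) (bernoulli K \<Omega>m \<phi>m Q) < bernoulli K \<Omega>m \<phi>m Q"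
    using continuous_on_bernoulli[OF C2m, of K, unfolded continuous_on_iff, rule_format, OF Qm bm] by blast
  obtain r2 where r2: "r2 > 0" "\<And>x. x \<in> \<Omega>p \<union> \<Gamma> \<Longrightarrow> dist x Q < r2 \<Longrightarrow> dist (bernoulli K \<Omega>p \<phi>p x) (bernoulli K \<Omega>p \<phi>p Q) < bernoulli K \<Omega>p \<phi>p Q"
    using continuous_on_bernoulli[OF C2p, of K, unfolded continuous_on_iff, rule_format, OF Qp bp] by blast
  have posI: "a > 0" if "dist a b < b" for a b :: real using that unfolding dist_real_def by linarith
  define R where "R = min r (min r1 r2)"
  have R: "R > 0" "R \<le> r" "R \<le> r1" "R \<le> r2" using r r1 r2 by (auto simp: R_def)
  have sub: "ball Q R \<subseteq> ball Q r" using R by auto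
  have Lip: "\<bar>f (x \<bullet> t) - f (y \<bullet> t)\<bar> \<le> \<Lambda> * \<bar>x \<bullet> t - y \<bullet> t\<bar>" if "x \<in> ball Q R" "y \<in> ball Q R" for x y
  proof (rule \<Lambda>(2))
    have "\<bar>(z - Q) \<bullet> t\<bar> < r" if "z \<in> ball Q R" for z
      using Cauchy_Schwarz_ineq2[of "z - Q" t] te that R by (simp add: dist_norm norm_minus_commute)
    then show "\<bar>x \<bullet> t - Q \<bullet> t\<bar> < r" "\<bar>y \<bullet> t - Q \<bullet> t\<bar> < r" using that by (auto simp: inner_diff_left)
  qed
  interpret sp: sonic_point \<gamma> K \<Omega>m \<Omega>p \<Gamma> \<phi>m \<phi>p t e Q R \<Lambda> f
    "{x. - f (x \<bullet> t) < x \<bullet> - e} \<inter> ball Q R" "{x. - f (x \<bullet> t) \<le> x \<bullet> - e} \<inter> ball Q R"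
    "{x. f (x \<bullet> t) < x \<bullet> e} \<inter> ball Q R" "{x. f (x \<bullet> t) \<le> x \<bullet> e} \<inter> ball Q R" f' L
  proof (intro sonic_point.intro)
    show m: "flow_side \<gamma> K \<Omega>m (closure \<Omega>m) \<phi>m t (- e) Q R \<Lambda> (\<lambda>x. - f x)
       ({x. - f (x \<bullet> t) < x \<bullet> - e} \<inter> ball Q R) ({x. - f (x \<bullet> t) \<le> x \<bullet> - e} \<inter> ball Q R)"
    proof
      show S: "{x. - f (x \<bullet> t) < x \<bullet> - e} \<inter> ball Q R \<subseteq> \<Omega>m" using sides(2) sub flip by blast
      show "bernoulli K \<Omega>m \<phi>m x > 0" if "x \<in> {x. - f (x \<bullet> t) < x \<bullet> - e} \<inter> ball Q R" for x
      proof (rule posI, rule r1(2))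
        show "x \<in> closure \<Omega>m" using that S closure_subset[of \<Omega>m] by blast
        show "dist x Q < r1" using that R(3) by (simp add: dist_commute)
      qed
      show "{x. - f (x \<bullet> t) \<le> x \<bullet> - e} \<inter> ball Q R \<subseteq> closure \<Omega>m" using closm sub by blast
      show "\<bar>- f (x \<bullet> t) - - f (y \<bullet> t)\<bar> \<le> \<Lambda> * \<bar>x \<bullet> t - y \<bullet> t\<bar>" if "x \<in> ball Q R" "y \<in> ball Q R" for x y
        using Lip[OF that] by linarith
    qed (rule refl \<gamma> C2m flowm te te' \<Lambda>(1))+
    show p: "flow_side \<gamma> K \<Omega>p (\<Omega>p \<union> \<Gamma>) \<phi>p t e Q R \<Lambda> f
       ({x. f (x \<bullet> t) < x \<bullet> e} \<inter> ball Q R) ({x. f (x \<bullet> t) \<le> x \<bullet> e} \<inter> ball Q R)"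
    proof
      show S: "{x. f (x \<bullet> t) < x \<bullet> e} \<inter> ball Q R \<subseteq> \<Omega>p" using sides(1) sub by blast
      show "bernoulli K \<Omega>p \<phi>p x > 0" if "x \<in> {x. f (x \<bullet> t) < x \<bullet> e} \<inter> ball Q R" for x
      proof (rule posI, rule r2(2))
        show "x \<in> \<Omega>p \<union> \<Gamma>" using that S by blast
        show "dist x Q < r2" using that R(4) by (simp add: dist_commute)
      qed
      show "{x. f (x \<bullet> t) \<le> x \<bullet> e} \<inter> ball Q R \<subseteq> \<Omega>p \<union> \<Gamma>" using closp sub by blast
    qed (rule refl \<gamma> C2p flowp te \<Lambda>(1) | (rule Lip; assumption))+
    interpret m: flow_side \<gamma> K \<Omega>m "closure \<Omega>m" \<phi>m t "- e" Q R \<Lambda> "\<lambda>x. - f x"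
       "{x. - f (x \<bullet> t) < x \<bullet> - e} \<inter> ball Q R" "{x. - f (x \<bullet> t) \<le> x \<bullet> - e} \<inter> ball Q R" by (rule m)
    interpret p: flow_side \<gamma> K \<Omega>p "\<Omega>p \<union> \<Gamma>" \<phi>p t e Q R \<Lambda> f
       "{x. f (x \<bullet> t) < x \<bullet> e} \<inter> ball Q R" "{x. f (x \<bullet> t) \<le> x \<bullet> e} \<inter> ball Q R" by (rule p)
    have gm: "grad_from \<Omega>m \<phi>m x = (m.U x, m.V x)" "grad_from \<Omega>p \<phi>p x = (p.U x, p.V x)" for x
      by (simp_all add: grad_from_def m.U_def m.V_def p.U_def p.V_def)
    show "sonic_point_axioms \<gamma> K \<Omega>m \<Omega>p \<Gamma> \<phi>m \<phi>p t e Q R f ({x. f (x \<bullet> t) < x \<bullet> e} \<inter> ball Q R) f' L"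
    proof
      show "\<Gamma> \<inter> ball Q R = {x. f (x \<bullet> t) = x \<bullet> e} \<inter> ball Q R" using \<Gamma> sub by blast
      show "p.U x = m.U x" "p.V x = m.V x" if "x \<in> \<Gamma>" for x
        using on\<Gamma>(2)[OF that] by (simp_all add: gm)
      show "(m.U x)^2 + (m.V x)^2 = m.C x" if "x \<in> \<Gamma>" for x
      proof -
        have "sqrt ((m.U x)^2 + (m.V x)^2) = sqrt (m.C x)"
          using on\<Gamma>(3)[OF that] by (simp add: gm norm_Pair sonic_speed_def m.C_bernoulli)
        then show ?thesis by simp
      qed
      show "(p.U x)^2 + (p.V x)^2 < p.C x" if x: "x \<in> {x. f (x \<bullet> t) < x \<bullet> e} \<inter> ball Q R" for x
      proof -
        have xp: "x \<in> \<Omega>p" using x p.S_sub by blast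
        have "grad \<phi>p x = (p.U x, p.V x)" using xp by (simp add: grad_def p.U_def p.V_def value_from_in)
        then have "sqrt ((p.U x)^2 + (p.V x)^2) < sqrt (p.C x)"
          using subs[OF xp] by (simp add: norm_Pair sonic_speed_def p.C_bernoulli)
        then show ?thesis by simp
      qed
      show "(m.U Q, m.V Q) \<bullet> (t + f' *\<^sub>R e) \<noteq> 0" using nonexceptional by (simp add: W_def gm)
      show "\<bar>f x - f (Q \<bullet> t) - f' * (x - Q \<bullet> t)\<bar> \<le> L * (x - Q \<bullet> t)^2" if "\<bar>x - Q \<bullet> t\<bar> < R" for x
        using L(2)[of x] that R by simp
    qed (rule R(1) Q L(1) on\<Gamma>(1) perp sonic_configuration_disjoint[OF conf] | assumption)+
  qed
  have eqs: "sp.W = W" "sp.\<psi> = \<psi>" "c = sqrt (sp.m.C Q)"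
    by (simp_all add: W_def sp.W_def \<psi>_def sp.\<psi>_def c_def sonic_speed_def sp.m.C_bernoulli)
  show "twice_differentiable_at \<psi> Q" using sp.twice_differentiable unfolding eqs .
  show "v \<bullet> W \<noteq> 0" if "v \<noteq> 0" "v \<bullet> (t + f' *\<^sub>R e) = 0" for v
    using sp.no_tangential_velocity[of v] that unfolding sp.T_def eqs by blast
  show "\<exists>\<epsilon>>0. \<forall>s. \<bar>s\<bar> < \<epsilon> \<longrightarrow> (1 / (\<gamma> + 1) - \<epsilon>0) * ((v \<bullet> W) / c)^2 * s^2 \<le> \<psi> (Q + s *\<^sub>R v)"
    if v: "v \<bullet> W \<noteq> 0" and \<epsilon>0: "\<epsilon>0 > 0" for v \<epsilon>0
  proof -
    obtain \<epsilon> where "\<epsilon> > 0" "\<And>s. \<bar>s\<bar> < \<epsilon> \<Longrightarrow> (1 / (\<gamma> + 1) - \<epsilon>0) * ((v \<bullet> sp.W) / sqrt (sp.m.C Q))^2 * s^2 \<le> sp.\<psi> (Q + s *\<^sub>R v)"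
      using sp.\<psi>_lower_bound[of v, OF _ \<epsilon>0] v unfolding eqs(1) by blast
    then show ?thesis unfolding eqs by blast
  qed
qed

text \<open>The quantifier over \<delta> expresses "sufficiently small": both constants can be taken
  below any prescribed bound.\<close>

theorem lemma6p1:
  fixes \<gamma> K :: real and \<Omega>m \<Omega>p \<Gamma> :: "plane set" and \<phi>m \<phi>p :: "plane \<Rightarrow> real"
    and Q :: plane and \<theta> l1 l2 r \<xi>s :: real and f :: "real \<Rightarrow> real"
  defines "W \<equiv> grad_from \<Omega>m \<phi>m Q"
    and "c \<equiv> sonic_speed \<gamma> K \<Omega>m \<phi>m Q"
    and "\<psi> \<equiv> psi \<Omega>m \<phi>m \<phi>p Q"
    and "n \<equiv> n_vec \<theta> f \<xi>s"
    and "\<tau> \<equiv> tau_vec \<theta> f \<xi>s"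
  assumes "\<gamma> > 1"
    and "sonic_configuration \<gamma> K \<Omega>m \<Omega>p \<Gamma> \<phi>m \<phi>p"
    and "Q \<in> \<Gamma>"
    and "sonic_chart \<Omega>m \<Omega>p \<Gamma> Q \<theta> f l1 l2 r"
    and "l1 < \<xi>s" "\<xi>s < l2" "Q = rot \<theta> (\<xi>s, f \<xi>s)"
    and "\<not> exceptional \<theta> f \<xi>s W"
    and "perp_deriv_c \<gamma> K \<Omega>m \<phi>m Q = 0 \<or> perp_deriv_c \<gamma> K \<Omega>p \<phi>p Q = 0"
  shows "twice_differentiable_at \<psi> Q \<and>
    (\<forall>\<delta>>0. \<exists>\<epsilon> \<epsilon>0. 0 < \<epsilon> \<and> \<epsilon> < \<delta> \<and> 0 < \<epsilon>0 \<and> \<epsilon>0 < \<delta> \<and>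
      (\<forall>t. - \<epsilon> < t \<and> t < \<epsilon> \<longrightarrow>
        \<psi> (Q + t *\<^sub>R n) \<ge> (1 / (\<gamma> + 1) - \<epsilon>0) * ((n \<bullet> W) / c)\<^sup>2 * t\<^sup>2) \<and>
      (\<forall>s. - \<epsilon> < s \<and> s < \<epsilon> \<longrightarrow>
        \<psi> (Q + s *\<^sub>R \<tau>) \<ge> (1 / (\<gamma> + 1) - \<epsilon>0) * ((\<tau> \<bullet> W) / c)\<^sup>2 * s\<^sup>2))"
proof -
  note \<gamma> = assms(6) and conf = assms(7) and Q = assms(8) and chart = assms(9) and \<xi>s = assms(10,11) and Qeq = assms(12)
    and nonexc = assms(13) and perp = assms(14)
  define t where "t = rot \<theta> (1, 0)"
  define e where "e = rot \<theta> (0, 1)"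
  note te = rot_orthonormal[of \<theta>, folded t_def e_def]
  define f' where "f' = deriv f \<xi>s"
  note ch = chart[unfolded sonic_chart_def]
  have r: "r > 0" using ch by (elim conjE)
  have C11: "C11_on l1 l2 f" using ch by (elim conjE)
  have \<Gamma>: "\<Gamma> \<inter> ball Q r = {rot \<theta> (\<xi>, f \<xi>) | \<xi>. l1 < \<xi> \<and> \<xi> < l2} \<inter> ball Q r" using ch by (elim conjE)
  have sides: "let below = {rot \<theta> (\<xi>, \<eta>) | \<xi> \<eta>. l1 < \<xi> \<and> \<xi> < l2 \<and> \<eta> < f \<xi>} \<inter> ball Q r;
          above = {rot \<theta> (\<xi>, \<eta>) | \<xi> \<eta>. l1 < \<xi> \<and> \<xi> < l2 \<and> f \<xi> < \<eta>} \<inter> ball Q r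
      in below \<subseteq> \<Omega>m \<and> above \<subseteq> \<Omega>p \<or> below \<subseteq> \<Omega>p \<and> above \<subseteq> \<Omega>m" using ch by (elim conjE)
  have Qt: "Q \<bullet> t = \<xi>s" "Q \<bullet> e = f \<xi>s" unfolding Qeq t_def e_def rot_coords by simp_all
  obtain \<rho> \<Lambda> L where \<rho>: "\<rho> > 0" "\<Lambda> \<ge> 0" "L \<ge> 0" "l1 < \<xi>s - \<rho>" "\<xi>s + \<rho> < l2"
    and Lip: "\<And>x y. \<bar>x - \<xi>s\<bar> \<le> \<rho> \<Longrightarrow> \<bar>y - \<xi>s\<bar> \<le> \<rho> \<Longrightarrow> \<bar>f x - f y\<bar> \<le> \<Lambda> * \<bar>x - y\<bar>"
    and quad: "\<And>x. \<bar>x - \<xi>s\<bar> \<le> \<rho> \<Longrightarrow> \<bar>f x - f \<xi>s - f' * (x - \<xi>s)\<bar> \<le> L * (x - \<xi>s)^2"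
    using C11_local_bounds[OF C11 \<xi>s] unfolding f'_def by blast
  define R where "R = min r \<rho>"
  have R: "R > 0" "R \<le> r" "R \<le> \<rho>" using r \<rho> by (auto simp: R_def)
  have inv: "x = rot \<theta> (x \<bullet> t, x \<bullet> e)" for x unfolding t_def e_def by (rule rot_inv)
  have strip: "l1 < x \<bullet> t \<and> x \<bullet> t < l2" if "x \<in> ball Q R" for x
  proof -
    have "\<bar>(x - Q) \<bullet> t\<bar> < \<rho>"
      using Cauchy_Schwarz_ineq2[of "x - Q" t] te that R by (simp add: dist_norm norm_minus_commute)
    then show ?thesis using \<rho>(4,5) by (simp add: inner_diff_left Qt abs_less_iff)
  qed
  \<comment> \<open>The smaller ball lies over the interval \<open>(l1, l2)\<close>, so the range
    condition of the chart is automatic and membership depends on the two coordinates alone.\<close>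
  have mem: "x \<in> {rot \<theta> (\<xi>, \<eta>) | \<xi> \<eta>. l1 < \<xi> \<and> \<xi> < l2 \<and> P \<xi> \<eta>} \<longleftrightarrow> P (x \<bullet> t) (x \<bullet> e)" if "x \<in> ball Q R" for x P
  proof
    assume "x \<in> {rot \<theta> (\<xi>, \<eta>) | \<xi> \<eta>. l1 < \<xi> \<and> \<xi> < l2 \<and> P \<xi> \<eta>}"
    then obtain \<xi> \<eta> where "x = rot \<theta> (\<xi>, \<eta>)" "P \<xi> \<eta>" by blast
    then show "P (x \<bullet> t) (x \<bullet> e)" unfolding t_def e_def by (simp add: rot_coords)
  next
    assume "P (x \<bullet> t) (x \<bullet> e)"
    then show "x \<in> {rot \<theta> (\<xi>, \<eta>) | \<xi> \<eta>. l1 < \<xi> \<and> \<xi> < l2 \<and> P \<xi> \<eta>}" using inv[of x] strip[OF that] by blast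
  qed
  have graph: "\<Gamma> \<inter> ball Q R = {x. f (x \<bullet> t) = x \<bullet> e} \<inter> ball Q R"
  proof -
    have "{rot \<theta> (\<xi>, f \<xi>) | \<xi>. l1 < \<xi> \<and> \<xi> < l2} = {rot \<theta> (\<xi>, \<eta>) | \<xi> \<eta>. l1 < \<xi> \<and> \<xi> < l2 \<and> f \<xi> = \<eta>}" by blast
    then have \<Gamma>': "\<Gamma> \<inter> ball Q r = {rot \<theta> (\<xi>, \<eta>) | \<xi> \<eta>. l1 < \<xi> \<and> \<xi> < l2 \<and> f \<xi> = \<eta>} \<inter> ball Q r"
      using \<Gamma> by simp
    have "x \<in> \<Gamma> \<longleftrightarrow> f (x \<bullet> t) = x \<bullet> e" if x: "x \<in> ball Q R" for x
    proof -
      have xr: "x \<in> ball Q r" using x R(2) by simp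
      then have "x \<in> \<Gamma> \<longleftrightarrow> x \<in> \<Gamma> \<inter> ball Q r" by simp
      also have "\<dots> \<longleftrightarrow> x \<in> {rot \<theta> (\<xi>, \<eta>) | \<xi> \<eta>. l1 < \<xi> \<and> \<xi> < l2 \<and> f \<xi> = \<eta>}"
        unfolding \<Gamma>' using xr by (simp only: Int_iff simp_thms)
      also have "\<dots> \<longleftrightarrow> f (x \<bullet> t) = x \<bullet> e" by (rule mem[OF x])
      finally show ?thesis .
    qed
    then show ?thesis by blast
  qed
  have W_T: "W \<bullet> (t + f' *\<^sub>R e) \<noteq> 0"
    using nonexc unfolding exceptional_def rot_Pair[of \<theta> 1 "deriv f \<xi>s"] by (simp add: t_def e_def f'_def)
  define P where "P \<longleftrightarrow> twice_differentiable_at \<psi> Q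
    \<and> (\<forall>v. v \<noteq> 0 \<longrightarrow> v \<bullet> (t + f' *\<^sub>R e) = 0 \<longrightarrow> v \<bullet> W \<noteq> 0)
    \<and> (\<forall>v \<epsilon>0. v \<bullet> W \<noteq> 0 \<longrightarrow> \<epsilon>0 > 0 \<longrightarrow>
      (\<exists>\<epsilon>>0. \<forall>s. \<bar>s\<bar> < \<epsilon> \<longrightarrow> (1 / (\<gamma> + 1) - \<epsilon>0) * ((v \<bullet> W) / c)^2 * s^2 \<le> \<psi> (Q + s *\<^sub>R v)))"
  have P
  proof -
    consider "{x. f (x \<bullet> t) < x \<bullet> e} \<inter> ball Q R \<subseteq> \<Omega>p" "{x. x \<bullet> e < f (x \<bullet> t)} \<inter> ball Q R \<subseteq> \<Omega>m"
      | "{x. f (x \<bullet> t) < x \<bullet> e} \<inter> ball Q R \<subseteq> \<Omega>m" "{x. x \<bullet> e < f (x \<bullet> t)} \<inter> ball Q R \<subseteq> \<Omega>p"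
    proof -
      define Bl where "Bl = {rot \<theta> (\<xi>, \<eta>) | \<xi> \<eta>. l1 < \<xi> \<and> \<xi> < l2 \<and> \<eta> < f \<xi>} \<inter> ball Q r"
      define Ab where "Ab = {rot \<theta> (\<xi>, \<eta>) | \<xi> \<eta>. l1 < \<xi> \<and> \<xi> < l2 \<and> f \<xi> < \<eta>} \<inter> ball Q r"
      have sides': "Bl \<subseteq> \<Omega>m \<and> Ab \<subseteq> \<Omega>p \<or> Bl \<subseteq> \<Omega>p \<and> Ab \<subseteq> \<Omega>m"
        using sides unfolding Let_def Bl_def Ab_def .
      have big: "x \<in> ball Q r" if "x \<in> ball Q R" for x using that R(2) by simp
      have "{x. x \<bullet> e < f (x \<bullet> t)} \<inter> ball Q R \<subseteq> Bl"
      proof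
        fix x assume x: "x \<in> {x. x \<bullet> e < f (x \<bullet> t)} \<inter> ball Q R"
        have xR: "x \<in> ball Q R" "x \<bullet> e < f (x \<bullet> t)" using x by simp_all
        show "x \<in> Bl" unfolding Bl_def
          by (rule IntI, rule mem[OF xR(1), of "\<lambda>\<xi> \<eta>. \<eta> < f \<xi>", THEN iffD2], rule xR(2), rule big, rule xR(1))
      qed
      moreover have "{x. f (x \<bullet> t) < x \<bullet> e} \<inter> ball Q R \<subseteq> Ab"
      proof
        fix x assume x: "x \<in> {x. f (x \<bullet> t) < x \<bullet> e} \<inter> ball Q R"
        have xR: "x \<in> ball Q R" "f (x \<bullet> t) < x \<bullet> e" using x by simp_all
        show "x \<in> Ab" unfolding Ab_def
          by (rule IntI, rule mem[OF xR(1), of "\<lambda>\<xi> \<eta>. f \<xi> < \<eta>", THEN iffD2], rule xR(2), rule big, rule xR(1))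
      qed
      ultimately show thesis using sides' that by (elim disjE conjE) (blast intro: order_trans)+
    qed
    then show P
    proof cases
      case 1
      have A: "\<bar>f x - f y\<bar> \<le> \<Lambda> * \<bar>x - y\<bar>" if "\<bar>x - Q \<bullet> t\<bar> < R" "\<bar>y - Q \<bullet> t\<bar> < R" for x y
        using Lip[of x y] that R(3) unfolding Qt by linarith
      have B: "\<bar>f x - f (Q \<bullet> t) - f' * (x - Q \<bullet> t)\<bar> \<le> L * (x - Q \<bullet> t)^2" if "\<bar>x - Q \<bullet> t\<bar> < R" for x
        using quad[of x] that R(3) unfolding Qt by linarith
      note b = sonic_point_behaviour[where f=f and f'=f', OF \<gamma> conf Q te R(1) graph 1 \<rho>(2) A \<rho>(3) B W_T[unfolded W_def] perp]
      show P unfolding P_def W_def \<psi>_def c_def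
        by (intro conjI allI impI; (rule b(1) | (rule b(2); assumption) | (rule b(3); assumption)))
    next
      case 2
      \<comment> \<open>The subsonic side now lies below the graph. Changing the signs of
        \<open>e\<close>, \<open>f\<close> and \<open>f'\<close> exchanges upper and lower side and
        preserves the tangent.\<close>
      have te': "norm (- e) = 1" "t \<bullet> (- e) = 0" using te by simp_all
      have W_T': "grad_from \<Omega>m \<phi>m Q \<bullet> (t + (- f') *\<^sub>R (- e)) \<noteq> 0" using W_T by (simp add: W_def)
      have graph': "\<Gamma> \<inter> ball Q R = {x. (\<lambda>z. - f z) (x \<bullet> t) = x \<bullet> (- e)} \<inter> ball Q R" using graph by auto
      have sides': "{x. (\<lambda>z. - f z) (x \<bullet> t) < x \<bullet> (- e)} \<inter> ball Q R \<subseteq> \<Omega>p"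
        "{x. x \<bullet> (- e) < (\<lambda>z. - f z) (x \<bullet> t)} \<inter> ball Q R \<subseteq> \<Omega>m" using 2 by auto
      have A: "\<bar>- f x - - f y\<bar> \<le> \<Lambda> * \<bar>x - y\<bar>" if "\<bar>x - Q \<bullet> t\<bar> < R" "\<bar>y - Q \<bullet> t\<bar> < R" for x y
        using Lip[of x y] that R(3) unfolding Qt by linarith
      have B: "\<bar>- f x - - f (Q \<bullet> t) - (- f') * (x - Q \<bullet> t)\<bar> \<le> L * (x - Q \<bullet> t)^2" if "\<bar>x - Q \<bullet> t\<bar> < R" for x
      proof -
        have "- f x - - f (Q \<bullet> t) - (- f') * (x - Q \<bullet> t) = - (f x - f (Q \<bullet> t) - f' * (x - Q \<bullet> t))" by simp
        then show ?thesis using quad[of x] that R(3) unfolding Qt abs_minus_cancel by (simp only: abs_minus_cancel)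
      qed
      note b = sonic_point_behaviour[where f="\<lambda>z. - f z" and f'="- f'", OF \<gamma> conf Q te(1) te' R(1) graph' sides' \<rho>(2) A \<rho>(3) B W_T' perp,
          unfolded scaleR_minus_left scaleR_minus_right minus_minus]
      show P unfolding P_def W_def \<psi>_def c_def
        by (intro conjI allI impI; (rule b(1) | (rule b(2); assumption) | (rule b(3); assumption)))
    qed
  qed
  have \<tau>: "\<tau> = (1 / sqrt (1 + f'^2)) *\<^sub>R (t + f' *\<^sub>R e)"
    unfolding \<tau>_def tau_vec_def rot_scaleR rot_Pair[of \<theta> 1 "deriv f \<xi>s"] by (simp add: t_def e_def f'_def)
  have n: "n = (1 / sqrt (1 + f'^2)) *\<^sub>R (f' *\<^sub>R t - e)"
    unfolding n_def n_vec_def rot_scaleR rot_Pair[of \<theta> "deriv f \<xi>s" "- 1"] by (simp add: t_def e_def f'_def)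
  have sq: "1 / sqrt (1 + f'^2) \<noteq> 0" by (simp add: add_nonneg_eq_0_iff)
  have tt: "t \<bullet> t = 1" "e \<bullet> e = 1" "e \<bullet> t = 0" using te by (simp_all add: dot_square_norm inner_commute)
  \<comment> \<open>For the tangential direction this is non-exceptionality itself; the normal
    direction rests on the exclusion of a tangential velocity.\<close>
  have "\<tau> \<bullet> W \<noteq> 0" using W_T sq unfolding \<tau> by (simp add: inner_commute)
  moreover have "n \<bullet> W \<noteq> 0"
  proof -
    have "(f' *\<^sub>R t - e) \<bullet> (t + f' *\<^sub>R e) = 0"
      using te(3) tt by (simp add: inner_diff_left inner_add_right)
    then have "n \<bullet> (t + f' *\<^sub>R e) = 0" unfolding n by simp
    moreover have "(f' *\<^sub>R t - e) \<bullet> e = - 1" using te(3) tt by (simp add: inner_diff_left)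
    then have "n \<noteq> 0" using sq unfolding n by auto
    ultimately show ?thesis using \<open>P\<close> unfolding P_def by blast
  qed
  ultimately have ex: "\<exists>\<epsilon>>0. \<forall>s. \<bar>s\<bar> < \<epsilon> \<longrightarrow> (1 / (\<gamma> + 1) - \<epsilon>0) * ((v \<bullet> W) / c)^2 * s^2 \<le> \<psi> (Q + s *\<^sub>R v)"
    if "\<epsilon>0 > 0" "v \<in> {n, \<tau>}" for v \<epsilon>0
    using \<open>P\<close> that unfolding P_def by blast
  show ?thesis
  proof (intro conjI allI impI)
    show "twice_differentiable_at \<psi> Q" using \<open>P\<close> unfolding P_def by blast
    fix \<delta> :: real assume \<delta>: "\<delta> > 0"
    obtain \<epsilon>1 where \<epsilon>1: "\<epsilon>1 > 0" "\<And>s. \<bar>s\<bar> < \<epsilon>1 \<Longrightarrow> (1 / (\<gamma> + 1) - \<delta> / 2) * ((n \<bullet> W) / c)^2 * s^2 \<le> \<psi> (Q + s *\<^sub>R n)"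
      using ex[of "\<delta> / 2" n] \<delta> by auto
    obtain \<epsilon>2 where \<epsilon>2: "\<epsilon>2 > 0" "\<And>s. \<bar>s\<bar> < \<epsilon>2 \<Longrightarrow> (1 / (\<gamma> + 1) - \<delta> / 2) * ((\<tau> \<bullet> W) / c)^2 * s^2 \<le> \<psi> (Q + s *\<^sub>R \<tau>)"
      using ex[of "\<delta> / 2" \<tau>] \<delta> by auto
    define \<epsilon> where "\<epsilon> = min (\<delta> / 2) (min \<epsilon>1 \<epsilon>2)"
    have \<epsilon>: "0 < \<epsilon>" "\<epsilon> < \<delta>" "\<epsilon> \<le> \<epsilon>1" "\<epsilon> \<le> \<epsilon>2" using \<delta> \<epsilon>1 \<epsilon>2 by (auto simp: \<epsilon>_def min_def)
    show "\<exists>\<epsilon> \<epsilon>0. 0 < \<epsilon> \<and> \<epsilon> < \<delta> \<and> 0 < \<epsilon>0 \<and> \<epsilon>0 < \<delta> \<and>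
      (\<forall>t. - \<epsilon> < t \<and> t < \<epsilon> \<longrightarrow>
        \<psi> (Q + t *\<^sub>R n) \<ge> (1 / (\<gamma> + 1) - \<epsilon>0) * ((n \<bullet> W) / c)^2 * t^2) \<and>
      (\<forall>s. - \<epsilon> < s \<and> s < \<epsilon> \<longrightarrow>
        \<psi> (Q + s *\<^sub>R \<tau>) \<ge> (1 / (\<gamma> + 1) - \<epsilon>0) * ((\<tau> \<bullet> W) / c)^2 * s^2)"
    proof (rule exI[of _ \<epsilon>], rule exI[of _ "\<delta> / 2"], intro conjI allI impI)
      fix s assume "- \<epsilon> < s \<and> s < \<epsilon>"
      then have s: "\<bar>s\<bar> < \<epsilon>1" "\<bar>s\<bar> < \<epsilon>2" using \<epsilon> by auto
      show "(1 / (\<gamma> + 1) - \<delta> / 2) * ((n \<bullet> W) / c)^2 * s^2 \<le> \<psi> (Q + s *\<^sub>R n)" by (rule \<epsilon>1(2)[OF s(1)])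
      show "(1 / (\<gamma> + 1) - \<delta> / 2) * ((\<tau> \<bullet> W) / c)^2 * s^2 \<le> \<psi> (Q + s *\<^sub>R \<tau>)" by (rule \<epsilon>2(2)[OF s(2)])
    qed (use \<epsilon> \<delta> in auto)
  qed
qed

end
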